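(* $r$-\textsc{Grouped Dominating Set} is fixed-parameter tractable when parameterized by the modular-width of the input graph.
   Context: An $r$-grouped dominating set with $k$ units in a graph $G=(V,E)$ is a family $\{D_1,\dots,D_k\}$ of mutually disjoint subsets of $V$ with $|D_i|=r$, $G[D_i]$ connected for each $i$, and $\bigcup_i D_i$ a dominating set of $G$. The problem $r$-\textsc{Grouped Dominating Set} takes a graph $G$ and positive integers $r,k$ and asks whether $G$ has an $r$-grouped dominating set with at most $k$ units. A set $M\subseteq V$ is a module of $G$ if for each $v\in V\setminus M$, either $M\subseteq N(v)$ or $M\cap N(v)=\emptyset$. The modular-width $\mathrm{mw}(G)$ is the minimum integer $k$ such that either $|V|\le k$, or there is a partition of $V$ into at most $k$ modules $M_1,\dots,M_{k'}$ of $G$ such that each $G[M_i]$ has modular-width at most $k$. *)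

theory Defs
  imports "Graph_Theory.Graph_Theory" "HOL-Library.Disjoint_Sets"
begin

section \<open>Model of computation\<close>

text \<open>
  A first-order, call-by-value functional language over binary trees (pure first-order LISP; the
  language F of Jones, \<^emph>\<open>Computability and Complexity from a Programming Perspective\<close>, with several
  functions of several arguments).
  Every evaluation step has unit cost. Since trees can only be built by pairing existing trees and
  inspected by testing for a leaf, an implementation with shared subtrees performs each step in
  constant time on a pointer machine; the model therefore simulates, and is simulated by,
  multitape Turing machines with polynomial overhead.
\<close>

datatype tree = Leaf | Node tree tree

primrec left :: "tree \<Rightarrow> tree" where
  "left Leaf = Leaf"
| "left (Node a b) = a"

primrec right :: "tree \<Rightarrow> tree" where
  "right Leaf = Leaf"
| "right (Node a b) = b"

primrec tree_size :: "tree \<Rightarrow> nat" where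
  "tree_size Leaf = 1"
| "tree_size (Node a b) = 1 + tree_size a + tree_size b"

text \<open>
  \<open>EVar i\<close> is the \<open>i\<close>-th argument of the function whose body is being evaluated, \<open>EIf\<close> takes its
  first branch on every tree other than \<open>Leaf\<close>, and \<open>ECall j es\<close> calls the \<open>j\<close>-th function of
  the program.
\<close>

datatype expr =
    EVar nat
  | ELeaf
  | ENode expr expr
  | ELeft expr
  | ERight expr
  | EIf expr expr expr
  | ECall nat "expr list"

text \<open>A program is a main expression together with the bodies of its functions.\<close>

type_synonym program = "expr \<times> expr list"

text \<open>
  \<open>eval fs env e v t\<close>: with function bodies \<open>fs\<close> and argument values \<open>env\<close>, the expression
  \<open>e\<close> evaluates to \<open>v\<close> in exactly \<open>t\<close> steps.
\<close>

inductive eval :: "expr list \<Rightarrow> tree list \<Rightarrow> expr \<Rightarrow> tree \<Rightarrow> nat \<Rightarrow> bool"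
  and evals :: "expr list \<Rightarrow> tree list \<Rightarrow> expr list \<Rightarrow> tree list \<Rightarrow> nat \<Rightarrow> bool"
  for fs :: "expr list" where
  Var: "i < length env \<Longrightarrow> eval fs env (EVar i) (env ! i) 1"
| Leaf: "eval fs env ELeaf Leaf 1"
| Node: "eval fs env e1 v1 t1 \<Longrightarrow> eval fs env e2 v2 t2 \<Longrightarrow>
    eval fs env (ENode e1 e2) (Node v1 v2) (t1 + t2 + 1)"
| Left: "eval fs env e v t \<Longrightarrow> eval fs env (ELeft e) (left v) (t + 1)"
| Right: "eval fs env e v t \<Longrightarrow> eval fs env (ERight e) (right v) (t + 1)"
| IfTrue: "eval fs env e v t \<Longrightarrow> v \<noteq> Leaf \<Longrightarrow> eval fs env e1 v1 t1 \<Longrightarrow>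
    eval fs env (EIf e e1 e2) v1 (t + t1 + 1)"
| IfFalse: "eval fs env e Leaf t \<Longrightarrow> eval fs env e2 v2 t2 \<Longrightarrow>
    eval fs env (EIf e e1 e2) v2 (t + t2 + 1)"
| Call: "j < length fs \<Longrightarrow> evals fs env es vs t \<Longrightarrow> eval fs vs (fs ! j) v t' \<Longrightarrow>
    eval fs env (ECall j es) v (t + t' + 1)"
| Nil: "evals fs env [] [] 0"
| Cons: "eval fs env e v t \<Longrightarrow> evals fs env es vs t' \<Longrightarrow>
    evals fs env (e # es) (v # vs) (t + t')"

inductive_cases eval_cases:
  "eval fs env (EVar i) v t" "eval fs env ELeaf v t" "eval fs env (ENode e1 e2) v t"
  "eval fs env (ELeft e) v t" "eval fs env (ERight e) v t" "eval fs env (EIf e e1 e2) v t"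
  "eval fs env (ECall j es) v t" "evals fs env [] vs t" "evals fs env (e # es) vs t"

lemma eval_deterministic:
  "eval fs env e v t \<Longrightarrow> eval fs env e v' t' \<Longrightarrow> v' = v \<and> t' = t"
  "evals fs env es vs t \<Longrightarrow> evals fs env es vs' t' \<Longrightarrow> vs' = vs \<and> t' = t"
  by (induction arbitrary: v' t' and vs' t' rule: eval_evals.inducts)
    (erule eval_cases; metis One_nat_def Suc_eq_plus1)+

definition runs_in :: "program \<Rightarrow> tree \<Rightarrow> tree \<Rightarrow> nat \<Rightarrow> bool" where
  "runs_in p x y t \<longleftrightarrow> eval (snd p) [x] (fst p) y t"


section \<open>Encodings\<close>

primrec encode_bool :: "bool \<Rightarrow> tree" where
  "encode_bool False = Leaf"
| "encode_bool True = Node Leaf Leaf"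

primrec encode_list :: "tree list \<Rightarrow> tree" where
  "encode_list [] = Leaf"
| "encode_list (x # xs) = Node x (encode_list xs)"

text \<open>Numbers are encoded in binary, least significant bit first.\<close>

fun bits :: "nat \<Rightarrow> bool list" where
  "bits n = (if n = 0 then [] else odd n # bits (n div 2))"

declare bits.simps [simp del]

definition encode_nat :: "nat \<Rightarrow> tree" where
  "encode_nat n = encode_list (map encode_bool (bits n))"

lemma encode_bool_inject [simp]: "encode_bool a = encode_bool b \<longleftrightarrow> a = b"
  by (cases a; cases b) auto

lemma encode_list_inject [simp]: "encode_list xs = encode_list ys \<longleftrightarrow> xs = ys"
proof (induction xs arbitrary: ys)
  case Nil
  then show ?case by (cases ys) auto
next
  case (Cons x xs)
  then show ?case by (cases ys) auto
qed

lemma bits_inject: "bits m = bits n \<Longrightarrow> m = n"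
proof (induction m arbitrary: n rule: bits.induct)
  case (1 m)
  show ?case
  proof (cases "m = 0 \<or> n = 0")
    case True
    then show ?thesis using "1.prems" by (auto simp: bits.simps split: if_splits)
  next
    case False
    then have *: "odd m = odd n" "bits (m div 2) = bits (n div 2)"
      using "1.prems" by (auto simp: bits.simps[of m] bits.simps[of n])
    then have "m div 2 = n div 2" using "1.IH" False by blast
    then show ?thesis using *(1) by presburger
  qed
qed

lemma encode_nat_inject [simp]: "encode_nat m = encode_nat n \<longleftrightarrow> m = n"
proof -
  have "inj encode_bool" by (rule injI) simp
  then show ?thesis by (auto simp: encode_nat_def inj_map_eq_map dest: bits_inject)
qed


section \<open>Fixed-parameter tractability\<close>

definition computable :: "(nat \<Rightarrow> nat) \<Rightarrow> bool" where
  "computable f \<longleftrightarrow> (\<exists>p. \<forall>n. \<exists>t. runs_in p (encode_nat n) (encode_nat (f n)) t)"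

text \<open>
  The decision problem with instances \<open>I\<close> (presented to the program through \<open>enc\<close>), yes-instances
  \<open>{x \<in> I. Q x}\<close> and parameterization \<open>\<kappa>\<close>. The value of the parameter is not given to the
  program.
\<close>

definition fixed_parameter_tractable ::
    "'i set \<Rightarrow> ('i \<Rightarrow> tree) \<Rightarrow> ('i \<Rightarrow> bool) \<Rightarrow> ('i \<Rightarrow> nat) \<Rightarrow> bool" where
  "fixed_parameter_tractable I enc Q \<kappa> \<longleftrightarrow>
     (\<exists>p f c. computable f \<and>
        (\<forall>x \<in> I. \<exists>t. runs_in p (enc x) (encode_bool (Q x)) t \<and>
                     t \<le> f (\<kappa> x) * tree_size (enc x) ^ c))"


section \<open>Grouped domination\<close>

definition dominating_set :: "('a, 'b) pre_digraph \<Rightarrow> 'a set \<Rightarrow> bool" where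
  "dominating_set G S \<longleftrightarrow>
     S \<subseteq> verts G \<and> (\<forall>v \<in> verts G. v \<in> S \<or> (\<exists>u \<in> S. u \<rightarrow>\<^bsub>G\<^esub> v))"

definition grouped_dominating_set ::
    "nat \<Rightarrow> nat \<Rightarrow> ('a, 'b) pre_digraph \<Rightarrow> 'a set set \<Rightarrow> bool" where
  "grouped_dominating_set r k G \<D> \<longleftrightarrow>
     finite \<D> \<and> card \<D> = k \<and> disjoint \<D> \<and>
     (\<forall>D \<in> \<D>. D \<subseteq> verts G \<and> card D = r \<and> connected (G \<restriction> D)) \<and>
     dominating_set G (\<Union>\<D>)"


section \<open>Modular-width\<close>

definition neighbourhood :: "('a, 'b) pre_digraph \<Rightarrow> 'a \<Rightarrow> 'a set" where
  "neighbourhood G v = {u. v \<rightarrow>\<^bsub>G\<^esub> u}"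

definition is_module :: "('a, 'b) pre_digraph \<Rightarrow> 'a set \<Rightarrow> bool" where
  "is_module G M \<longleftrightarrow> M \<subseteq> verts G \<and>
     (\<forall>v \<in> verts G - M. M \<subseteq> neighbourhood G v \<or> M \<inter> neighbourhood G v = {})"

text \<open>
  The recursion in the definition of modular-width is read as a least fixed point: the partition
  into the single module \<open>verts G\<close>, for which it would be circular, contributes nothing.
\<close>

inductive modular_width_le :: "('a, 'b) pre_digraph \<Rightarrow> nat \<Rightarrow> bool" where
  small: "card (verts G) \<le> k \<Longrightarrow> modular_width_le G k"
| modules: "partition_on (verts G) P \<Longrightarrow> finite P \<Longrightarrow> card P \<le> k \<Longrightarrow>
    (\<And>M. M \<in> P \<Longrightarrow> is_module G M) \<Longrightarrow>
    (\<And>M. M \<in> P \<Longrightarrow> modular_width_le (G \<restriction> M) k) \<Longrightarrow>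
    modular_width_le G k"

definition modular_width :: "('a, 'b) pre_digraph \<Rightarrow> nat" where
  "modular_width G = (LEAST k. modular_width_le G k)"


section \<open>The decision problem\<close>

text \<open>
  An instance \<open>(G, r, k)\<close> consists of a finite simple undirected graph (a symmetric loop-free
  digraph) whose \<open>n\<close> vertices are numbered \<open>0, \<dots>, n - 1\<close> and two positive integers; the graph is
  encoded by its adjacency matrix.
\<close>

type_synonym gds_instance = "nat pair_pre_digraph \<times> nat \<times> nat"

definition gds_instances :: "gds_instance set" where
  "gds_instances =
     {(G, r, k). pair_graph G \<and> pverts G = {..<card (pverts G)} \<and> r > 0 \<and> k > 0}"

definition encode_graph :: "nat pair_pre_digraph \<Rightarrow> tree" where
  "encode_graph G =
     (let n = card (pverts G)
      in encode_list (map (\<lambda>i. encode_list (map (\<lambda>j. encode_bool ((i, j) \<in> parcs G)) [0..<n])) [0..<n]))"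

definition encode_gds :: "gds_instance \<Rightarrow> tree" where
  "encode_gds = (\<lambda>(G, r, k). Node (encode_graph G) (Node (encode_nat r) (encode_nat k)))"

lemma encode_gds_inj: "inj_on encode_gds gds_instances"
proof -
  have "G = H"
    if G: "pair_graph G" "pverts G = {..<card (pverts G)}"
      and H: "pair_graph H" "pverts H = {..<card (pverts H)}"
      and eq: "encode_graph G = encode_graph H" for G H
  proof -
    have n: "card (pverts G) = card (pverts H)"
      using eq[unfolded encode_graph_def Let_def encode_list_inject, THEN arg_cong[of _ _ length]]
      by simp
    have same: "(i, j) \<in> parcs G \<longleftrightarrow> (i, j) \<in> parcs H"
      if "i < card (pverts H)" "j < card (pverts H)" for i j
      using eq that unfolding encode_graph_def Let_def n by simp
    have range: "i < card (pverts K) \<and> j < card (pverts K)"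
      if "pair_graph K" "pverts K = {..<card (pverts K)}" "(i, j) \<in> parcs K" for K i j
    proof -
      interpret pair_graph K by fact
      show ?thesis using wellformed'[OF that(3)] that(2) by (metis lessThan_iff)
    qed
    have "(i, j) \<in> parcs G \<longleftrightarrow> (i, j) \<in> parcs H" for i j
      using same[of i j] range[OF G, of i j] range[OF H, of i j] n by metis
    then have "parcs G = parcs H" by (intro set_eqI) (simp add: split_paired_all)
    moreover have "pverts G = pverts H" using G(2) H(2) n by metis
    ultimately show "G = H" by simp
  qed
  then show ?thesis by (simp add: inj_on_def gds_instances_def encode_gds_def split_paired_all)
qed

definition gds_yes :: "gds_instance \<Rightarrow> bool" where
  "gds_yes = (\<lambda>(G, r, k). \<exists>k' \<le> k. \<exists>\<D>. grouped_dominating_set r k' (with_proj G) \<D>)"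

end

theory Submission
  imports Defs
begin

text \<open>
  Only one level of the modular decomposition is needed. Let \<open>C\<close> be a connected component, partitioned
  into modules in the coarsest nontrivial way, which gives at most \<open>mw\<close> modules. If a unit with
  \<open>r \<ge> 2\<close> vertices lies inside a single module, then either a vertex of an adjacent module is free
  and can be exchanged for one of its vertices, or all adjacent modules are fully used and the unit
  is superfluous. So in an optimal solution every unit meets two adjacent modules, a module that is
  hit is dominated from a neighbouring one, and two units never hit the same set of modules. The
  solution is therefore described by a set of sets of modules, for which there are \<open>2 ^ 2 ^ mw\<close>
  possibilities, and whether such a description can be realised by disjoint units of size \<open>r\<close> is a
  transport problem that is decided by a Hall condition over all sets of modules. For \<open>r = 1\<close> the
  same description works if the representative of a module is universal in it whenever possible.
  The optimal numbers of units of the components add up.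

  On the side of the machine model, functions whose cost is polynomial in a measure of the arguments
  are closed under composition and bounded iteration over lists, so that the algorithm can be
  written as a term of the logic. The enumerations are cut off at the length of a list of length
  \<open>2 ^ 2 ^ mw\<close>, which makes everything except the computation of this list polynomial.
\<close>

section \<open>Implementable functions\<close>

text \<open>The program receives neither the modular width nor a decomposition, so it needs a
  partition that it can compute and that is never finer than the one behind the width. If the
  complement of a component is connected, overlapping proper modules have a proper union. The
  maximal proper modules then form a partition coarser than every nontrivial modular partition, in
  particular the one supplied by the modular width. If the complement is disconnected, maximal
  proper modules may overlap, but a partition into two modules exists, and no nontrivial partition
  has fewer parts. The size of the largest quotient thus replaces the parameter; the proof bounds it
  by the width plus one. One level suffices because a unit that meets several modules forming a
  connected quotient is connected whatever vertices it takes inside them. Only the numbers taken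
  matter: positive in every module hit, with sum \<open>r\<close>. Hence a transport problem whose
  lower bounds make the demand supermodular rather than additive. For \<open>r = 1\<close> a unit
  cannot meet two modules, and whether it dominates its own module depends on the vertex chosen
  there.\<close>

text \<open>Missing arguments read as \<open>Leaf\<close>, so functions of environments are total
  and no arity has to be tracked.\<close>

definition arg :: "tree list \<Rightarrow> nat \<Rightarrow> tree" where
  "arg e i = (if i < length e then e ! i else Leaf)"

lemma arg_simps [simp]:
  "arg (x # e) 0 = x" "arg (x # e) (Suc i) = arg e i" "arg (drop m e) i = arg e (m + i)"
  by (auto simp: arg_def add.commute)

lemma arg_numeral [simp]: "arg (x # e) (numeral k) = arg e (pred_numeral k)" "arg (x # y # e) 1 = y"
  by (simp_all add: numeral_eq_Suc)

definition esize :: "tree list \<Rightarrow> nat" where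
  "esize e = sum_list (map tree_size e)"

lemma esize_simps [simp]: "esize [] = 0" "esize (x # e) = tree_size x + esize e"
  by (simp_all add: esize_def)

lemma tree_size_pos [simp]: "0 < tree_size t"
  by (cases t) auto

lemma length_le_esize: "length e \<le> esize e"
  by (induction e) (auto simp: add_mono Suc_le_eq intro: le_less_trans)

lemma tree_size_arg: "tree_size (arg e i) \<le> esize e + 1"
proof (induction e arbitrary: i)
  case Nil
  then show ?case by (simp add: arg_def)
next
  case (Cons a e)
  show ?case
  proof (cases i)
    case (Suc j)
    then show ?thesis using Cons[of j] by simp
  qed simp
qed

primrec tlist :: "tree \<Rightarrow> tree list" where
  "tlist Leaf = []"
| "tlist (Node a b) = a # tlist b"

lemma tlist_encode_list [simp]: "tlist (encode_list xs) = xs"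
  by (induction xs) auto

lemma encode_list_tlist [simp]: "encode_list (tlist t) = t"
  by (induction t) auto

lemma tree_size_conv: "tree_size t = (\<Sum>x\<leftarrow>tlist t. tree_size x + 1) + 1"
  by (induction t) auto

lemma length_tlist_le: "length (tlist t) \<le> tree_size t"
  by (induction t) auto

lemma tree_size_suffix: "tlist t = zs @ ys \<Longrightarrow> (\<Sum>x\<leftarrow>ys. tree_size x + 1) + 1 \<le> tree_size t"
  using tree_size_conv[of t] by simp

lemma tree_size_elem: "x \<in> set (tlist t) \<Longrightarrow> tree_size x \<le> tree_size t"
  by (induction t) (auto simp: trans_le_add1 trans_le_add2 le_SucI)

text \<open>
  The code of a function is placed at offset \<open>k\<close> of the function table, and its expression is
  evaluated with \<open>n\<close> arguments.
\<close>

definition realizes :: "nat \<Rightarrow> nat \<Rightarrow> (tree list \<Rightarrow> nat) \<Rightarrow> (tree list \<Rightarrow> tree) \<Rightarrow> expr \<Rightarrow> expr list \<Rightarrow> bool" where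
  "realizes k n T g e code \<longleftrightarrow> (\<forall>pre post env. length pre = k \<longrightarrow> length env = n \<longrightarrow>
     (\<exists>t \<le> T env. eval (pre @ code @ post) env e (g env) t))"

lemma realizesI:
  "(\<And>pre post env. length pre = k \<Longrightarrow> length env = n \<Longrightarrow>
     \<exists>t \<le> T env. eval (pre @ code @ post) env e (g env) t) \<Longrightarrow> realizes k n T g e code"
  unfolding realizes_def by blast

lemma realizesD:
  "realizes k n T g e code \<Longrightarrow> length pre = k \<Longrightarrow> length env = n \<Longrightarrow>
     \<exists>t \<le> T env. eval (pre @ code @ post) env e (g env) t"
  unfolding realizes_def by blast

text \<open>Calls use absolute indices into the function table, so code is needed for every offset
  \<open>k\<close>. Since \<open>realizes\<close> allows arbitrary code before and after, pieces of
  code can simply be concatenated.\<close>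

definition implements :: "(tree list \<Rightarrow> nat) \<Rightarrow> (tree list \<Rightarrow> tree) \<Rightarrow> bool" where
  "implements T g \<longleftrightarrow> (\<forall>n k. \<exists>e code. realizes k n T g e code)"

lemma implementsI: "(\<And>n k. \<exists>e code. realizes k n T g e code) \<Longrightarrow> implements T g"
  unfolding implements_def by blast

lemma implementsE:
  assumes "implements T g"
  obtains e code where "realizes k n T g e code"
  using assms unfolding implements_def by blast

lemma implements_mono: "implements T g \<Longrightarrow> (\<And>e. T e \<le> T' e) \<Longrightarrow> implements T' g"
  unfolding implements_def realizes_def by (meson le_trans)

section \<open>Code for the constructs of the language\<close>

lemma implements_arg: "implements (\<lambda>e. 1) (\<lambda>e. arg e i)"
proof (rule implementsI)
  fix n k
  have "realizes k n (\<lambda>e. 1) (\<lambda>e. arg e i) (if i < n then EVar i else ELeaf) []"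
    by (rule realizesI)
      (auto simp: arg_def intro!: exI[of _ "Suc 0"] eval_evals.Var[simplified] eval_evals.Leaf[simplified])
  then show "\<exists>e code. realizes k n (\<lambda>e. 1) (\<lambda>e. arg e i) e code" by blast
qed

lemma implements_Leaf: "implements (\<lambda>e. 1) (\<lambda>e. Leaf)"
proof (rule implementsI)
  fix n k
  have "realizes k n (\<lambda>e. 1) (\<lambda>e. Leaf) ELeaf []"
    by (rule realizesI) (auto intro!: exI[of _ "Suc 0"] eval_evals.Leaf[simplified])
  then show "\<exists>e code. realizes k n (\<lambda>e. 1) (\<lambda>e. Leaf) e code" by blast
qed

lemma implements_left:
  assumes "implements T g"
  shows "implements (\<lambda>e. T e + 1) (\<lambda>e. left (g e))"
proof (rule implementsI)
  fix n k
  obtain e code where *: "realizes k n T g e code" using assms by (rule implementsE)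
  have "realizes k n (\<lambda>e. T e + 1) (\<lambda>e. left (g e)) (ELeft e) code"
    using * unfolding realizes_def by (metis add_le_mono1 eval_evals.Left)
  then show "\<exists>e code. realizes k n (\<lambda>e. T e + 1) (\<lambda>e. left (g e)) e code" by blast
qed

lemma implements_right:
  assumes "implements T g"
  shows "implements (\<lambda>e. T e + 1) (\<lambda>e. right (g e))"
proof (rule implementsI)
  fix n k
  obtain e code where *: "realizes k n T g e code" using assms by (rule implementsE)
  have "realizes k n (\<lambda>e. T e + 1) (\<lambda>e. right (g e)) (ERight e) code"
    using * unfolding realizes_def by (metis add_le_mono1 eval_evals.Right)
  then show "\<exists>e code. realizes k n (\<lambda>e. T e + 1) (\<lambda>e. right (g e)) e code" by blast
qed

lemma implements_Node:
  assumes "implements T1 g1" "implements T2 g2"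
  shows "implements (\<lambda>e. T1 e + T2 e + 1) (\<lambda>e. Node (g1 e) (g2 e))" (is "implements ?T ?g")
proof (rule implementsI)
  fix n k
  obtain e1 c1 where 1: "realizes k n T1 g1 e1 c1" using assms(1) by (rule implementsE)
  obtain e2 c2 where 2: "realizes (k + length c1) n T2 g2 e2 c2" using assms(2) by (rule implementsE)
  have "realizes k n ?T ?g (ENode e1 e2) (c1 @ c2)"
  proof (rule realizesI)
    fix pre post :: "expr list" and env :: "tree list"
    assume len: "length pre = k" "length env = n"
    obtain t1 where t1: "t1 \<le> T1 env" "eval (pre @ c1 @ c2 @ post) env e1 (g1 env) t1"
      using realizesD[OF 1 len, of "c2 @ post"] by auto
    obtain t2 where t2: "t2 \<le> T2 env" "eval (pre @ c1 @ c2 @ post) env e2 (g2 env) t2"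
      using realizesD[OF 2, of "pre @ c1" env post] len by auto
    show "\<exists>t \<le> ?T env. eval (pre @ (c1 @ c2) @ post) env (ENode e1 e2) (?g env) t"
      using t1 t2 eval_evals.Node[OF t1(2) t2(2)] by (intro exI[of _ "t1 + t2 + 1"]) simp
  qed
  then show "\<exists>e code. realizes k n ?T ?g e code" by blast
qed

lemma implements_If:
  assumes "implements T0 g0" "implements T1 g1" "implements T2 g2"
  shows "implements (\<lambda>e. T0 e + T1 e + T2 e + 1) (\<lambda>e. if g0 e \<noteq> Leaf then g1 e else g2 e)"
    (is "implements ?T ?g")
proof (rule implementsI)
  fix n k
  obtain e0 c0 where 0: "realizes k n T0 g0 e0 c0" using assms(1) by (rule implementsE)
  obtain e1 c1 where 1: "realizes (k + length c0) n T1 g1 e1 c1" using assms(2) by (rule implementsE)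
  obtain e2 c2 where 2: "realizes (k + length c0 + length c1) n T2 g2 e2 c2"
    using assms(3) by (rule implementsE)
  have "realizes k n ?T ?g (EIf e0 e1 e2) (c0 @ c1 @ c2)"
  proof (rule realizesI)
    fix pre post :: "expr list" and env :: "tree list"
    assume len: "length pre = k" "length env = n"
    let ?fs = "pre @ (c0 @ c1 @ c2) @ post"
    obtain t0 where t0: "t0 \<le> T0 env" "eval ?fs env e0 (g0 env) t0"
      using realizesD[OF 0 len, of "c1 @ c2 @ post"] by auto
    obtain t1 where t1: "t1 \<le> T1 env" "eval ?fs env e1 (g1 env) t1"
      using realizesD[OF 1, of "pre @ c0" env "c2 @ post"] len by auto
    obtain t2 where t2: "t2 \<le> T2 env" "eval ?fs env e2 (g2 env) t2"
      using realizesD[OF 2, of "pre @ c0 @ c1" env post] len by auto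
    show "\<exists>t \<le> ?T env. eval ?fs env (EIf e0 e1 e2) (?g env) t"
    proof (cases "g0 env = Leaf")
      case True
      then show ?thesis using t0 t2 eval_evals.IfFalse[OF _ t2(2)]
        by (intro exI[of _ "t0 + t2 + 1"]) auto
    next
      case False
      then show ?thesis using t0 t1 eval_evals.IfTrue[OF t0(2) _ t1(2)]
        by (intro exI[of _ "t0 + t1 + 1"]) auto
    qed
  qed
  then show "\<exists>e code. realizes k n ?T ?g e code" by blast
qed

lemma implements_evals:
  assumes "\<And>g. g \<in> set gs \<Longrightarrow> implements U g"
  shows "\<exists>es code. \<forall>pre post env. length pre = k \<longrightarrow> length env = n \<longrightarrow>
     (\<exists>t \<le> length gs * U env. evals (pre @ code @ post) env es (map (\<lambda>g. g env) gs) t)"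
  using assms
proof (induction gs arbitrary: k)
  case Nil
  show ?case by (rule exI[of _ "[]"], rule exI[of _ "[]"]) (auto intro: eval_evals.intros)
next
  case (Cons g gs)
  have "implements U g" using Cons.prems by simp
  then obtain e1 c1 where 1: "realizes k n U g e1 c1" by (rule implementsE)
  obtain es c2 where 2: "\<forall>pre post env. length pre = k + length c1 \<longrightarrow> length env = n \<longrightarrow>
     (\<exists>t \<le> length gs * U env. evals (pre @ c2 @ post) env es (map (\<lambda>g. g env) gs) t)"
    using Cons.IH[of "k + length c1"] Cons.prems by auto
  have "\<exists>t \<le> length (g # gs) * U env.
      evals (pre @ (c1 @ c2) @ post) env (e1 # es) (map (\<lambda>g. g env) (g # gs)) t"
    if len: "length pre = k" "length env = n" for pre post env
  proof -
    obtain t1 where t1: "t1 \<le> U env" "eval (pre @ c1 @ c2 @ post) env e1 (g env) t1"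
      using realizesD[OF 1 len, of "c2 @ post"] by auto
    obtain t2 where t2: "t2 \<le> length gs * U env"
        "evals (pre @ c1 @ c2 @ post) env es (map (\<lambda>g. g env) gs) t2"
      using 2[rule_format, of "pre @ c1" env post] len by auto
    show ?thesis
      using t1 t2 eval_evals.Cons[OF t1(2) t2(2)] by (intro exI[of _ "t1 + t2"]) auto
  qed
  then show ?case by blast
qed

text \<open>The called expression becomes the last entry of the emitted code, so its absolute index
  is the offset plus the lengths of the code for the arguments and of the code that it uses
  itself.\<close>

lemma implements_call:
  assumes F: "implements T F" and gs: "\<And>g. g \<in> set gs \<Longrightarrow> implements U g"
  shows "implements (\<lambda>e. length gs * U e + T (map (\<lambda>g. g e) gs) + 1) (\<lambda>e. F (map (\<lambda>g. g e) gs))"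
    (is "implements ?T ?g")
proof (rule implementsI)
  fix n k
  obtain es c1 where 1: "\<forall>pre post env. length pre = k \<longrightarrow> length env = n \<longrightarrow>
     (\<exists>t \<le> length gs * U env. evals (pre @ c1 @ post) env es (map (\<lambda>g. g env) gs) t)"
    using implements_evals[OF gs, of gs k n] by blast
  obtain e2 c2 where 2: "realizes (k + length c1) (length gs) T F e2 c2"
    using F by (rule implementsE)
  have "realizes k n ?T ?g (ECall (k + length c1 + length c2) es) (c1 @ c2 @ [e2])"
  proof (rule realizesI)
    fix pre post :: "expr list" and env :: "tree list"
    assume len: "length pre = k" "length env = n"
    let ?fs = "pre @ (c1 @ c2 @ [e2]) @ post"
    let ?vs = "map (\<lambda>g. g env) gs"
    obtain t1 where t1: "t1 \<le> length gs * U env" "evals ?fs env es ?vs t1"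
      using 1[rule_format, OF len, of "c2 @ e2 # post"] by auto
    obtain t2 where t2: "t2 \<le> T ?vs" "eval ?fs ?vs e2 (F ?vs) t2"
      using realizesD[OF 2, of "pre @ c1" ?vs "e2 # post"] len by auto
    have "?fs ! (k + length c1 + length c2) = e2"
      using len by (simp add: nth_append)
    then show "\<exists>t \<le> ?T env. eval ?fs env (ECall (k + length c1 + length c2) es) (?g env) t"
      using t1 t2 len eval_evals.Call[of "k + length c1 + length c2" ?fs, OF _ t1(2), of _ t2]
      by (intro exI[of _ "t1 + t2 + 1"]) auto
  qed
  then show "\<exists>e code. realizes k n ?T ?g e code" by blast
qed

lemma evals_vars: "m + length e \<le> length env \<Longrightarrow> (\<And>i. i < length e \<Longrightarrow> env ! (m + i) = e ! i) \<Longrightarrow>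
  evals fs env (map EVar [m..<m + length e]) e (length e)"
proof (induction e arbitrary: m)
  case Nil
  then show ?case by (simp add: eval_evals.Nil)
next
  case (Cons x e)
  have "eval fs env (EVar m) x 1"
    using Cons.prems(1) Cons.prems(2)[of 0] eval_evals.Var[of m env fs] by simp
  moreover have "evals fs env (map EVar [Suc m..<Suc m + length e]) e (length e)"
    using Cons.prems(1) Cons.prems(2)[of "Suc _"] by (intro Cons.IH) auto
  ultimately have "evals fs env (EVar m # map EVar [Suc m..<Suc m + length e]) (x # e) (1 + length e)"
    by (rule eval_evals.Cons)
  then show ?case by (simp add: upt_conv_Cons del: upt_Suc)
qed

text \<open>The loop is a recursive function of the remaining list, the start value and the
  environment. Each iteration passes the environment on twice, to the recursive call and to the step
  function, hence \<open>2 * length e\<close>. The bound \<open>B\<close> is only required for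
  accumulators that really arise, the folds over suffixes.\<close>

lemma implements_fold:
  assumes l: "implements Tl l" and i: "implements Ti i" and h: "implements Th h"
    and B: "\<And>e zs x ys. tlist (l e) = zs @ x # ys \<Longrightarrow>
      Th (x # foldr (\<lambda>x a. h (x # a # e)) ys (i e) # e) \<le> B e"
  shows "implements (\<lambda>e. Tl e + Ti e + (length (tlist (l e)) + 1) * (B e + 2 * length e + 10))
    (\<lambda>e. foldr (\<lambda>x a. h (x # a # e)) (tlist (l e)) (i e))" (is "implements ?T ?g")
proof (rule implementsI)
  fix n k
  obtain el cl where 1: "realizes k n Tl l el cl" using l by (rule implementsE)
  obtain ei ci where 2: "realizes (k + length cl) n Ti i ei ci" using i by (rule implementsE)
  obtain eh ch where 3: "realizes (k + length cl + length ci) (n + 2) Th h eh ch"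
    using h by (rule implementsE)
  \<comment> \<open>Entries \<open>j\<close> and \<open>Suc j\<close> of the table will hold the
    loop and the step function. Inside the loop, variables 0 and 1 are the remaining list and the
    start value, so the environment starts at variable 2.\<close>
  define j where "j = k + length cl + length ci + length ch"
  define vs where "vs = map EVar [2..<2 + n]"
  define loop where "loop = EIf (EVar 0)
     (ECall (Suc j) (ELeft (EVar 0) # ECall j (ERight (EVar 0) # EVar 1 # vs) # vs)) (EVar 1)"
  have loopI: "eval fs env loop v t" if "eval fs env (EIf (EVar 0)
     (ECall (Suc j) (ELeft (EVar 0) # ECall j (ERight (EVar 0) # EVar 1 # vs) # vs)) (EVar 1)) v t"
    for fs env v t
    using that unfolding loop_def .
  have "realizes k n ?T ?g (ECall j (el # ei # map EVar [0..<n])) (cl @ ci @ ch @ [loop, eh])"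
  proof (rule realizesI)
    fix pre post :: "expr list" and env :: "tree list"
    assume len: "length pre = k" "length env = n"
    let ?fs = "pre @ (cl @ ci @ ch @ [loop, eh]) @ post"
    let ?fold = "\<lambda>ys. foldr (\<lambda>x a. h (x # a # env)) ys (i env)"
    let ?C = "B env + 2 * n + 10"
    obtain tl where tl: "tl \<le> Tl env" "eval ?fs env el (l env) tl"
      using realizesD[OF 1 len, of "ci @ ch @ loop # eh # post"] by auto
    obtain ti where ti: "ti \<le> Ti env" "eval ?fs env ei (i env) ti"
      using realizesD[OF 2, of "pre @ cl" env "ch @ loop # eh # post"] len by auto
    have j: "?fs ! j = loop" "?fs ! Suc j = eh" "j < length ?fs" "Suc j < length ?fs"
      using len unfolding j_def by (simp_all add: nth_append)
    have loop: "\<exists>t \<le> length ys * ?C + 3. eval ?fs (encode_list ys # i env # env) loop (?fold ys) t"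
      if "\<exists>zs. tlist (l env) = zs @ ys" for ys
      using that
    proof (induction ys)
      case Nil
      have "eval ?fs (Leaf # i env # env) loop (i env) (1 + 1 + 1)"
        by (rule loopI, rule eval_evals.IfFalse) (use eval_evals.Var[of 0 "Leaf # i env # env" ?fs]
            eval_evals.Var[of 1 "Leaf # i env # env" ?fs] in simp_all)
      then show ?case by (intro exI[of _ "1 + 1 + 1"]) simp
    next
      case (Cons x ys)
      then obtain zs where zs: "tlist (l env) = zs @ x # ys" by blast
      then have "\<exists>zs. tlist (l env) = zs @ ys" by (intro exI[of _ "zs @ [x]"]) simp
      then obtain t where t: "t \<le> length ys * ?C + 3"
          "eval ?fs (encode_list ys # i env # env) loop (?fold ys) t"
        using Cons.IH by blast
      obtain th where th: "th \<le> Th (x # ?fold ys # env)"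
          "eval ?fs (x # ?fold ys # env) eh (h (x # ?fold ys # env)) th"
        using realizesD[OF 3, of "pre @ cl @ ci" "x # ?fold ys # env" "loop # eh # post"] len by auto
      have "th \<le> B env" using th(1) B[OF zs] by simp
      let ?env = "encode_list (x # ys) # i env # env"
      have vs: "evals ?fs ?env vs env n"
        unfolding vs_def using evals_vars[of 2 env ?env ?fs] len by simp
      have v0: "eval ?fs ?env (EVar 0) (encode_list (x # ys)) 1"
        using eval_evals.Var[of 0 ?env ?fs] by simp
      have v1: "eval ?fs ?env (EVar 1) (i env) 1"
        using eval_evals.Var[of 1 ?env ?fs] by simp
      have "eval ?fs ?env (ECall j (ERight (EVar 0) # EVar 1 # vs)) (?fold ys) ((1 + 1 + (1 + n)) + t + 1)"
      proof (rule eval_evals.Call)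
        have "evals ?fs ?env (ERight (EVar 0) # EVar 1 # vs)
            (right (encode_list (x # ys)) # i env # env) (1 + 1 + (1 + n))"
          by (intro eval_evals.Cons eval_evals.Right v0 v1 vs)
        then show "evals ?fs ?env (ERight (EVar 0) # EVar 1 # vs)
            (encode_list ys # i env # env) (1 + 1 + (1 + n))" by simp
      qed (use j t in simp_all)
      moreover have "eval ?fs ?env (ELeft (EVar 0)) x (1 + 1)"
        using eval_evals.Left[OF v0] by simp
      ultimately have "evals ?fs ?env (ELeft (EVar 0) # ECall j (ERight (EVar 0) # EVar 1 # vs) # vs)
          (x # ?fold ys # env) (1 + 1 + (((1 + 1 + (1 + n)) + t + 1) + n))"
        by (intro eval_evals.Cons vs)
      then have "eval ?fs ?env (ECall (Suc j)
          (ELeft (EVar 0) # ECall j (ERight (EVar 0) # EVar 1 # vs) # vs)) (?fold (x # ys))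
          ((1 + 1 + (((1 + 1 + (1 + n)) + t + 1) + n)) + th + 1)"
        by (rule eval_evals.Call[OF j(4)]) (use j(2) th(2) in simp)
      then have "eval ?fs ?env loop (?fold (x # ys))
          (1 + ((1 + 1 + (((1 + 1 + (1 + n)) + t + 1) + n)) + th + 1) + 1)"
        by (intro loopI eval_evals.IfTrue[OF v0]) simp_all
      \<comment> \<open>An iteration has nine steps of overhead besides the environment; the 3
        stands for the final test on the empty list.\<close>
      moreover have "1 + ((1 + 1 + (((1 + 1 + (1 + n)) + t + 1) + n)) + th + 1) + 1
          \<le> length (x # ys) * ?C + 3"
        using t(1) \<open>th \<le> B env\<close> by simp
      ultimately show ?case by blast
    qed
    then obtain t where t: "t \<le> length (tlist (l env)) * ?C + 3"
        "eval ?fs (l env # i env # env) loop (?g env) t"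
      by (metis append_Nil encode_list_tlist)
    have "evals ?fs env (map EVar [0..<n]) env n"
      using evals_vars[of 0 env env ?fs] len by simp
    then have "evals ?fs env (el # ei # map EVar [0..<n]) (l env # i env # env) (tl + (ti + n))"
      by (intro eval_evals.Cons tl(2) ti(2))
    then have "eval ?fs env (ECall j (el # ei # map EVar [0..<n])) (?g env) ((tl + (ti + n)) + t + 1)"
      by (rule eval_evals.Call[OF j(3)]) (use t(2) j(1) in simp)
    moreover have "(tl + (ti + n)) + t + 1 \<le> ?T env"
      using tl(1) ti(1) t(1) len by simp
    ultimately show "\<exists>t \<le> ?T env. eval ?fs env (ECall j (el # ei # map EVar [0..<n])) (?g env) t"
      by blast
  qed
  then show "\<exists>e code. realizes k n ?T ?g e code" by blast
qed

section \<open>Functions of polynomial cost\<close>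

text \<open>With a base of at least 2, a single exponent absorbs constants, coefficients and
  sums.\<close>

definition poly_bounded :: "('e \<Rightarrow> nat) \<Rightarrow> ('e \<Rightarrow> nat) \<Rightarrow> bool" where
  "poly_bounded \<mu> T \<longleftrightarrow> (\<exists>c. \<forall>e. T e \<le> (\<mu> e + 2) ^ c)"

lemma poly_bounded_mono: "poly_bounded \<mu> T \<Longrightarrow> (\<And>e. T' e \<le> T e) \<Longrightarrow> poly_bounded \<mu> T'"
  unfolding poly_bounded_def by (meson le_trans)

lemma poly_bounded_self [simp]: "poly_bounded \<mu> \<mu>"
  unfolding poly_bounded_def by (rule exI[of _ 1]) simp

lemma poly_bounded_const [simp]: "poly_bounded \<mu> (\<lambda>e. n)"
proof -
  have "n \<le> (\<mu> e + 2) ^ n" for e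
  proof -
    have "n \<le> 2 ^ n" by simp
    also have "\<dots> \<le> (\<mu> e + 2) ^ n" by (rule power_mono) simp_all
    finally show ?thesis .
  qed
  then show ?thesis unfolding poly_bounded_def by blast
qed

lemma poly_bounded_mult [intro]:
  assumes "poly_bounded \<mu> S" "poly_bounded \<mu> T"
  shows "poly_bounded \<mu> (\<lambda>e. S e * T e)"
proof -
  obtain a b where "\<And>e. S e \<le> (\<mu> e + 2) ^ a" "\<And>e. T e \<le> (\<mu> e + 2) ^ b"
    using assms unfolding poly_bounded_def by blast
  then have "S e * T e \<le> (\<mu> e + 2) ^ (a + b)" for e
    unfolding power_add by (intro mult_mono) simp_all
  then show ?thesis unfolding poly_bounded_def by blast
qed

lemma poly_bounded_add [intro]:
  assumes "poly_bounded \<mu> S" "poly_bounded \<mu> T"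
  shows "poly_bounded \<mu> (\<lambda>e. S e + T e)"
proof (rule poly_bounded_mono)
  have S: "poly_bounded \<mu> (\<lambda>e. S e + 1)" if "poly_bounded \<mu> S" for S :: "'a \<Rightarrow> nat"
  proof -
    obtain a where a: "\<And>e. S e \<le> (\<mu> e + 2) ^ a"
      using \<open>poly_bounded \<mu> S\<close> unfolding poly_bounded_def by blast
    have "S e + 1 \<le> (\<mu> e + 2) ^ (a + 1)" for e
    proof -
      have "S e + 1 \<le> (\<mu> e + 2) ^ a + (\<mu> e + 2) ^ a" using a[of e] by (intro add_mono) simp_all
      also have "\<dots> = 2 * (\<mu> e + 2) ^ a" by simp
      also have "\<dots> \<le> (\<mu> e + 2) * (\<mu> e + 2) ^ a" by (rule mult_le_mono1) simp
      finally show ?thesis by simp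
    qed
    then show ?thesis unfolding poly_bounded_def by blast
  qed
  show "poly_bounded \<mu> (\<lambda>e. (S e + 1) * (T e + 1))" by (intro poly_bounded_mult S assms)
  show "S e + T e \<le> (S e + 1) * (T e + 1)" for e by simp
qed

lemma poly_bounded_power [intro]: "poly_bounded \<mu> T \<Longrightarrow> poly_bounded \<mu> (\<lambda>e. T e ^ c)"
  by (induction c) auto

lemma poly_bounded_comp:
  assumes "poly_bounded \<nu> T" "poly_bounded \<mu> (\<lambda>e. \<nu> (h e))"
  shows "poly_bounded \<mu> (\<lambda>e. T (h e))"
proof -
  obtain c where "\<And>e. T (h e) \<le> (\<nu> (h e) + 2) ^ c"
    using assms(1) unfolding poly_bounded_def by blast
  moreover have "poly_bounded \<mu> (\<lambda>e. (\<nu> (h e) + 2) ^ c)" using assms(2)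
    by (intro poly_bounded_power poly_bounded_add poly_bounded_const)
  ultimately show ?thesis by (rule poly_bounded_mono[rotated])
qed

lemma poly_bounded_sum_list:
  "(\<And>g. g \<in> set gs \<Longrightarrow> poly_bounded \<mu> (T g)) \<Longrightarrow> poly_bounded \<mu> (\<lambda>e. \<Sum>g\<leftarrow>gs. T g e)"
  by (induction gs) auto

text \<open>
  The size of the result is bounded separately: as trees share subtrees, a short computation can
  have a result of exponential size.
\<close>

definition feasible :: "(tree list \<Rightarrow> nat) \<Rightarrow> (tree list \<Rightarrow> tree) \<Rightarrow> bool" where
  "feasible \<mu> g \<longleftrightarrow>
     (\<exists>T. implements T g \<and> poly_bounded \<mu> T) \<and> poly_bounded \<mu> (\<lambda>e. tree_size (g e))"

lemma feasibleI:
  "implements T g \<Longrightarrow> poly_bounded \<mu> T \<Longrightarrow> poly_bounded \<mu> (\<lambda>e. tree_size (g e)) \<Longrightarrow> feasible \<mu> g"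
  unfolding feasible_def by blast

lemma feasible_size: "feasible \<mu> g \<Longrightarrow> poly_bounded \<mu> (\<lambda>e. tree_size (g e))"
  unfolding feasible_def by blast

lemma feasible_measure: "feasible \<mu> g \<Longrightarrow> poly_bounded \<nu> \<mu> \<Longrightarrow> feasible \<nu> g"
  unfolding feasible_def using poly_bounded_comp[where h="\<lambda>e. e"] by blast

lemma feasible_Leaf [intro]: "feasible \<mu> (\<lambda>e. Leaf)"
  by (rule feasibleI[OF implements_Leaf]) simp_all

lemma feasible_arg: "poly_bounded \<mu> esize \<Longrightarrow> feasible \<mu> (\<lambda>e. arg e i)"
  by (rule feasibleI[OF implements_arg])
    (auto intro: poly_bounded_mono[OF poly_bounded_add[OF _ poly_bounded_const] tree_size_arg])

lemma tree_size_left: "tree_size (left t) \<le> tree_size t"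
  and tree_size_right: "tree_size (right t) \<le> tree_size t"
  by (cases t; simp)+

lemma feasible_left [intro]: "feasible \<mu> g \<Longrightarrow> feasible \<mu> (\<lambda>e. left (g e))"
  unfolding feasible_def
  by (auto intro!: exI[where x="\<lambda>e. _ e + 1"] intro: implements_left
      poly_bounded_mono[OF _ tree_size_left])

lemma feasible_right [intro]: "feasible \<mu> g \<Longrightarrow> feasible \<mu> (\<lambda>e. right (g e))"
  unfolding feasible_def
  by (auto intro!: exI[where x="\<lambda>e. _ e + 1"] intro: implements_right
      poly_bounded_mono[OF _ tree_size_right])

lemma feasible_Node [intro]:
  assumes "feasible \<mu> g" "feasible \<mu> h"
  shows "feasible \<mu> (\<lambda>e. Node (g e) (h e))"
proof -
  obtain T U where "implements T g" "poly_bounded \<mu> T" "implements U h" "poly_bounded \<mu> U"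
    using assms unfolding feasible_def by blast
  moreover have "poly_bounded \<mu> (\<lambda>e. 1 + tree_size (g e) + tree_size (h e))"
    using assms by (intro poly_bounded_add poly_bounded_const feasible_size)
  ultimately show ?thesis
    by (intro feasibleI[OF implements_Node])
      (simp_all only: tree_size.simps, intro poly_bounded_add poly_bounded_const)
qed

lemma feasible_If [intro]:
  assumes "feasible \<mu> g0" "feasible \<mu> g1" "feasible \<mu> g2"
  shows "feasible \<mu> (\<lambda>e. if g0 e \<noteq> Leaf then g1 e else g2 e)"
proof -
  obtain T0 T1 T2 where "implements T0 g0" "poly_bounded \<mu> T0" "implements T1 g1"
    "poly_bounded \<mu> T1" "implements T2 g2" "poly_bounded \<mu> T2"
    using assms unfolding feasible_def by blast
  moreover have "poly_bounded \<mu> (\<lambda>e. tree_size (g1 e) + tree_size (g2 e))"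
    by (intro poly_bounded_add feasible_size assms)
  then have "poly_bounded \<mu> (\<lambda>e. tree_size (if g0 e \<noteq> Leaf then g1 e else g2 e))"
    by (rule poly_bounded_mono) auto
  ultimately show ?thesis
    by (intro feasibleI[OF implements_If] poly_bounded_add poly_bounded_const)
qed

text \<open>The cost of the callee is measured at the values of its arguments, so its measure there
  has to be bounded in terms of the caller's. The step bounds of the arguments are added up because
  \<open>implements_call\<close> takes one bound for all of them.\<close>

lemma feasible_call:
  assumes F: "feasible \<nu> F" and gs: "\<And>g. g \<in> set gs \<Longrightarrow> feasible \<mu> g"
    and \<nu>: "poly_bounded \<mu> (\<lambda>e. \<nu> (map (\<lambda>g. g e) gs))"
  shows "feasible \<mu> (\<lambda>e. F (map (\<lambda>g. g e) gs))"
proof -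
  obtain T where T: "implements T F" "poly_bounded \<nu> T" using F unfolding feasible_def by blast
  obtain U where U: "\<And>g. g \<in> set gs \<Longrightarrow> implements (U g) g \<and> poly_bounded \<mu> (U g)"
    using gs unfolding feasible_def by metis
  define V where "V e = (\<Sum>g\<leftarrow>gs. U g e)" for e
  have "implements V g" if "g \<in> set gs" for g
  proof (rule implements_mono)
    show "implements (U g) g" using U[OF that] by simp
    show "U g e \<le> V e" for e
      unfolding V_def using that by (intro member_le_sum_list) auto
  qed
  moreover have "poly_bounded \<mu> V"
    unfolding V_def using U by (intro poly_bounded_sum_list) blast
  ultimately show ?thesis
    by (intro feasibleI[OF implements_call[OF T(1)]]
        poly_bounded_comp[where h="\<lambda>e. map (\<lambda>g. g e) gs", OF feasible_size[OF F] \<nu>]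
        poly_bounded_add poly_bounded_mult poly_bounded_const
        poly_bounded_comp[where h="\<lambda>e. map (\<lambda>g. g e) gs", OF T(2) \<nu>])
qed

section \<open>Polynomial time in the total size of the arguments\<close>

abbreviation ptime :: "(tree list \<Rightarrow> tree) \<Rightarrow> bool" where
  "ptime \<equiv> feasible esize"

abbreviation ptime_test :: "(tree list \<Rightarrow> bool) \<Rightarrow> bool" where
  "ptime_test P \<equiv> ptime (\<lambda>e. encode_bool (P e))"

text \<open>Here the size bound contained in \<open>feasible\<close> pays off: it controls the total
  size of the argument values.\<close>

lemma feasible_call_ptime:
  assumes F: "ptime F" and gs: "\<And>g. g \<in> set gs \<Longrightarrow> feasible \<mu> g"
  shows "feasible \<mu> (\<lambda>e. F (map (\<lambda>g. g e) gs))"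
proof (rule feasible_call[OF assms])
  have "poly_bounded \<mu> (\<lambda>e. \<Sum>g\<leftarrow>gs. tree_size (g e))"
    using gs feasible_size by (intro poly_bounded_sum_list) blast
  then show "poly_bounded \<mu> (\<lambda>e. esize (map (\<lambda>g. g e) gs))"
    by (simp add: esize_def comp_def)
qed

text \<open>A polynomial step can still let the accumulator explode when it is iterated, so a bound
  \<open>S\<close> on all intermediate values has to be supplied. Given \<open>S\<close>, the cost
  of each step is polynomial in the measure.\<close>

lemma feasible_fold:
  assumes l: "feasible \<mu> l" and i: "feasible \<mu> i"
    and h: "ptime (\<lambda>e. h (arg e 0) (arg e 1) (drop 2 e))"
    and \<mu>: "poly_bounded \<mu> esize" and S: "poly_bounded \<mu> S"
    and size: "\<And>e zs ys. tlist (l e) = zs @ ys \<Longrightarrow> tree_size (foldr (\<lambda>x a. h x a e) ys (i e)) \<le> S e"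
  shows "feasible \<mu> (\<lambda>e. foldr (\<lambda>x a. h x a e) (tlist (l e)) (i e))"
proof -
  define hb where "hb = (\<lambda>e. h (arg e 0) (arg e 1) (drop 2 e))"
  have hb: "(\<lambda>x a. h x a e) = (\<lambda>x a. hb (x # a # e))" for e
    by (auto simp: hb_def fun_eq_iff numeral_2_eq_2)
  obtain Tl Ti Th where T: "implements Tl l" "poly_bounded \<mu> Tl" "implements Ti i"
      "poly_bounded \<mu> Ti" "implements Th hb" "poly_bounded esize Th"
    using l i h unfolding feasible_def hb_def by blast
  obtain c where c: "\<And>e. Th e \<le> (esize e + 2) ^ c"
    using T(6) unfolding poly_bounded_def by blast
  define B where "B e = (tree_size (l e) + S e + esize e + 2) ^ c" for e
  have "poly_bounded \<mu> B"
    unfolding B_def by (intro poly_bounded_power poly_bounded_add \<mu> S feasible_size[OF l]) simp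
  moreover have "poly_bounded \<mu> length"
    using \<mu> length_le_esize by (rule poly_bounded_mono)
  moreover have "poly_bounded \<mu> (\<lambda>e. length (tlist (l e)))"
    using feasible_size[OF l] length_tlist_le by (rule poly_bounded_mono)
  ultimately have bnd: "poly_bounded \<mu>
      (\<lambda>e. Tl e + Ti e + (length (tlist (l e)) + 1) * (B e + 2 * length e + 10))"
    by (intro poly_bounded_add poly_bounded_mult T) simp_all
  have "implements (\<lambda>e. Tl e + Ti e + (length (tlist (l e)) + 1) * (B e + 2 * length e + 10))
     (\<lambda>e. foldr (\<lambda>x a. hb (x # a # e)) (tlist (l e)) (i e))"
  proof (rule implements_fold[OF T(1,3,5)])
    fix e zs x ys
    assume *: "tlist (l e) = zs @ x # ys"
    let ?a = "foldr (\<lambda>x a. hb (x # a # e)) ys (i e)"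
    have "tree_size ?a \<le> S e" using size[of e "zs @ [x]" ys] * unfolding hb by simp
    moreover have "tree_size x \<le> tree_size (l e)" using * by (intro tree_size_elem) simp
    ultimately have "esize (x # ?a # e) + 2 \<le> tree_size (l e) + S e + esize e + 2" by simp
    then have "(esize (x # ?a # e) + 2) ^ c \<le> B e" unfolding B_def by (rule power_mono) simp
    with c show "Th (x # ?a # e) \<le> B e" by (rule le_trans)
  qed
  then show ?thesis unfolding hb
    by (rule feasibleI[OF _ bnd]) (use size[of _ "[]"] in \<open>auto intro!: poly_bounded_mono[OF S] simp: hb\<close>)
qed

text \<open>In the body of a fold the outer arguments stand behind the element and the accumulator,
  so every level of nested iteration contributes one \<open>drop\<close>.\<close>

lemma ptime_arg [intro]: "ptime (\<lambda>e. arg e i)" "ptime (\<lambda>e. arg (drop m e) i)"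
  "ptime (\<lambda>e. arg (drop m (drop m' e)) i)" "ptime (\<lambda>e. arg (drop m (drop m' (drop m'' e))) i)"
  by (simp_all add: feasible_arg)

text \<open>A call starts with a fresh environment. It is therefore enough to analyse a function on
  variables, and the nesting of \<open>drop\<close> starts anew.\<close>

lemma ptime_comp1:
  assumes "ptime (\<lambda>e. F (arg e 0))" "feasible \<mu> a"
  shows "feasible \<mu> (\<lambda>e. F (a e))"
  using feasible_call_ptime[OF assms(1), of "[a]" \<mu>] assms(2-) by simp

lemma ptime_comp2:
  assumes "ptime (\<lambda>e. F (arg e 0) (arg e 1))" "feasible \<mu> a" "feasible \<mu> b"
  shows "feasible \<mu> (\<lambda>e. F (a e) (b e))"
  using feasible_call_ptime[OF assms(1), of "[a, b]" \<mu>] assms(2-) by auto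

lemma ptime_comp3:
  assumes "ptime (\<lambda>e. F (arg e 0) (arg e 1) (arg e 2))" "feasible \<mu> a" "feasible \<mu> b" "feasible \<mu> c"
  shows "feasible \<mu> (\<lambda>e. F (a e) (b e) (c e))"
  using feasible_call_ptime[OF assms(1), of "[a, b, c]" \<mu>] assms(2-) by (auto simp: numeral_2_eq_2)

lemma ptime_comp4:
  assumes "ptime (\<lambda>e. F (arg e 0) (arg e 1) (arg e 2) (arg e 3))"
    "feasible \<mu> a" "feasible \<mu> b" "feasible \<mu> c" "feasible \<mu> d"
  shows "feasible \<mu> (\<lambda>e. F (a e) (b e) (c e) (d e))"
  using feasible_call_ptime[OF assms(1), of "[a, b, c, d]" \<mu>] assms(2-)
  by (auto simp: numeral_2_eq_2 numeral_3_eq_3)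

lemma ptime_comp5:
  assumes "ptime (\<lambda>e. F (arg e 0) (arg e 1) (arg e 2) (arg e 3) (arg e 4))"
    "feasible \<mu> a" "feasible \<mu> b" "feasible \<mu> c" "feasible \<mu> d" "feasible \<mu> f"
  shows "feasible \<mu> (\<lambda>e. F (a e) (b e) (c e) (d e) (f e))"
  using feasible_call_ptime[OF assms(1), of "[a, b, c, d, f]" \<mu>] assms(2-)
  by (auto simp: numeral_2_eq_2 numeral_3_eq_3)

section \<open>List processing\<close>

abbreviation tset :: "tree \<Rightarrow> tree set" where
  "tset t \<equiv> set (tlist t)"

abbreviation tlen :: "tree \<Rightarrow> nat" where
  "tlen t \<equiv> length (tlist t)"

lemma encode_bool_conv: "encode_bool b = (if b then Node Leaf Leaf else Leaf)"
  by (cases b) auto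

lemma encode_bool_eq_Leaf [simp]: "encode_bool b = Leaf \<longleftrightarrow> \<not> b"
  by (cases b) auto

lemma tlist_eq_Nil [simp]: "tlist t = [] \<longleftrightarrow> t = Leaf"
  by (cases t) auto

lemma feasible_if:
  "feasible \<mu> (\<lambda>e. encode_bool (P e)) \<Longrightarrow> feasible \<mu> g \<Longrightarrow> feasible \<mu> h \<Longrightarrow>
   feasible \<mu> (\<lambda>e. if P e then g e else h e)"
  using feasible_If[of \<mu> "\<lambda>e. encode_bool (P e)" g h] by simp

lemma ptime_not: "ptime_test P \<Longrightarrow> ptime_test (\<lambda>e. \<not> P e)"
proof -
  assume "ptime_test P"
  then have "ptime (\<lambda>e. if P e then Leaf else Node Leaf Leaf)"
    by (intro feasible_if feasible_Leaf feasible_Node)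
  moreover have "(\<lambda>e. if P e then Leaf else Node Leaf Leaf) = (\<lambda>e. encode_bool (\<not> P e))"
    by (auto simp: fun_eq_iff)
  ultimately show ?thesis by simp
qed

lemma ptime_conj: "ptime_test P \<Longrightarrow> ptime_test Q \<Longrightarrow> ptime_test (\<lambda>e. P e \<and> Q e)"
proof -
  assume "ptime_test P" "ptime_test Q"
  then have "ptime (\<lambda>e. if P e then encode_bool (Q e) else Leaf)"
    by (intro feasible_if feasible_Leaf)
  moreover have "(\<lambda>e. if P e then encode_bool (Q e) else Leaf) = (\<lambda>e. encode_bool (P e \<and> Q e))"
    by (auto simp: fun_eq_iff)
  ultimately show ?thesis by simp
qed

lemma ptime_disj: "ptime_test P \<Longrightarrow> ptime_test Q \<Longrightarrow> ptime_test (\<lambda>e. P e \<or> Q e)"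
  using ptime_not[OF ptime_conj[OF ptime_not[of P] ptime_not[of Q]]] by simp

lemma ptime_imp: "ptime_test P \<Longrightarrow> ptime_test Q \<Longrightarrow> ptime_test (\<lambda>e. P e \<longrightarrow> Q e)"
  unfolding imp_conv_disj by (intro ptime_disj ptime_not)

lemma ptime_iff: "ptime_test P \<Longrightarrow> ptime_test Q \<Longrightarrow> ptime_test (\<lambda>e. P e = Q e)"
  unfolding iff_conv_conj_imp by (intro ptime_conj ptime_imp)

lemma ptime_eq_Leaf: "ptime g \<Longrightarrow> ptime_test (\<lambda>e. g e = Leaf)"
proof -
  assume "ptime g"
  then have "ptime (\<lambda>e. if g e \<noteq> Leaf then Leaf else Node Leaf Leaf)"
    by (intro feasible_If feasible_Leaf feasible_Node)
  moreover have "(\<lambda>e. if g e \<noteq> Leaf then Leaf else Node Leaf Leaf) = (\<lambda>e. encode_bool (g e = Leaf))"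
    by (auto simp: fun_eq_iff)
  ultimately show ?thesis by simp
qed

lemma ptime_fold:
  assumes "ptime l" "ptime i" "ptime (\<lambda>e. h (arg e 0) (arg e 1) (drop 2 e))"
    and "poly_bounded esize S"
    and "\<And>e zs ys. tlist (l e) = zs @ ys \<Longrightarrow> tree_size (foldr (\<lambda>x a. h x a e) ys (i e)) \<le> S e"
  shows "ptime (\<lambda>e. foldr (\<lambda>x a. h x a e) (tlist (l e)) (i e))"
  using feasible_fold[OF assms(1-3) _ assms(4)] assms(5) by simp

lemma ptime_Bex:
  assumes "ptime l" "ptime_test (\<lambda>e. P (arg e 0) (drop 2 e))"
  shows "ptime_test (\<lambda>e. \<exists>x\<in>tset (l e). P x e)"
proof -
  have fold: "foldr (\<lambda>x a. if P x e then Node Leaf Leaf else a) xs Leaf = encode_bool (\<exists>x\<in>set xs. P x e)"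
    for e xs
    by (induction xs) (simp_all add: encode_bool_conv)
  have "ptime (\<lambda>e. foldr (\<lambda>x a. if P x e then Node Leaf Leaf else a) (tlist (l e)) Leaf)"
    by (rule ptime_fold[where S="\<lambda>e. 3"])
      (auto intro!: assms feasible_if simp: fold encode_bool_conv)
  then show ?thesis unfolding fold .
qed

lemma ptime_Ball:
  "ptime l \<Longrightarrow> ptime_test (\<lambda>e. P (arg e 0) (drop 2 e)) \<Longrightarrow> ptime_test (\<lambda>e. \<forall>x\<in>tset (l e). P x e)"
  using ptime_not[OF ptime_Bex[of l "\<lambda>x e. \<not> P x e"]] ptime_not[of "\<lambda>e. P (arg e 0) (drop 2 e)"]
  by simp

definition tfilter :: "(tree \<Rightarrow> bool) \<Rightarrow> tree \<Rightarrow> tree" where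
  "tfilter P t = encode_list (filter P (tlist t))"

lemma tlist_tfilter [simp]: "tlist (tfilter P t) = filter P (tlist t)"
  by (simp add: tfilter_def)

lemma tree_size_encode_filter:
  "tree_size (encode_list (filter P xs)) \<le> (\<Sum>x\<leftarrow>xs. tree_size x + 1) + 1"
  by (induction xs) auto

lemma tree_size_tfilter: "tree_size (tfilter P t) \<le> tree_size t"
  using tree_size_encode_filter[of P "tlist t"] unfolding tfilter_def tree_size_conv[of t] .

lemma ptime_filter:
  assumes "ptime l" "ptime_test (\<lambda>e. P (arg e 0) (drop 2 e))"
  shows "ptime (\<lambda>e. tfilter (\<lambda>x. P x e) (l e))"
proof -
  have fold: "foldr (\<lambda>x a. if P x e then Node x a else a) xs Leaf = encode_list (filter (\<lambda>x. P x e) xs)"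
    for e xs
    by (induction xs) simp_all
  have "ptime (\<lambda>e. foldr (\<lambda>x a. if P x e then Node x a else a) (tlist (l e)) Leaf)"
  proof (rule ptime_fold[where S="\<lambda>e. tree_size (l e)"])
    fix e zs ys
    assume "tlist (l e) = zs @ ys"
    then show "tree_size (foldr (\<lambda>x a. if P x e then Node x a else a) ys Leaf) \<le> tree_size (l e)"
      unfolding fold using tree_size_encode_filter tree_size_suffix le_trans by blast
  qed (auto intro!: assms feasible_if feasible_size)
  then show ?thesis unfolding fold tfilter_def .
qed

definition tmap :: "(tree \<Rightarrow> tree) \<Rightarrow> tree \<Rightarrow> tree" where
  "tmap f t = encode_list (map f (tlist t))"

lemma tlist_tmap [simp]: "tlist (tmap f t) = map f (tlist t)"
  by (simp add: tmap_def)

lemma ptime_map: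
  assumes "ptime l" "ptime (\<lambda>e. f (arg e 0) (drop 2 e))"
  shows "ptime (\<lambda>e. tmap (\<lambda>x. f x e) (l e))"
proof -
  have fold: "foldr (\<lambda>x. Node (f x e)) xs Leaf = encode_list (map (\<lambda>x. f x e) xs)" for e xs
    by (induction xs) simp_all
  obtain c where c: "\<And>e. tree_size (f (arg e 0) (drop 2 e)) \<le> (esize e + 2) ^ c"
    using feasible_size[OF assms(2)] unfolding poly_bounded_def by blast
  define B where "B e = (tree_size (l e) + 1 + esize e + 2) ^ c" for e
  have "ptime (\<lambda>e. foldr (\<lambda>x a. Node (f x e) a) (tlist (l e)) Leaf)"
  proof (rule ptime_fold[where S="\<lambda>e. tree_size (l e) * (B e + 1) + 1"])
    show "poly_bounded esize (\<lambda>e. tree_size (l e) * (B e + 1) + 1)"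
      unfolding B_def by (intro poly_bounded_add poly_bounded_mult poly_bounded_power
          feasible_size[OF assms(1)] poly_bounded_const poly_bounded_self)
    fix e zs ys
    assume ys: "tlist (l e) = zs @ ys"
    have "tree_size (f x e) \<le> B e" if "x \<in> set ys" for x
    proof -
      \<comment> \<open>The mapped function does not see the accumulator, so \<open>Leaf\<close> can
        stand in its slot.\<close>
      have "esize (x # Leaf # e) + 2 \<le> tree_size (l e) + 1 + esize e + 2"
        using tree_size_elem[of x "l e"] that ys by simp
      then have "(esize (x # Leaf # e) + 2) ^ c \<le> B e" unfolding B_def by (rule power_mono) simp
      then show ?thesis using c[of "x # Leaf # e"] by (simp add: numeral_2_eq_2)
    qed
    then have "tree_size (encode_list (map (\<lambda>x. f x e) ys)) \<le> length ys * (B e + 1) + 1"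
    proof (induction ys)
      case (Cons y ys)
      then have "tree_size (f y e) \<le> B e"
        "tree_size (encode_list (map (\<lambda>x. f x e) ys)) \<le> length ys * (B e + 1) + 1"
        by simp_all
      then show ?case by simp
    qed simp
    also have "length ys * (B e + 1) + 1 \<le> tree_size (l e) * (B e + 1) + 1"
      using length_tlist_le[of "l e"] ys by (intro add_mono mult_le_mono1) simp_all
    finally show "tree_size (foldr (\<lambda>x a. Node (f x e) a) ys Leaf) \<le> tree_size (l e) * (B e + 1) + 1"
      unfolding fold by simp
  qed (auto intro!: assms)
  then show ?thesis unfolding fold tmap_def .
qed

definition tappend :: "tree \<Rightarrow> tree \<Rightarrow> tree" where
  "tappend a b = encode_list (tlist a @ tlist b)"

lemma tlist_tappend [simp]: "tlist (tappend a b) = tlist a @ tlist b"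
  by (simp add: tappend_def)

lemma tree_size_tappend: "tree_size (tappend a b) + 1 = tree_size a + tree_size b"
  by (simp add: tree_size_conv[of "tappend a b"] tree_size_conv[of a] tree_size_conv[of b])

lemma feasible_tappend:
  assumes "feasible \<mu> g" "feasible \<mu> h"
  shows "feasible \<mu> (\<lambda>e. tappend (g e) (h e))"
proof (rule ptime_comp2[where F=tappend, OF _ assms])
  have fold: "foldr Node xs b = encode_list (xs @ tlist b)" for xs b
    by (induction xs) simp_all
  have "ptime (\<lambda>e. foldr (\<lambda>x a. Node x a) (tlist (arg e 0)) (arg e 1))"
  proof (rule ptime_fold[where S="\<lambda>e. tree_size (arg e 0) + tree_size (arg e 1)"])
    fix e zs ys
    assume "tlist (arg e 0) = zs @ ys"
    then have "tree_size (encode_list (ys @ tlist (arg e 1))) \<le> tree_size (arg e 0) + tree_size (arg e 1)"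
      unfolding tree_size_conv[of "encode_list _"] tree_size_conv[of "arg e 0"]
        tree_size_conv[of "arg e 1"] by simp
    then show "tree_size (foldr Node ys (arg e 1)) \<le> tree_size (arg e 0) + tree_size (arg e 1)"
      unfolding fold .
  qed (auto intro!: feasible_size poly_bounded_add ptime_arg)
  then show "ptime (\<lambda>e. tappend (arg e 0) (arg e 1))" unfolding fold tappend_def .
qed

definition tconcat :: "tree \<Rightarrow> tree" where
  "tconcat t = encode_list (concat (map tlist (tlist t)))"

lemma tlist_tconcat [simp]: "tlist (tconcat t) = concat (map tlist (tlist t))"
  by (simp add: tconcat_def)

lemma feasible_tconcat: "feasible \<mu> g \<Longrightarrow> feasible \<mu> (\<lambda>e. tconcat (g e))"
proof (rule ptime_comp1[where F=tconcat])
  have fold: "foldr tappend xs Leaf = encode_list (concat (map tlist xs))" for xs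
    by (induction xs) (simp_all add: tappend_def)
  have size: "tree_size (foldr tappend xs Leaf) \<le> (\<Sum>x\<leftarrow>xs. tree_size x + 1) + 1" for xs
  proof (induction xs)
    case (Cons x xs)
    then show ?case using tree_size_tappend[of x "foldr tappend xs Leaf"] by simp
  qed simp
  have "ptime (\<lambda>e. foldr (\<lambda>x a. tappend x a) (tlist (arg e 0)) Leaf)"
  proof (rule ptime_fold[where S="\<lambda>e. tree_size (arg e 0)"])
    fix e zs ys
    assume "tlist (arg e 0) = zs @ ys"
    then show "tree_size (foldr tappend ys Leaf) \<le> tree_size (arg e 0)"
      using size tree_size_suffix le_trans by blast
  qed (auto intro!: feasible_size feasible_tappend ptime_arg)
  then show "ptime (\<lambda>e. tconcat (arg e 0))" unfolding fold tconcat_def .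
qed

definition tdrop :: "tree \<Rightarrow> tree \<Rightarrow> tree" where
  "tdrop n t = encode_list (drop (tlen n) (tlist t))"

lemma feasible_tdrop:
  assumes "feasible \<mu> g" "feasible \<mu> h"
  shows "feasible \<mu> (\<lambda>e. tdrop (g e) (h e))"
proof (rule ptime_comp2[where F=tdrop, OF _ assms])
  have right: "right t = encode_list (tl (tlist t))" for t
    by (cases t) auto
  have fold: "foldr (\<lambda>x. right) xs t = encode_list (drop (length xs) (tlist t))" for xs :: "tree list" and t
    by (induction xs) (simp_all add: right drop_Suc tl_drop)
  have "ptime (\<lambda>e. foldr (\<lambda>x a. right a) (tlist (arg e 0)) (arg e 1))"
  proof (rule ptime_fold[where S="\<lambda>e. tree_size (arg e 1)"])
    fix e and ys :: "tree list"
    show "tree_size (foldr (\<lambda>x. right) ys (arg e 1)) \<le> tree_size (arg e 1)"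
      unfolding fold using tree_size_suffix[of "arg e 1" "take (length ys) (tlist (arg e 1))"
          "drop (length ys) (tlist (arg e 1))"]
      unfolding tree_size_conv[of "encode_list _"] by simp
  qed (auto intro!: feasible_size feasible_right ptime_arg)
  then show "ptime (\<lambda>e. tdrop (arg e 0) (arg e 1))" unfolding fold tdrop_def .
qed

definition tnth :: "tree \<Rightarrow> tree \<Rightarrow> tree" where
  "tnth t n = left (tdrop n t)"

lemma tnth_conv: "tlen n < tlen t \<Longrightarrow> tnth t n = tlist t ! tlen n"
  by (simp add: tnth_def tdrop_def flip: Cons_nth_drop_Suc)

lemma feasible_tnth: "feasible \<mu> g \<Longrightarrow> feasible \<mu> h \<Longrightarrow> feasible \<mu> (\<lambda>e. tnth (g e) (h e))"
  unfolding tnth_def by (intro feasible_left feasible_tdrop)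

text \<open>Unary numbers are lists of which only the length matters.\<close>

definition shorter :: "tree \<Rightarrow> tree \<Rightarrow> bool" where
  "shorter a b \<longleftrightarrow> tlen a \<le> tlen b"

lemma ptime_shorter: "ptime g \<Longrightarrow> ptime h \<Longrightarrow> ptime_test (\<lambda>e. shorter (g e) (h e))"
proof -
  have "shorter a b \<longleftrightarrow> tdrop b a = Leaf" for a b
    by (metis drop_eq_Nil shorter_def tdrop_def tlist_encode_list tlist_eq_Nil)
  then show "ptime g \<Longrightarrow> ptime h \<Longrightarrow> ?thesis" by (simp only:) (intro ptime_eq_Leaf feasible_tdrop)
qed

definition same_length :: "tree \<Rightarrow> tree \<Rightarrow> bool" where
  "same_length a b \<longleftrightarrow> tlen a = tlen b"

lemma ptime_same_length: "ptime g \<Longrightarrow> ptime h \<Longrightarrow> ptime_test (\<lambda>e. same_length (g e) (h e))"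
  using ptime_conj[OF ptime_shorter ptime_shorter, of g h h g]
  by (simp add: shorter_def same_length_def eq_iff)

lemmas ptime_rules = ptime_arg feasible_Leaf feasible_left feasible_right feasible_Node feasible_if
  ptime_not ptime_conj ptime_disj ptime_imp ptime_iff ptime_eq_Leaf
  ptime_Bex ptime_Ball ptime_filter ptime_map feasible_tappend feasible_tconcat feasible_tdrop
  feasible_tnth ptime_shorter ptime_same_length

text \<open>\<open>guard z t\<close> keeps iterations whose results grow exponentially within the length of \<open>z\<close>.\<close>

definition guard :: "tree \<Rightarrow> tree \<Rightarrow> tree" where
  "guard z t = (if shorter t z then t else z)"

lemma ptime_guard: "ptime g \<Longrightarrow> ptime h \<Longrightarrow> ptime (\<lambda>e. guard (g e) (h e))"
  by (rule ptime_comp2[where F=guard]) (simp_all add: guard_def ptime_rules)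

section \<open>Unary numbers, conversion from binary, and enumeration of sublists\<close>

definition unary :: "nat \<Rightarrow> tree" where
  "unary n = encode_list (replicate n Leaf)"

lemma tlist_unary [simp]: "tlist (unary n) = replicate n Leaf"
  by (simp add: unary_def)

lemma tree_size_unary: "tree_size (unary n) = 2 * n + 1"
  by (induction n) (simp_all add: unary_def)

definition to_unary :: "tree \<Rightarrow> tree" where
  "to_unary t = tmap (\<lambda>x. Leaf) t"

lemma to_unary_conv: "to_unary t = unary (tlen t)"
  by (simp add: to_unary_def unary_def tmap_def map_replicate_const)

lemma ptime_to_unary: "ptime g \<Longrightarrow> ptime (\<lambda>e. to_unary (g e))"
  unfolding to_unary_def by (intro ptime_rules)

definition double_add :: "tree \<Rightarrow> tree \<Rightarrow> tree" where
  "double_add b a = (if b \<noteq> Leaf then Node Leaf (tappend a a) else tappend a a)"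

lemma double_add_unary: "double_add (encode_bool b) (unary n) = unary (2 * n + of_bool b)"
  by (simp add: double_add_def tappend_def unary_def replicate_add[symmetric] mult_2)

lemma ptime_double_add: "ptime g \<Longrightarrow> ptime h \<Longrightarrow> ptime (\<lambda>e. double_add (g e) (h e))"
  by (rule ptime_comp2[where F=double_add]) (simp_all add: double_add_def ptime_rules)

text \<open>Horner's scheme: the least significant bit comes first, so \<open>foldr\<close> starts
  at the top bit. The cap is applied after every digit because the uncapped value can be exponential
  in the length of \<open>b\<close>.\<close>

definition capped_value :: "tree \<Rightarrow> tree \<Rightarrow> tree" where
  "capped_value z b = foldr (\<lambda>b a. guard (to_unary z) (double_add b a)) (tlist b) Leaf"

lemma guard_unary: "guard (unary m) (unary n) = unary (min m n)"
  by (simp add: guard_def shorter_def min_def)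

lemma ptime_capped_value: "ptime g \<Longrightarrow> ptime h \<Longrightarrow> ptime (\<lambda>e. capped_value (g e) (h e))"
proof (rule ptime_comp2[where F=capped_value])
  have unary: "\<exists>m\<le>tlen z. foldr (\<lambda>b a. guard (to_unary z) (double_add b a)) bs Leaf = unary m" for z bs
  proof (induction bs)
    case Nil
    show ?case by (intro exI[of _ 0]) (simp add: unary_def)
  next
    case (Cons b bs)
    then obtain m where "foldr (\<lambda>b a. guard (to_unary z) (double_add b a)) bs Leaf = unary m"
      by blast
    moreover have "double_add b (unary m) = unary (2 * m + of_bool (b \<noteq> Leaf))"
      using double_add_unary[of "b \<noteq> Leaf" m] by (simp add: double_add_def)
    ultimately show ?case
      by (intro exI[of _ "min (tlen z) (2 * m + of_bool (b \<noteq> Leaf))"])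
        (simp add: to_unary_conv guard_unary)
  qed
  show "ptime (\<lambda>e. capped_value (arg e 0) (arg e 1))"
    unfolding capped_value_def
  proof (rule ptime_fold[where S="\<lambda>e. 2 * tree_size (arg e 0) + 1"])
    show "poly_bounded esize (\<lambda>e. 2 * tree_size (arg e 0) + 1)"
      by (intro poly_bounded_add poly_bounded_mult poly_bounded_const feasible_size ptime_arg)
    fix e ys
    obtain m where "m \<le> tlen (arg e 0)"
      "foldr (\<lambda>b a. guard (to_unary (arg e 0)) (double_add b a)) ys Leaf = unary m"
      using unary by blast
    then show "tree_size (foldr (\<lambda>b a. guard (to_unary (arg e 0)) (double_add b a)) ys Leaf)
        \<le> 2 * tree_size (arg e 0) + 1"
      using length_tlist_le[of "arg e 0"] by (simp add: tree_size_unary)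
  qed (intro ptime_guard ptime_to_unary ptime_double_add ptime_rules)+
qed

text \<open>Capping the leading digits early is harmless, since
  \<open>min m (2 * min m a + b) = min m (2 * a + b)\<close>.\<close>

lemma capped_value_conv: "capped_value z (encode_nat n) = unary (min (tlen z) n)"
proof (induction n rule: bits.induct)
  case (1 n)
  show ?case
  proof (cases "n = 0")
    case True
    then show ?thesis by (simp add: capped_value_def encode_nat_def bits.simps unary_def)
  next
    case False
    then have "encode_nat n = Node (encode_bool (odd n)) (encode_nat (n div 2))"
      by (simp add: encode_nat_def bits.simps[of n])
    then have "capped_value z (encode_nat n) =
        guard (unary (tlen z)) (double_add (encode_bool (odd n)) (unary (min (tlen z) (n div 2))))"
      using 1 False by (simp add: capped_value_def to_unary_conv)
    also have "\<dots> = unary (min (tlen z) (2 * min (tlen z) (n div 2) + of_bool (odd n)))"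
      by (simp only: double_add_unary guard_unary)
    also have "min (tlen z) (2 * min (tlen z) (n div 2) + of_bool (odd n)) =
        min (tlen z) (2 * (n div 2) + of_bool (odd n))"
      by (simp add: min_def)
    also have "2 * (n div 2) + of_bool (odd n) = n"
      by (cases "odd n") auto
    finally show ?thesis .
  qed
qed

definition extend :: "tree \<Rightarrow> tree \<Rightarrow> tree \<Rightarrow> tree" where
  "extend z x a = guard z (tappend (tmap (\<lambda>s. Node x s) a) a)"

lemma ptime_extend: "ptime f \<Longrightarrow> ptime g \<Longrightarrow> ptime h \<Longrightarrow> ptime (\<lambda>e. extend (f e) (g e) (h e))"
  by (rule ptime_comp3[where F=extend]) (simp_all only: extend_def, intro ptime_guard ptime_rules)

text \<open>
  The length of \<open>z\<close> cuts off the enumeration, so that the cost is polynomial in the sizes of \<open>z\<close> and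
  \<open>t\<close>. If the cut-off takes effect then the result is meaningless.
\<close>

definition sublists :: "tree \<Rightarrow> tree \<Rightarrow> tree" where
  "sublists z t = foldr (extend z) (tlist t) (Node Leaf Leaf)"

lemma sublists_conv:
  assumes "2 ^ tlen t \<le> tlen z"
  shows "sublists z t = encode_list (map encode_list (subseqs (tlist t)))"
proof -
  have "foldr (extend z) xs (Node Leaf Leaf) = encode_list (map encode_list (subseqs xs))"
    if "2 ^ length xs \<le> tlen z" for xs
    using that
  proof (induction xs)
    case (Cons x xs)
    have "length (subseqs (x # xs)) = 2 ^ length (x # xs)" by (rule length_subseqs)
    then have "length (subseqs (x # xs)) \<le> tlen z" using Cons.prems by simp
    then have "shorter (encode_list (map encode_list (subseqs (x # xs)))) z" by (simp add: shorter_def)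
    then show ?case using Cons
      by (simp add: extend_def guard_def tappend_def tmap_def Let_def comp_def)
  qed simp
  then show ?thesis using assms unfolding sublists_def by blast
qed

text \<open>The guard limits the number of elements. When it fires, the elements are replaced by
  those of \<open>z\<close>, so the bound on a single element contains
  \<open>tree_size z\<close>.\<close>

lemma tree_size_sublists:
  fixes z :: tree and ys :: "tree list"
  defines "a \<equiv> foldr (extend z) ys (Node Leaf Leaf)"
  shows "tree_size a \<le> (tlen z + 1) * ((\<Sum>x\<leftarrow>ys. tree_size x + 1) + tree_size z + 2) + 1"
proof -
  let ?b = "\<lambda>ys. (\<Sum>x\<leftarrow>ys. tree_size x + 1) + 1 + tree_size z"
  have elems: "\<forall>s\<in>tset (foldr (extend z) ys (Node Leaf Leaf)). tree_size s \<le> ?b ys" for ys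
  proof (induction ys)
    case (Cons y ys)
    show ?case
    proof
      fix s
      let ?a = "foldr (extend z) ys (Node Leaf Leaf)"
      assume "s \<in> tset (foldr (extend z) (y # ys) (Node Leaf Leaf))"
      then consider "s \<in> tset z" | s' where "s = Node y s'" "s' \<in> tset ?a" | "s \<in> tset ?a"
        by (auto simp: extend_def guard_def split: if_splits)
      then show "tree_size s \<le> ?b (y # ys)"
      proof cases
        case 1
        then show ?thesis using tree_size_elem by (simp add: trans_le_add2 le_SucI)
      next
        case 2
        then have "tree_size s' \<le> ?b ys" using Cons by blast
        then show ?thesis using 2 by simp
      next
        case 3
        then have "tree_size s \<le> ?b ys" using Cons by blast
        then show ?thesis by simp
      qed
    qed
  qed simp
  \<comment> \<open>The start value has one element even if \<open>z\<close> is empty, whence the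
    1.\<close>
  have "tlen a \<le> tlen z + 1"
    unfolding a_def by (cases ys) (auto simp: extend_def guard_def shorter_def)
  have "tree_size a = (\<Sum>x\<leftarrow>tlist a. tree_size x + 1) + 1" by (rule tree_size_conv)
  also have "(\<Sum>x\<leftarrow>tlist a. tree_size x + 1) \<le> (\<Sum>x\<leftarrow>tlist a. ?b ys + 1)"
    using elems[of ys] by (intro sum_list_mono) (auto simp: a_def)
  also have "\<dots> = tlen a * (?b ys + 1)" by (simp add: sum_list_triv)
  also have "\<dots> \<le> (tlen z + 1) * (?b ys + 1)"
    using \<open>tlen a \<le> tlen z + 1\<close> by (rule mult_le_mono1)
  finally show ?thesis by (simp add: add_ac)
qed

lemma ptime_sublists: "ptime g \<Longrightarrow> ptime h \<Longrightarrow> ptime (\<lambda>e. sublists (g e) (h e))"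
proof (rule ptime_comp2[where F=sublists])
  show "ptime (\<lambda>e. sublists (arg e 0) (arg e 1))"
    unfolding sublists_def
  proof (rule ptime_fold[where h="\<lambda>x a e. extend (arg e 0) x a" and
        S="\<lambda>e. (tree_size (arg e 0) + 1) * (tree_size (arg e 1) + tree_size (arg e 0) + 1) + 1"])
    show "poly_bounded esize
        (\<lambda>e. (tree_size (arg e 0) + 1) * (tree_size (arg e 1) + tree_size (arg e 0) + 1) + 1)"
      by (intro poly_bounded_add poly_bounded_mult poly_bounded_const feasible_size ptime_arg)
    fix e zs ys
    assume "tlist (arg e 1) = zs @ ys"
    then have "(\<Sum>x\<leftarrow>ys. tree_size x + 1) + tree_size (arg e 0) + 2 \<le>
        tree_size (arg e 1) + tree_size (arg e 0) + 1"
      using tree_size_suffix[of "arg e 1" zs ys] by simp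
    moreover have "tlen (arg e 0) + 1 \<le> tree_size (arg e 0) + 1"
      using length_tlist_le by simp
    ultimately have "(tlen (arg e 0) + 1) * ((\<Sum>x\<leftarrow>ys. tree_size x + 1) + tree_size (arg e 0) + 2) \<le>
        (tree_size (arg e 0) + 1) * (tree_size (arg e 1) + tree_size (arg e 0) + 1)"
      by (intro mult_le_mono)
    then show "tree_size (foldr (\<lambda>x a. extend (arg e 0) x a) ys (Node Leaf Leaf)) \<le>
        (tree_size (arg e 0) + 1) * (tree_size (arg e 1) + tree_size (arg e 0) + 1) + 1"
      using tree_size_sublists[where z="arg e 0" and ys=ys] by linarith
  qed (intro ptime_extend ptime_rules)+
qed

section \<open>Iterated doubling\<close>

definition doubling :: "tree \<Rightarrow> tree \<Rightarrow> tree" where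
  "doubling n a = foldr (\<lambda>_ a. tappend a a) (tlist n) a"

lemma doubling_unary: "doubling n (unary m) = unary (m * 2 ^ tlen n)"
proof -
  have "foldr (\<lambda>_ a. tappend a a) xs (unary m) = unary (m * 2 ^ length xs)" for xs :: "tree list"
    by (induction xs) (auto simp: tappend_def unary_def replicate_add[symmetric] algebra_simps)
  then show ?thesis unfolding doubling_def .
qed

text \<open>The result is exponential in the length of the counter, so the exponential is made part
  of the measure.\<close>

lemma feasible_doubling:
  "feasible (\<lambda>e. esize e + 2 ^ tlen (arg e 0)) (\<lambda>e. doubling (arg e 0) (arg e 1))"
    (is "feasible ?\<mu> _")
  unfolding doubling_def
proof (rule feasible_fold[where S="\<lambda>e. ?\<mu> e * (?\<mu> e + 1)"])
  show \<mu>: "poly_bounded ?\<mu> esize" by (rule poly_bounded_mono[OF poly_bounded_self]) simp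
  show "feasible ?\<mu> (\<lambda>e. arg e 0)" "feasible ?\<mu> (\<lambda>e. arg e 1)" using \<mu> by (rule feasible_arg)+
  show "poly_bounded ?\<mu> (\<lambda>e. ?\<mu> e * (?\<mu> e + 1))"
    by (intro poly_bounded_mult poly_bounded_add[of _ ?\<mu>] poly_bounded_const poly_bounded_self)
  show "ptime (\<lambda>e. tappend (arg e 1) (arg e 1))" by (intro ptime_rules)
  fix e zs ys
  assume zs: "tlist (arg e 0) = zs @ ys"
  let ?a = "\<lambda>ys :: tree list. foldr (\<lambda>_ a. tappend a a) ys (arg e 1)"
  have "tree_size (?a ys) \<le> 2 ^ length ys * tree_size (arg e 1)"
  proof (induction ys)
    case (Cons y ys)
    then show ?case using tree_size_tappend[of "?a ys" "?a ys"] by simp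
  qed simp
  also have "\<dots> \<le> ?\<mu> e * (?\<mu> e + 1)"
  proof (rule mult_le_mono)
    have "(2::nat) ^ length ys \<le> 2 ^ tlen (arg e 0)" using zs by (intro power_increasing) simp_all
    then show "2 ^ length ys \<le> ?\<mu> e" by (rule trans_le_add2)
    show "tree_size (arg e 1) \<le> ?\<mu> e + 1" using tree_size_arg[of e 1] by simp
  qed
  finally show "tree_size (?a ys) \<le> ?\<mu> e * (?\<mu> e + 1)" .
qed

text \<open>The uncapped conversion; it only serves to show that the bounding function is
  computable.\<close>

definition binary_value :: "tree \<Rightarrow> tree" where
  "binary_value b = foldr double_add (tlist b) Leaf"

lemma binary_value_encode_nat: "binary_value (encode_nat n) = unary n"
proof (induction n rule: bits.induct)
  case (1 n)
  show ?case
  proof (cases "n = 0")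
    case True
    then show ?thesis by (simp add: binary_value_def encode_nat_def bits.simps unary_def)
  next
    case False
    then have "binary_value (encode_nat n) = double_add (encode_bool (odd n)) (unary (n div 2))"
      using 1 by (simp add: binary_value_def encode_nat_def bits.simps[of n])
    then show ?thesis by (simp add: double_add_unary)
  qed
qed

lemma feasible_binary_value:
  "feasible (\<lambda>e. esize e + 2 ^ tlen (arg e 0)) (\<lambda>e. binary_value (arg e 0))" (is "feasible ?\<mu> _")
  unfolding binary_value_def
proof (rule feasible_fold[where S="\<lambda>e. 2 * ?\<mu> e + 1"])
  show \<mu>: "poly_bounded ?\<mu> esize" by (rule poly_bounded_mono[OF poly_bounded_self]) simp
  show "feasible ?\<mu> (\<lambda>e. arg e 0)" using \<mu> by (rule feasible_arg)
  show "poly_bounded ?\<mu> (\<lambda>e. 2 * ?\<mu> e + 1)"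
    by (intro poly_bounded_mult poly_bounded_add[of _ "\<lambda>e. 2 * ?\<mu> e"] poly_bounded_const poly_bounded_self)
  fix e zs ys
  assume zs: "tlist (arg e 0) = zs @ ys"
  have "\<exists>m<2 ^ length ys. foldr double_add ys Leaf = unary m"
  proof (induction ys)
    case Nil
    show ?case by (simp add: unary_def)
  next
    case (Cons y ys)
    then obtain m where m: "m < 2 ^ length ys" "foldr double_add ys Leaf = unary m" by blast
    have "double_add y (unary m) = unary (2 * m + of_bool (y \<noteq> Leaf))"
      using double_add_unary[of "y \<noteq> Leaf" m] by (simp add: double_add_def)
    then show ?case using m by (intro exI[of _ "2 * m + of_bool (y \<noteq> Leaf)"]) auto
  qed
  then obtain m where m: "m < 2 ^ length ys" "foldr double_add ys Leaf = unary m" by blast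
  have "(2::nat) ^ length ys \<le> 2 ^ tlen (arg e 0)" using zs by (intro power_increasing) simp_all
  then have "m \<le> ?\<mu> e" using m(1) by linarith
  then show "tree_size (foldr double_add ys Leaf) \<le> 2 * ?\<mu> e + 1"
    unfolding m(2) tree_size_unary by simp
qed (intro ptime_double_add ptime_rules)+

lemma feasible_unary: "feasible \<mu> (\<lambda>e. unary n)"
proof (induction n)
  case (Suc n)
  then show ?case using feasible_Node[OF feasible_Leaf] by (simp add: unary_def)
qed (simp add: unary_def feasible_Leaf)

lemma feasible_program:
  assumes "feasible \<mu> g"
  shows "\<exists>p c. \<forall>x. \<exists>t. runs_in p x (g [x]) t \<and> t \<le> (\<mu> [x] + 2) ^ c"
proof -
  obtain T c where T: "implements T g" "\<And>e. T e \<le> (\<mu> e + 2) ^ c"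
    using assms unfolding feasible_def poly_bounded_def by blast
  obtain e code where *: "realizes 0 1 T g e code" using T(1) by (rule implementsE)
  have "\<exists>t \<le> T [x]. runs_in (e, code) x (g [x]) t" for x
    using realizesD[OF *, of "[]" "[x]" "[]"] by (simp add: runs_in_def)
  then show ?thesis using T(2) le_trans by metis
qed

section \<open>Fixed-parameter tractability\<close>

text \<open>In binary, least significant bit first, the value is \<open>n * 2 ^ m\<close> zeros
  followed by a one. As the bit zero is encoded by \<open>Leaf\<close>, a unary number already is
  such a block of zeros.\<close>

lemma computable_double_exponential: "computable (\<lambda>m. 2 ^ (n * 2 ^ m))"
proof -
  define g where "g e = tappend (doubling (binary_value (arg e 0)) (unary n)) (Node (Node Leaf Leaf) Leaf)" for e
  have bits: "bits (2 ^ i) = replicate i False @ [True]" for i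
    by (induction i) (auto simp: bits.simps)
  have g: "g [encode_nat m] = encode_nat (2 ^ (n * 2 ^ m))" for m
  proof -
    have "g [encode_nat m] = tappend (unary (n * 2 ^ m)) (Node (Node Leaf Leaf) Leaf)"
      by (simp add: g_def binary_value_encode_nat doubling_unary)
    also have "\<dots> = encode_nat (2 ^ (n * 2 ^ m))"
      by (simp add: encode_nat_def bits tappend_def)
    finally show ?thesis .
  qed
  \<comment> \<open>Computability only asks for termination, so the measure may contain the
    exponentials of both iterations.\<close>
  define \<mu> where "\<mu> e = esize e + 2 ^ tlen (arg e 0) + 2 ^ tlen (binary_value (arg e 0))" for e
  have b: "feasible \<mu> (\<lambda>e. binary_value (arg e 0))"
    by (rule feasible_measure[OF feasible_binary_value poly_bounded_mono[OF poly_bounded_self]])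
      (simp add: \<mu>_def)
  have "feasible \<mu> (\<lambda>e. doubling (binary_value (arg e 0)) (unary n))"
  proof -
    have "poly_bounded \<mu> (\<lambda>e. (tree_size (binary_value (arg e 0)) + tree_size (unary n)) + \<mu> e)"
      by (intro poly_bounded_add feasible_size[OF b] poly_bounded_const poly_bounded_self)
    then have "poly_bounded \<mu>
        (\<lambda>e. tree_size (binary_value (arg e 0)) + tree_size (unary n) + 2 ^ tlen (binary_value (arg e 0)))"
      by (rule poly_bounded_mono) (simp add: \<mu>_def)
    then show ?thesis
      using feasible_call[OF feasible_doubling, of "[\<lambda>e. binary_value (arg e 0), \<lambda>e. unary n]" \<mu>] b
        feasible_unary by auto
  qed
  then have "feasible \<mu> g"
    unfolding g_def by (intro feasible_tappend feasible_Node feasible_Leaf)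
  from feasible_program[OF this] show ?thesis
    unfolding computable_def using g by metis
qed

text \<open>A polynomial in the sum of the size \<open>s\<close> and
  \<open>E = 2 ^ 2 ^ \<kappa> x\<close> factors as required, because
  \<open>s + E + 2 \<le> 4 * s * E\<close> for positive \<open>s\<close> and \<open>E\<close>. A
  fixed power of \<open>4 * E\<close> is at most
  \<open>2 ^ (3 * b * 2 ^ \<kappa> x)\<close>.\<close>

lemma fixed_parameter_tractableI:
  assumes g: "feasible \<mu> g" and "\<And>x. x \<in> I \<Longrightarrow> g [enc x] = encode_bool (Q x)"
    and \<mu>: "\<And>x. x \<in> I \<Longrightarrow> \<mu> [enc x] \<le> (tree_size (enc x) + 2 ^ 2 ^ \<kappa> x + 2) ^ d"
  shows "fixed_parameter_tractable I enc Q \<kappa>"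
proof -
  obtain p c where p: "\<And>x. \<exists>t. runs_in p x (g [x]) t \<and> t \<le> (\<mu> [x] + 2) ^ c"
    using feasible_program[OF g] by blast
  \<comment> \<open>The additive 2 in the cost is absorbed by two further factors \<open>?N\<close>,
    as \<open>?N ^ 2 \<ge> 4\<close>.\<close>
  define b where "b = (d + 2) * c"
  have "(\<mu> [enc x] + 2) ^ c \<le> 2 ^ (3 * b * 2 ^ \<kappa> x) * tree_size (enc x) ^ b" if x: "x \<in> I" for x
  proof -
    let ?s = "tree_size (enc x)"
    let ?E = "2 ^ 2 ^ \<kappa> x :: nat"
    let ?N = "?s + ?E + 2"
    have E: "1 \<le> ?E" by simp
    have "?s > 0" by simp
    have "\<mu> [enc x] + 2 \<le> ?N ^ d + 2" using \<mu>[OF x] by simp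
    also have "\<dots> \<le> ?N ^ d * ?N ^ 2"
    proof -
      have "1 \<le> ?N ^ d" by (rule one_le_power) simp
      moreover have "4 \<le> ?N ^ 2" using power_mono[of 2 ?N 2] by simp
      then have "?N ^ d * 4 \<le> ?N ^ d * ?N ^ 2" by (rule mult_le_mono2)
      ultimately show ?thesis by linarith
    qed
    also have "\<dots> = ?N ^ (d + 2)" by (simp only: power_add)
    finally have "(\<mu> [enc x] + 2) ^ c \<le> ?N ^ b"
      unfolding b_def power_mult by (rule power_mono) simp
    also have "?N \<le> ?s * (2 ^ 2 * ?E)"
    proof -
      have "?s + ?E + 2 \<le> ?s * ?E + ?s * ?E + 2 * (?s * ?E)"
        using E \<open>?s > 0\<close> by (intro add_mono) (simp_all add: Suc_le_eq)
      then show ?thesis by simp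
    qed
    then have "?N ^ b \<le> (?s * (2 ^ 2 * ?E)) ^ b" by (rule power_mono) simp
    also have "\<dots> = 2 ^ ((2 + 2 ^ \<kappa> x) * b) * ?s ^ b"
      by (simp only: power_mult_distrib power_add[symmetric] power_mult[symmetric] mult.commute)
    also have "\<dots> \<le> 2 ^ (3 * b * 2 ^ \<kappa> x) * ?s ^ b"
    proof (intro mult_le_mono1 power_increasing)
      have "2 + 2 ^ \<kappa> x \<le> (3 * 2 ^ \<kappa> x :: nat)" by simp
      then have "(2 + 2 ^ \<kappa> x) * b \<le> 3 * 2 ^ \<kappa> x * b" by (rule mult_le_mono1)
      then show "(2 + 2 ^ \<kappa> x) * b \<le> 3 * b * 2 ^ \<kappa> x" by (simp only: mult_ac)
    qed simp
    finally show ?thesis .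
  qed
  then have "\<forall>x\<in>I. \<exists>t. runs_in p (enc x) (encode_bool (Q x)) t \<and>
      t \<le> 2 ^ (3 * b * 2 ^ \<kappa> x) * tree_size (enc x) ^ b"
    using p assms(2) by (metis le_trans)
  then show ?thesis
    unfolding fixed_parameter_tractable_def
    by (intro exI[of _ p] exI[of _ "\<lambda>m. 2 ^ (3 * b * 2 ^ m)"] exI[of _ b] conjI
        computable_double_exponential)
qed

section \<open>A transport lemma\<close>

text \<open>The least number of vertices that a unit of size \<open>d S\<close> hitting exactly the
  modules in \<open>S\<close> must take from the modules in \<open>U\<close>: all of them if it has
  no other modules, otherwise at least one from each common module.\<close>

definition demand :: "('a set \<Rightarrow> nat) \<Rightarrow> 'a set \<Rightarrow> 'a set \<Rightarrow> nat" where
  "demand d S U = (if S \<subseteq> U then d S else card (S \<inter> U))"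

text \<open>\<open>card (S \<inter> _)\<close> is modular, and the jump up to \<open>d S\<close>
  happens exactly on supersets of \<open>S\<close>. If only one of the two sets contains
  \<open>S\<close>, the union jumps with it; if neither does, only the union can still gain.\<close>

lemma demand_supermodular:
  assumes "finite S" "card S \<le> d S"
  shows "demand d S A + demand d S B \<le> demand d S (A \<union> B) + demand d S (A \<inter> B)"
proof -
  have *: "card (S \<inter> A) + card (S \<inter> B) = card (S \<inter> (A \<union> B)) + card (S \<inter> (A \<inter> B))"
    using card_Un_Int[of "S \<inter> A" "S \<inter> B"] assms by (simp add: Int_Un_distrib Int_ac)
  consider "S \<subseteq> A" "S \<subseteq> B" | "S \<subseteq> A" "\<not> S \<subseteq> B" | "\<not> S \<subseteq> A" "S \<subseteq> B" | "\<not> S \<subseteq> A" "\<not> S \<subseteq> B"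
    by blast
  then show ?thesis
  proof cases
    case 2
    then have "S \<inter> (A \<inter> B) = S \<inter> B" "S \<subseteq> A \<union> B" by auto
    with 2 show ?thesis by (simp add: demand_def)
  next
    case 3
    then have "S \<inter> (A \<inter> B) = S \<inter> A" "S \<subseteq> A \<union> B" by auto
    with 3 show ?thesis by (simp add: demand_def)
  next
    case 4
    then have "\<not> S \<subseteq> A \<inter> B" by blast
    moreover have "card (S \<inter> (A \<union> B)) \<le> demand d S (A \<union> B)"
      using assms by (auto simp: demand_def Int_absorb2)
    ultimately show ?thesis using * 4 by (simp add: demand_def)
  qed (auto simp: demand_def)
qed

text \<open>
  If no point of \<open>S0\<close> admits sending one unit of the excess demand of \<open>S0\<close> to it, then every
  point of \<open>S0\<close> lies in a tight set not containing \<open>S0\<close>. By supermodularity the union of these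
  sets is tight even for the demand without the excess, which contradicts the hypothesis.
\<close>

lemma transport_step:
  assumes fin: "finite R" "finite F" and sub: "\<And>S. S \<in> F \<Longrightarrow> S \<subseteq> R"
    and d: "\<And>S. S \<in> F \<Longrightarrow> card S \<le> d S"
    and hall: "\<And>U. U \<subseteq> R \<Longrightarrow> (\<Sum>S\<in>F. demand d S U) \<le> (\<Sum>u\<in>U. c u)"
    and S0: "S0 \<in> F" "card S0 < d S0"
  shows "\<exists>u\<in>S0. 0 < c u \<and> (\<forall>U\<subseteq>R. (\<Sum>S\<in>F. demand (d(S0 := d S0 - 1)) S U) \<le>
    (\<Sum>u'\<in>U. (c(u := c u - 1)) u'))"
proof (rule ccontr)
  assume no: "\<not> ?thesis"
  have finS: "finite S" if "S \<in> F" for S using sub[OF that] fin(1) finite_subset by blast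
  \<comment> \<open>\<open>?d'\<close> gives up one unit of the excess of \<open>S0\<close>,
    \<open>?d0\<close> all of it. On sets not containing \<open>S0\<close> both demand the same as
    \<open>d\<close>.\<close>
  let ?d' = "d(S0 := d S0 - 1)"
  let ?d0 = "d(S0 := card S0)"
  let ?dem = "\<lambda>d U. \<Sum>S\<in>F. demand d S U"
  let ?c = "\<lambda>U. \<Sum>u\<in>U. c u"
  have split: "?dem d' U = demand d' S0 U + (\<Sum>S\<in>F - {S0}. demand d S U)"
    if "\<And>S. S \<noteq> S0 \<Longrightarrow> d' S = d S" for d' U
  proof -
    have "(\<Sum>S\<in>F - {S0}. demand d' S U) = (\<Sum>S\<in>F - {S0}. demand d S U)"
      using that by (intro sum.cong) (auto simp: demand_def)
    then show ?thesis using sum.remove[OF fin(2) S0(1), of "\<lambda>S. demand d' S U"] by simp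
  qed
  have "\<exists>U\<subseteq>R. u \<in> U \<and> ?dem ?d0 U = ?c U" if u: "u \<in> S0" for u
  proof -
    have "u \<in> R" using u S0 sub by blast
    have "0 < demand d S0 {u}" using u S0(2) by (auto simp: demand_def)
    then have "0 < ?dem d {u}" using split[of d "{u}"] by simp
    with hall[of "{u}"] \<open>u \<in> R\<close> have cu: "0 < c u" by simp
    then obtain U where U: "U \<subseteq> R" "\<not> ?dem ?d' U \<le> (\<Sum>u'\<in>U. (c(u := c u - 1)) u')"
      using no u by blast
    have finU: "finite U" using U(1) fin(1) finite_subset by blast
    have dem': "?dem ?d' U \<le> ?dem d U"
      by (intro sum_mono) (auto simp: demand_def)
    have "u \<in> U"
    proof (rule ccontr)
      assume "u \<notin> U"
      then have "(\<Sum>u'\<in>U. (c(u := c u - 1)) u') = ?c U" by (intro sum.cong) auto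
      then show False using U hall[OF U(1)] dem' by simp
    qed
    have c': "(\<Sum>u'\<in>U. (c(u := c u - 1)) u') + 1 = ?c U"
    proof -
      have "(\<Sum>u'\<in>U - {u}. (c(u := c u - 1)) u') = (\<Sum>u'\<in>U - {u}. c u')"
        by (intro sum.cong) auto
      then show ?thesis
        using sum.remove[OF finU \<open>u \<in> U\<close>, of c] sum.remove[OF finU \<open>u \<in> U\<close>, of "c(u := c u - 1)"] cu
        by simp
    qed
    have "\<not> S0 \<subseteq> U"
    proof
      assume "S0 \<subseteq> U"
      then have "demand ?d' S0 U + 1 = demand d S0 U" using S0(2) by (simp add: demand_def)
      then have "?dem ?d' U + 1 = ?dem d U" using split[of ?d' U] split[of d U] by simp
      then show False using U c' hall[OF U(1)] by simp
    qed
    then have "demand ?d' S0 U = demand d S0 U" "demand ?d0 S0 U = demand d S0 U"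
      by (simp_all add: demand_def)
    then have "?dem ?d' U = ?dem d U" "?dem ?d0 U = ?dem d U"
      using split[of ?d' U] split[of d U] split[of ?d0 U] by simp_all
    then have "?dem ?d0 U = ?c U" using U(2) c' hall[OF U(1)] by simp
    then show ?thesis using U(1) \<open>u \<in> U\<close> by blast
  qed
  then obtain W where W: "\<And>u. u \<in> S0 \<Longrightarrow> W u \<subseteq> R \<and> u \<in> W u \<and> ?dem ?d0 (W u) = ?c (W u)"
    by metis
  have le0: "?dem ?d0 U \<le> ?c U" if "U \<subseteq> R" for U
  proof -
    have "?dem ?d0 U \<le> ?dem d U" using S0(2) by (intro sum_mono) (auto simp: demand_def)
    then show ?thesis using hall[OF that] by simp
  qed
  have tight: "?dem ?d0 (\<Union>(W ` T)) = ?c (\<Union>(W ` T))" if "finite T" "T \<subseteq> S0" for T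
    using that
  proof (induction T)
    case empty
    then show ?case using le0[of "{}"] by (simp del: fun_upd_apply)
  next
    case (insert u T)
    let ?A = "W u" and ?B = "\<Union>(W ` T)"
    have AB: "?A \<subseteq> R" "?B \<subseteq> R" using insert.prems W by blast+
    have "?c ?A + ?c ?B = ?dem ?d0 ?A + ?dem ?d0 ?B"
      using insert W by (simp del: fun_upd_apply)
    also have "\<dots> \<le> ?dem ?d0 (?A \<union> ?B) + ?dem ?d0 (?A \<inter> ?B)"
      unfolding sum.distrib[symmetric] using finS d
      by (intro sum_mono demand_supermodular) auto
    also have "?dem ?d0 (?A \<inter> ?B) \<le> ?c (?A \<inter> ?B)" using AB by (intro le0) blast
    finally have "?c ?A + ?c ?B \<le> ?dem ?d0 (?A \<union> ?B) + ?c (?A \<inter> ?B)"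
      by (simp del: fun_upd_apply)
    moreover have "?c (?A \<union> ?B) + ?c (?A \<inter> ?B) = ?c ?A + ?c ?B"
      using AB fin(1) by (intro sum.union_inter) (auto intro: finite_subset)
    ultimately have "?c (?A \<union> ?B) \<le> ?dem ?d0 (?A \<union> ?B)"
      by (simp del: fun_upd_apply)
    then show ?case using le0[of "?A \<union> ?B"] AB by (simp del: fun_upd_apply)
  qed
  define X where "X = \<Union>(W ` S0)"
  have "S0 \<subseteq> X" "X \<subseteq> R" using W unfolding X_def by blast+
  then have "demand ?d0 S0 X < demand d S0 X" using S0(2) by (simp add: demand_def)
  then have "?dem ?d0 X < ?dem d X" using split[of ?d0 X] split[of d X] by simp
  moreover have "?dem ?d0 X = ?c X" unfolding X_def using tight finS[OF S0(1)] by blast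
  ultimately show False using hall[OF \<open>X \<subseteq> R\<close>] by simp
qed

text \<open>\<open>x S u\<close> is the number of vertices that the unit for \<open>S\<close> takes
  from the module \<open>u\<close> with \<open>c u\<close> vertices. The induction runs over the
  total excess, each step committing one unit of it to some \<open>u\<close>. Without excess the
  constant 1 is a solution: the Hall condition for a singleton is then the capacity
  constraint.\<close>

lemma transport:
  assumes fin: "finite R" "finite F" and sub: "\<And>S. S \<in> F \<Longrightarrow> S \<subseteq> R"
    and d: "\<And>S. S \<in> F \<Longrightarrow> card S \<le> d S"
    and hall: "\<And>U. U \<subseteq> R \<Longrightarrow> (\<Sum>S\<in>F. demand d S U) \<le> (\<Sum>u\<in>U. c u)"
  shows "\<exists>x. (\<forall>S\<in>F. (\<forall>u\<in>S. 0 < x S u) \<and> (\<Sum>u\<in>S. x S u) = d S) \<and>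
    (\<forall>u\<in>R. (\<Sum>S\<in>{S \<in> F. u \<in> S}. x S u) \<le> (c u :: nat))"
  using d hall
proof (induction "\<Sum>S\<in>F. d S - card S" arbitrary: d c)
  case 0
  have finS: "finite S" if "S \<in> F" for S using sub[OF that] fin(1) finite_subset by blast
  have d: "d S = card S" if "S \<in> F" for S
  proof -
    have "d S - card S = 0" using 0(1)[symmetric] fin(2) that by (simp only: sum_eq_0_iff)
    then show ?thesis using 0(2)[OF that] by linarith
  qed
  have "(\<Sum>S\<in>{S \<in> F. u \<in> S}. 1) \<le> c u" if "u \<in> R" for u
  proof -
    have "demand d S {u} = (if u \<in> S then 1 else 0)" if "S \<in> F" for S
    proof (cases "S \<subseteq> {u}")
      case True
      then consider "S = {}" | "S = {u}" by blast
      then show ?thesis using d[OF that] by cases (simp_all add: demand_def)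
    next
      case False
      then show ?thesis by (cases "u \<in> S") (simp_all add: demand_def Int_insert_right)
    qed
    then have "(\<Sum>S\<in>F. demand d S {u}) = (\<Sum>S\<in>F. if u \<in> S then 1 else 0)" by simp
    also have "\<dots> = (\<Sum>S\<in>{S \<in> F. u \<in> S}. 1)" using fin(2) by (simp add: sum.If_cases Int_def)
    finally show ?thesis using 0(3)[of "{u}"] that by simp
  qed
  then show ?case using d by (intro exI[of _ "\<lambda>S u. 1"]) auto
next
  case (Suc n)
  have finS: "finite S" if "S \<in> F" for S using sub[OF that] fin(1) finite_subset by blast
  have "\<exists>S0\<in>F. card S0 < d S0"
  proof (rule ccontr)
    assume "\<not> ?thesis"
    then have "(\<Sum>S\<in>F. d S - card S) = 0" by (auto simp: not_less)
    with Suc.hyps(2) show False by simp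
  qed
  then obtain S0 where S0: "S0 \<in> F" "card S0 < d S0" by blast
  obtain u0 where u0: "u0 \<in> S0" "0 < c u0" and hall': "\<And>U. U \<subseteq> R \<Longrightarrow>
      (\<Sum>S\<in>F. demand (d(S0 := d S0 - 1)) S U) \<le> (\<Sum>u\<in>U. (c(u0 := c u0 - 1)) u)"
    using transport_step[OF fin sub Suc.prems S0] by blast
  let ?d = "d(S0 := d S0 - 1)" and ?c = "c(u0 := c u0 - 1)"
  have "(\<Sum>S\<in>F - {S0}. ?d S - card S) = (\<Sum>S\<in>F - {S0}. d S - card S)"
    by (intro sum.cong) auto
  then have "n = (\<Sum>S\<in>F. ?d S - card S)"
    using Suc.hyps(2) S0 sum.remove[OF fin(2) S0(1), of "\<lambda>S. d S - card S"]
      sum.remove[OF fin(2) S0(1), of "\<lambda>S. ?d S - card S"] by simp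
  moreover have "card S \<le> ?d S" if "S \<in> F" for S using Suc.prems(1)[OF that] S0 by auto
  ultimately have "\<exists>x. (\<forall>S\<in>F. (\<forall>u\<in>S. 0 < x S u) \<and> (\<Sum>u\<in>S. x S u) = ?d S) \<and>
      (\<forall>u\<in>R. (\<Sum>S\<in>{S \<in> F. u \<in> S}. x S u) \<le> ?c u)"
    using hall' by (rule Suc.hyps(1))
  then obtain x where x: "\<And>S. S \<in> F \<Longrightarrow> (\<forall>u\<in>S. 0 < x S u) \<and> (\<Sum>u\<in>S. x S u) = ?d S"
      and xc: "\<And>u. u \<in> R \<Longrightarrow> (\<Sum>S\<in>{S \<in> F. u \<in> S}. x S u) \<le> ?c u"
    by blast
  define y where "y S u = (if S = S0 \<and> u = u0 then x S u + 1 else x S u)" for S u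
  have "(\<Sum>u\<in>S. y S u) = d S" if "S \<in> F" for S
  proof (cases "S = S0")
    case True
    have "(\<Sum>u\<in>S0 - {u0}. y S0 u) = (\<Sum>u\<in>S0 - {u0}. x S0 u)"
      by (intro sum.cong) (auto simp: y_def)
    then have "(\<Sum>u\<in>S0. y S0 u) = (\<Sum>u\<in>S0. x S0 u) + 1"
      using sum.remove[OF finS[OF S0(1)] u0(1), of "y S0"] sum.remove[OF finS[OF S0(1)] u0(1), of "x S0"]
      by (simp add: y_def)
    then show ?thesis using True x[OF S0(1)] S0 by simp
  next
    case False
    then have "(\<Sum>u\<in>S. y S u) = (\<Sum>u\<in>S. x S u)" by (intro sum.cong) (auto simp: y_def)
    then show ?thesis using False x[OF that] by simp
  qed
  moreover have "(\<Sum>S\<in>{S \<in> F. u \<in> S}. y S u) \<le> c u" if "u \<in> R" for u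
  proof (cases "u = u0")
    case True
    let ?F = "{S \<in> F. u0 \<in> S}"
    have F: "finite ?F" "S0 \<in> ?F" using fin(2) S0 u0 by auto
    have "(\<Sum>S\<in>?F - {S0}. y S u0) = (\<Sum>S\<in>?F - {S0}. x S u0)"
      by (intro sum.cong) (auto simp: y_def)
    then have "(\<Sum>S\<in>?F. y S u0) = (\<Sum>S\<in>?F. x S u0) + 1"
      using sum.remove[OF F, of "\<lambda>S. y S u0"] sum.remove[OF F, of "\<lambda>S. x S u0"]
      by (simp add: y_def)
    then show ?thesis using True xc[of u0] that u0(2) by simp
  next
    case False
    then have "(\<Sum>S\<in>{S \<in> F. u \<in> S}. y S u) = (\<Sum>S\<in>{S \<in> F. u \<in> S}. x S u)"
      by (intro sum.cong) (auto simp: y_def)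
    then show ?thesis using xc[OF that] False by simp
  qed
  moreover have "\<forall>u\<in>S. 0 < y S u" if "S \<in> F" for S using x[OF that] by (auto simp: y_def)
  ultimately show ?case by (intro exI[of _ y]) blast
qed

text \<open>Greedy choice works: the sets chosen so far occupy the sum of their sizes, which leaves
  room for the next one.\<close>

lemma disjoint_choice:
  assumes "finite F" "finite M" "(\<Sum>S\<in>F. x S) \<le> card M"
  shows "\<exists>A. (\<forall>S\<in>F. A S \<subseteq> M \<and> card (A S) = x S) \<and> (\<forall>S\<in>F. \<forall>T\<in>F. S \<noteq> T \<longrightarrow> A S \<inter> A T = {})"
  using assms(1,3)
proof (induction F)
  case (insert S F)
  then obtain A where A: "\<forall>S\<in>F. A S \<subseteq> M \<and> card (A S) = x S"
    "\<forall>S\<in>F. \<forall>T\<in>F. S \<noteq> T \<longrightarrow> A S \<inter> A T = {}" by auto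
  have "card (\<Union>(A ` F)) = (\<Sum>S\<in>F. card (A S))"
    using A insert.hyps assms(2) by (intro card_UN_disjoint) (auto intro: finite_subset)
  then have "card (\<Union>(A ` F)) = (\<Sum>S\<in>F. x S)" using A(1) by simp
  moreover have "\<Union>(A ` F) \<subseteq> M" using A(1) by blast
  ultimately have "x S \<le> card (M - \<Union>(A ` F))"
    using insert.prems insert.hyps assms(2) by (simp add: card_Diff_subset finite_subset)
  then obtain B where B: "B \<subseteq> M - \<Union>(A ` F)" "card B = x S"
    using obtain_subset_with_card_n by metis
  show ?case
    using A B insert.hyps by (intro exI[of _ "A(S := B)"]) (auto 0 3)
qed simp

section \<open>Grouped domination in a graph with a quotient\<close>

text \<open>Connectedness in terms of cuts rather than paths. Cuts of the quotient pull back to cuts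
  of the graph, which makes passing to the quotient easy.\<close>

definition conn :: "('a \<Rightarrow> 'a \<Rightarrow> bool) \<Rightarrow> 'a set \<Rightarrow> bool" where
  "conn E D \<longleftrightarrow> D \<noteq> {} \<and> (\<forall>A\<subseteq>D. A \<noteq> {} \<longrightarrow> A \<noteq> D \<longrightarrow> (\<exists>a\<in>A. \<exists>b\<in>D - A. E a b))"

lemma connD:
  assumes "conn E D" "A \<subseteq> D" "a \<in> A" "b \<in> D" "b \<notin> A"
  obtains x y where "x \<in> A" "y \<in> D" "y \<notin> A" "E x y"
proof -
  have "A \<noteq> {}" "A \<noteq> D" using assms by auto
  then show ?thesis using assms(1,2) that unfolding conn_def by blast
qed

definition dominates :: "('a \<Rightarrow> 'a \<Rightarrow> bool) \<Rightarrow> 'a set \<Rightarrow> 'a set \<Rightarrow> bool" where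
  "dominates E S C \<longleftrightarrow> S \<subseteq> C \<and> (\<forall>v\<in>C. v \<in> S \<or> (\<exists>u\<in>S. E u v))"

definition units :: "('a \<Rightarrow> 'a \<Rightarrow> bool) \<Rightarrow> nat \<Rightarrow> 'a set \<Rightarrow> 'a set set \<Rightarrow> bool" where
  "units E r C \<D> \<longleftrightarrow> finite \<D> \<and> disjoint \<D> \<and> (\<forall>D\<in>\<D>. D \<subseteq> C \<and> card D = r \<and> conn E D) \<and>
     dominates E (\<Union>\<D>) C"

text \<open>
  The fibres of \<open>q\<close> are modules of the graph on \<open>C\<close>, and \<open>q v\<close> is the chosen representative of
  the module of \<open>v\<close>.
\<close>

locale modular_quotient =
  fixes E :: "'a \<Rightarrow> 'a \<Rightarrow> bool" and C :: "'a set" and q :: "'a \<Rightarrow> 'a"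
  assumes fin: "finite C"
    and sym: "\<And>x y. x \<in> C \<Longrightarrow> y \<in> C \<Longrightarrow> E x y = E y x"
    and q_in: "\<And>v. v \<in> C \<Longrightarrow> q v \<in> C"
    and q_q: "\<And>v. v \<in> C \<Longrightarrow> q (q v) = q v"
    and module: "\<And>x y. x \<in> C \<Longrightarrow> y \<in> C \<Longrightarrow> q x \<noteq> q y \<Longrightarrow> E x y = E (q x) (q y)"
    and nbr: "\<And>v. v \<in> C \<Longrightarrow> C \<noteq> {v} \<Longrightarrow> \<exists>w\<in>C. q w \<noteq> q v \<and> E v w"
    and universal: "\<And>x. x \<in> C \<Longrightarrow> \<forall>y\<in>C. q y = q x \<longrightarrow> y = x \<or> E x y \<Longrightarrow>
      \<forall>y\<in>C. q y = q x \<longrightarrow> y = q x \<or> E (q x) y"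
begin

text \<open>The members of \<open>F\<close> are the sets of representatives of the modules that the
  units hit. The lower bound \<open>min 2 r\<close> forces two modules as soon as \<open>r\<close>
  is at least 2. The last condition is the hypothesis of \<open>transport\<close> with the module
  sizes as capacities.\<close>

definition valid :: "nat \<Rightarrow> 'a set set \<Rightarrow> bool" where
  "valid r F \<longleftrightarrow> (\<forall>S\<in>F. S \<subseteq> q ` C \<and> conn E S \<and> card S \<le> r \<and> min 2 r \<le> card S) \<and>
     dominates E (\<Union>F) C \<and>
     (\<forall>U\<subseteq>q ` C. (\<Sum>S\<in>F. demand (\<lambda>S. r) S U) \<le> card {v\<in>C. q v \<in> U})"

lemma module_cong:
  assumes "x \<in> C" "x' \<in> C" "y \<in> C" "y' \<in> C" "q x = q x'" "q y = q y'" "q x \<noteq> q y"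
  shows "E x y = E x' y'"
  using module[of x y] module[of x' y'] assms by simp

lemma q_image_in: "q ` C \<subseteq> C"
  using q_in by blast

lemma q_rep: "u \<in> q ` C \<Longrightarrow> q u = u"
  using q_q by blast

text \<open>A cut that respects the modules is crossed by an edge coming from the quotient. A cut
  that separates two vertices of one module is crossed as well: both have a common neighbour in
  \<open>D\<close> from another module, and one of these two edges crosses.\<close>

lemma conn_lift:
  assumes "D \<subseteq> C" "conn E (q ` D)" "2 \<le> card (q ` D)"
  shows "conn E D"
  unfolding conn_def
proof (intro conjI allI impI)
  show "D \<noteq> {}" using assms(2) by (auto simp: conn_def)
  fix A
  assume A: "A \<subseteq> D" "A \<noteq> {}" "A \<noteq> D"
  show "\<exists>a\<in>A. \<exists>b\<in>D - A. E a b"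
  proof (cases "q ` A \<inter> q ` (D - A) = {}")
    case True
    from A obtain a b where "a \<in> A" "b \<in> D" "b \<notin> A" by blast
    then have "q a \<in> q ` A" "q b \<in> q ` D" "q b \<notin> q ` A" using True by blast+
    then obtain u l where "u \<in> q ` A" "l \<in> q ` D" "l \<notin> q ` A" "E u l"
      using connD[OF assms(2), of "q ` A"] A(1) by (metis image_mono)
    then obtain a w where w: "a \<in> A" "w \<in> D" "w \<notin> A" "E (q a) (q w)" "q w \<notin> q ` A" by blast
    then have "E a w" using module[of a w] A(1) assms(1) by (metis imageI subsetD)
    then show ?thesis using w by blast
  next
    case False
    then obtain a b where ab: "a \<in> A" "b \<in> D" "b \<notin> A" "q a = q b" by blast
    have "\<not> q ` D \<subseteq> {q a}"
      using assms(3) card_mono[of "{q a}" "q ` D"] by auto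
    then obtain l where "l \<in> q ` D" "l \<noteq> q a" by blast
    then obtain l where l: "l \<in> q ` D" "l \<noteq> q a" "E (q a) l"
      using connD[OF assms(2), of "{q a}" "q a" l] ab A(1) by blast
    then obtain w where w: "w \<in> D" "l = q w" by blast
    have C: "a \<in> C" "b \<in> C" "w \<in> C" using ab w A(1) assms(1) by blast+
    then have "E a w" using module[of a w] l w by auto
    moreover have "E w b"
      using module_cong[of a b w w] C ab l w \<open>E a w\<close> sym[of w b] by simp
    ultimately show ?thesis using ab w by blast
  qed
qed

lemma conn_project:
  assumes "D \<subseteq> C" "conn E D"
  shows "conn E (q ` D)"
  unfolding conn_def
proof (intro conjI allI impI)
  show "q ` D \<noteq> {}" using assms(2) by (auto simp: conn_def)
  fix A
  assume A: "A \<subseteq> q ` D" "A \<noteq> {}" "A \<noteq> q ` D"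
  let ?A = "{v\<in>D. q v \<in> A}"
  from A obtain a b where "a \<in> ?A" "b \<in> D" "b \<notin> ?A" by blast
  then obtain x y where "x \<in> ?A" "y \<in> D" "y \<notin> ?A" "E x y"
    using connD[OF assms(2), of ?A] by blast
  moreover from this have "E (q x) (q y)" using module[of x y] assms(1) by (metis (mono_tags, lifting) mem_Collect_eq subsetD)
  ultimately show "\<exists>a\<in>A. \<exists>b\<in>q ` D - A. E a b" by blast
qed

text \<open>The projection of \<open>D\<close> is connected with at least two elements, so the
  module of \<open>v\<close> has a neighbour there, and adjacency between modules does not depend on
  the vertices. In particular \<open>v\<close> may lie outside \<open>D\<close>.\<close>

lemma spanning_nbr:
  assumes "D \<subseteq> C" "conn E D" "2 \<le> card (q ` D)" "v \<in> C" "q v \<in> q ` D"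
  shows "\<exists>w\<in>D. q w \<noteq> q v \<and> E w v"
proof -
  have "\<not> q ` D \<subseteq> {q v}" using assms(3) card_mono[of "{q v}" "q ` D"] by auto
  then obtain l where "l \<in> q ` D" "l \<noteq> q v" by blast
  then have "\<exists>l. l \<in> q ` D \<and> l \<noteq> q v \<and> E (q v) l"
    using connD[OF conn_project[OF assms(1,2)], of "{q v}" "q v" l] assms(5) by auto
  then obtain l where l: "l \<in> q ` D" "l \<noteq> q v" "E (q v) l" by blast
  then obtain w where w: "w \<in> D" "l = q w" by blast
  moreover have "w \<in> C" using w assms(1) by blast
  ultimately have "E v w" using module[OF assms(4)] l by metis
  then have "E w v" using sym[OF assms(4) \<open>w \<in> C\<close>] by simp
  then show ?thesis using w l by metis
qed

lemma spanning_dominates: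
  assumes "\<And>D. D \<in> \<D> \<Longrightarrow> D \<subseteq> C \<and> conn E D \<and> 2 \<le> card (q ` D)"
    and "\<And>v. v \<in> C \<Longrightarrow> q v \<in> q ` \<Union>\<D> \<or> (\<exists>w\<in>\<Union>\<D>. q w \<noteq> q v \<and> E w v)"
  shows "dominates E (\<Union>\<D>) C"
proof -
  have "\<exists>u\<in>\<Union>\<D>. E u v" if v: "v \<in> C" for v
    using assms(2)[OF v]
  proof
    assume "q v \<in> q ` \<Union>\<D>"
    then obtain D where "D \<in> \<D>" "q v \<in> q ` D" by blast
    then show ?thesis using spanning_nbr[of D v] assms(1)[of D] v by blast
  qed blast
  then show ?thesis using assms(1) unfolding dominates_def by blast
qed

text \<open>Minimality is lexicographic: first the number of units, then the number of units inside
  a single module. The exchange keeps the first number and lowers the second, the deletion lowers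
  the first.\<close>

lemma minimal_units_spanning:
  assumes r: "2 \<le> r" and u: "units E r C \<D>"
    and min1: "\<And>\<D>'. units E r C \<D>' \<Longrightarrow> card \<D> \<le> card \<D>'"
    and min2: "\<And>\<D>'. units E r C \<D>' \<Longrightarrow> card \<D>' = card \<D> \<Longrightarrow>
      card {D\<in>\<D>. card (q ` D) < 2} \<le> card {D\<in>\<D>'. card (q ` D) < 2}"
    and D0: "D0 \<in> \<D>"
  shows "2 \<le> card (q ` D0)"
proof (rule ccontr)
  assume ns: "\<not> 2 \<le> card (q ` D0)"
  note U = u[unfolded units_def dominates_def]
  have D0': "D0 \<subseteq> C" "card D0 = r" "conn E D0" using U D0 by blast+
  have finD: "finite D0" using D0'(1) fin finite_subset by blast
  obtain x where x: "x \<in> D0" using D0'(3) by (auto simp: conn_def)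
  have "card (q ` D0) \<noteq> 0" using x finD by (auto simp: card_eq_0_iff)
  then have "card (q ` D0) = 1" using ns by linarith
  then have qD0: "q v = q x" if "v \<in> D0" for v
    using that x by (metis card_1_singletonE imageI singletonD)
  have xC: "x \<in> C" using x D0' by blast
  have disj: "D \<inter> D0 = {}" if "D \<in> \<D>" "D \<noteq> D0" for D
    using U D0 that by (auto simp: disjoint_def)
  have dom: "v \<in> \<Union>\<D> \<or> (\<exists>d\<in>\<Union>\<D>. E d v)" if "v \<in> C" for v using U that by blast
  show False
  proof (cases "\<exists>y\<in>C. q y \<noteq> q x \<and> E x y \<and> y \<notin> \<Union>\<D>")
    case True
    then obtain y where y: "y \<in> C" "q y \<noteq> q x" "E x y" "y \<notin> \<Union>\<D>" by blast
    have adj: "E y v" if "v \<in> C" "q v = q x" for v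
      using module_cong[of x v y y] y that xC sym[of v y] by simp
    \<comment> \<open>The new vertex \<open>y\<close> is adjacent to the whole module, so
      \<open>D1\<close> contains a star centred at \<open>y\<close> and is connected.\<close>
    define D1 where "D1 = insert y (D0 - {x})"
    define \<D>' where "\<D>' = insert D1 (\<D> - {D0})"
    have cardD1: "card D1 = r"
      using y x D0 D0' finD card_Suc_Diff1[OF finD x] unfolding D1_def by (subst card_insert_disjoint) auto
    \<comment> \<open>As \<open>r\<close> is at least 2, some \<open>z\<close> of the module stays
      in the unit. Outside the module it dominates whatever the vertices of \<open>D0\<close> did,
      while \<open>y\<close> dominates the module.\<close>
    have "card (D0 - {x}) > 0" using D0'(2) r x finD by simp
    then obtain z where z: "z \<in> D0" "z \<noteq> x" by (metis Diff_iff card_gt_0_iff ex_in_conv insertI1)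
    have "conn E D1"
      unfolding conn_def
    proof (intro conjI allI impI)
      show "D1 \<noteq> {}" unfolding D1_def by blast
      fix A
      assume A: "A \<subseteq> D1" "A \<noteq> {}" "A \<noteq> D1"
      show "\<exists>a\<in>A. \<exists>b\<in>D1 - A. E a b"
      proof (cases "y \<in> A")
        case True
        from A obtain b where b: "b \<in> D1" "b \<notin> A" by blast
        then have "b \<in> D0" using True by (auto simp: D1_def)
        then have "E y b" using adj qD0 D0'(1) by blast
        then show ?thesis using True b by blast
      next
        case False
        from A obtain a where a: "a \<in> A" by blast
        then have "a \<in> D0" using A False by (auto simp: D1_def)
        then have "E y a" using adj qD0 D0'(1) by blast
        then have "E a y" using sym[of a y] \<open>a \<in> D0\<close> D0'(1) y by blast
        moreover have "y \<in> D1 - A" using False by (simp add: D1_def)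
        ultimately show ?thesis using a by blast
      qed
    qed
    moreover have "disjoint \<D>'"
      unfolding \<D>'_def disjoint_def
    proof (intro ballI impI)
      have *: "D \<inter> D1 = {}" if "D \<in> \<D> - {D0}" for D
        using disj[of D] that y by (auto simp: D1_def)
      fix A B
      assume "A \<in> insert D1 (\<D> - {D0})" "B \<in> insert D1 (\<D> - {D0})" "A \<noteq> B"
      then consider "A = D1" "B \<in> \<D> - {D0}" | "B = D1" "A \<in> \<D> - {D0}" | "A \<in> \<D>" "B \<in> \<D>" "A \<noteq> B"
        by blast
      then show "A \<inter> B = {}"
      proof cases
        case 3
        then show ?thesis using U by (simp add: disjoint_def)
      qed (use * in blast)+
    qed
    moreover have "v \<in> \<Union>\<D>' \<or> (\<exists>d\<in>\<Union>\<D>'. E d v)" if v: "v \<in> C" for v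
    proof (cases "q v = q x")
      case True
      then have "E y v" using adj v by blast
      then show ?thesis unfolding \<D>'_def D1_def by blast
    next
      case False
      have mem: "d \<in> \<Union>\<D>'" if "d \<in> \<Union>\<D>" "d \<notin> D0" for d using that by (auto simp: \<D>'_def)
      from dom[OF v] show ?thesis
      proof
        assume "v \<in> \<Union>\<D>"
        then show ?thesis using mem[of v] qD0 False by blast
      next
        assume "\<exists>d\<in>\<Union>\<D>. E d v"
        then obtain d where d: "d \<in> \<Union>\<D>" "E d v" by blast
        show ?thesis
        proof (cases "d \<in> D0")
          case True
          then have "E z v"
            using module_cong[of d z v v] d v False qD0[OF True] qD0[OF z(1)] z D0'(1) by (metis subsetD)
          moreover have "z \<in> \<Union>\<D>'" using z by (simp add: \<D>'_def D1_def)
          ultimately show ?thesis by blast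
        qed (use d mem in blast)
      qed
    qed
    moreover have "D1 \<subseteq> C" using D0'(1) y by (auto simp: D1_def)
    ultimately have u': "units E r C \<D>'"
      using U cardD1 unfolding units_def dominates_def \<D>'_def by auto
    have notin: "D1 \<notin> \<D>" using y by (auto simp: D1_def)
    then have "card \<D>' = card \<D>"
      using U card_Suc_Diff1[OF _ D0] unfolding \<D>'_def by simp
    then have le: "card {D\<in>\<D>. card (q ` D) < 2} \<le> card {D\<in>\<D>'. card (q ` D) < 2}"
      using min2[OF u'] by blast
    have "card {q y, q z} \<le> card (q ` D1)"
      using z finD by (intro card_mono) (auto simp: D1_def)
    then have "2 \<le> card (q ` D1)" using y(2) qD0[OF z(1)] by simp
    then have "{D\<in>\<D>'. card (q ` D) < 2} \<subseteq> {D\<in>\<D>. card (q ` D) < 2} - {D0}"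
      by (auto simp: \<D>'_def)
    moreover have "D0 \<in> {D\<in>\<D>. card (q ` D) < 2}" using D0 ns by simp
    ultimately have "{D\<in>\<D>'. card (q ` D) < 2} \<subset> {D\<in>\<D>. card (q ` D) < 2}" by blast
    then have "card {D\<in>\<D>'. card (q ` D) < 2} < card {D\<in>\<D>. card (q ` D) < 2}"
      using U by (intro psubset_card_mono) auto
    with le show False by simp
  next
    case False
    then have all: "y \<in> \<Union>\<D>" if "y \<in> C" "q y \<noteq> q x" "E x y" for y using that by blast
    have "C \<noteq> {x}" using D0' r card_mono[of "{x}" D0] by auto
    then obtain w where w: "w \<in> C" "q w \<noteq> q x" "E x w" using nbr[OF xC] by blast
    \<comment> \<open>Outside its module, \<open>D0\<close> only dominates vertices that belong to
      other units; the module itself is dominated by \<open>w\<close>, which lies in another unit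
      too.\<close>
    define \<D>' where "\<D>' = \<D> - {D0}"
    have mem: "d \<in> \<Union>\<D>'" if "d \<in> \<Union>\<D>" "q d \<noteq> q x" for d
      using that qD0 by (auto simp: \<D>'_def)
    have "v \<in> \<Union>\<D>' \<or> (\<exists>d\<in>\<Union>\<D>'. E d v)" if v: "v \<in> C" for v
    proof (cases "q v = q x")
      case True
      then have "E w v" using module_cong[of x v w w] w v xC sym[of v w] by simp
      then show ?thesis using mem[of w] all w by blast
    next
      case False
      from dom[OF v] show ?thesis
      proof
        assume "\<exists>d\<in>\<Union>\<D>. E d v"
        then obtain d where d: "d \<in> \<Union>\<D>" "E d v" by blast
        show ?thesis
        proof (cases "d \<in> D0")
          case True
          then have "E x v" using module_cong[of d x v v] d v False qD0 D0'(1) xC by (metis subsetD)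
          then show ?thesis using mem[of v] all[of v] v False by blast
        qed (use d in \<open>auto simp: \<D>'_def\<close>)
      qed (use mem False in blast)
    qed
    then have "units E r C \<D>'"
      using U unfolding units_def dominates_def \<D>'_def by (auto simp: disjoint_def)
    then have "card \<D> \<le> card \<D>'" by (rule min1)
    then show False using D0 U card_Diff1_less[of \<D> D0] by (auto simp: \<D>'_def)
  qed
qed

text \<open>The family is the image of a lexicographically minimal solution. Since a family is a
  set, units with equal projection would be counted once only; minimality rules them out, because
  domination by spanning units depends only on the modules that are hit.\<close>

lemma valid_of_units:
  assumes r: "2 \<le> r" and u: "units E r C \<D>\<^sub>0"
  shows "\<exists>F. finite F \<and> card F \<le> card \<D>\<^sub>0 \<and> valid r F"
proof -
  obtain \<D>\<^sub>1 where 1: "units E r C \<D>\<^sub>1" "\<And>\<D>'. units E r C \<D>' \<Longrightarrow> card \<D>\<^sub>1 \<le> card \<D>'"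
    using ex_has_least_nat[of "units E r C" \<D>\<^sub>0 card] u by blast
  obtain \<D> where 2: "units E r C \<D>" "card \<D> = card \<D>\<^sub>1"
      "\<And>\<D>'. units E r C \<D>' \<Longrightarrow> card \<D>' = card \<D>\<^sub>1 \<Longrightarrow>
        card {D\<in>\<D>. card (q ` D) < 2} \<le> card {D\<in>\<D>'. card (q ` D) < 2}"
    using ex_has_least_nat[of "\<lambda>\<D>. units E r C \<D> \<and> card \<D> = card \<D>\<^sub>1" \<D>\<^sub>1
        "\<lambda>\<D>. card {D\<in>\<D>. card (q ` D) < 2}"] 1 by blast
  have min: "card \<D> \<le> card \<D>'" if "units E r C \<D>'" for \<D>' using 1(2) 2(2) that by simp
  have span: "2 \<le> card (q ` D)" if "D \<in> \<D>" for D
    using r 2(1) min _ that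
  proof (rule minimal_units_spanning)
    show "card {D\<in>\<D>. card (q ` D) < 2} \<le> card {D\<in>\<D>'. card (q ` D) < 2}"
      if "units E r C \<D>'" "card \<D>' = card \<D>" for \<D>' using 2 that by simp
  qed
  note U = 2(1)[unfolded units_def dominates_def]
  have finD: "finite D" if "D \<in> \<D>" for D
    using U that finite_subset[OF _ fin] by blast
  have dom: "v \<in> \<Union>\<D> \<or> (\<exists>d\<in>\<Union>\<D>. E d v)" if "v \<in> C" for v using U that by blast
  have inj: "inj_on ((`) q) \<D>"
  proof (rule inj_onI, rule ccontr)
    fix D D'
    assume D: "D \<in> \<D>" "D' \<in> \<D>" "q ` D = q ` D'" "D \<noteq> D'"
    let ?\<D> = "\<D> - {D'}"
    \<comment> \<open>Removing \<open>D'\<close> leaves the set of modules hit unchanged.\<close>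
    have eq: "q ` \<Union>?\<D> = q ` \<Union>\<D>"
    proof
      show "q ` \<Union>\<D> \<subseteq> q ` \<Union>?\<D>"
      proof
        fix u
        assume "u \<in> q ` \<Union>\<D>"
        then obtain A where "A \<in> \<D>" "u \<in> q ` A" by blast
        then show "u \<in> q ` \<Union>?\<D>" using D by (cases "A = D'") blast+
      qed
    qed blast
    have "dominates E (\<Union>?\<D>) C"
    proof (rule spanning_dominates)
      show "A \<subseteq> C \<and> conn E A \<and> 2 \<le> card (q ` A)" if "A \<in> ?\<D>" for A
        using that U span by blast
      fix v
      assume v: "v \<in> C"
      from dom[OF v] show "q v \<in> q ` \<Union>?\<D> \<or> (\<exists>w\<in>\<Union>?\<D>. q w \<noteq> q v \<and> E w v)"
      proof
        assume "v \<in> \<Union>\<D>"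
        then show ?thesis unfolding eq by blast
      next
        assume "\<exists>d\<in>\<Union>\<D>. E d v"
        then obtain d where d: "d \<in> \<Union>\<D>" "E d v" by blast
        then have "q d \<in> q ` \<Union>?\<D>" unfolding eq by blast
        then obtain d' where d': "d' \<in> \<Union>?\<D>" "q d' = q d" by (metis imageE)
        show ?thesis
        proof (cases "q d = q v")
          case True
          then show ?thesis using d' by (metis imageI)
        next
          case False
          have "d \<in> C" "d' \<in> C" using d d' U by blast+
          then have "E d' v" using module_cong[of d d' v v] d d' v False by simp
          then show ?thesis using d' False by metis
        qed
      qed
    qed
    moreover have "disjoint ?\<D>" using U by (auto simp: disjoint_def)
    ultimately have "units E r C ?\<D>" using U unfolding units_def by blast
    then have "card \<D> \<le> card ?\<D>" by (rule min)
    then show False using D U card_Diff1_less[of \<D> D'] by auto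
  qed
  let ?F = "(`) q ` \<D>"
  have "valid r ?F"
    unfolding valid_def
  proof (intro conjI ballI allI impI)
    fix S
    assume "S \<in> ?F"
    then obtain D where D: "D \<in> \<D>" "S = q ` D" by blast
    have DC: "D \<subseteq> C" "card D = r" "conn E D" using D U by blast+
    show "S \<subseteq> q ` C" using D DC by blast
    show "conn E S" using conn_project D DC by blast
    show "card S \<le> r" using D DC card_image_le finD by blast
    show "min 2 r \<le> card S" using span[OF D(1)] D(2) by (simp add: min.coboundedI1)
  next
    have UF: "\<Union>?F = q ` \<Union>\<D>" by blast
    show "dominates E (\<Union>?F) C"
      unfolding dominates_def UF
    proof (intro conjI ballI)
      show "q ` \<Union>\<D> \<subseteq> C" using U q_in by blast
      fix v
      assume v: "v \<in> C"
      let ?goal = "v \<in> q ` \<Union>\<D> \<or> (\<exists>u\<in>q ` \<Union>\<D>. E u v)"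
      have hit: ?goal if hv: "q v \<in> q ` \<Union>\<D>"
      proof -
        obtain D where D: "D \<in> \<D>" "q v \<in> q ` D" using hv by blast
        then obtain w where w: "w \<in> D" "q w \<noteq> q v" "E w v"
          using spanning_nbr[of D v] U span v by blast
        have "w \<in> C" using w D U by blast
        then have "E (q w) v" using module_cong[of w "q w" v v] w v q_in q_q by simp
        then show ?thesis using w D by blast
      qed
      from dom[OF v] show ?goal
      proof
        assume "\<exists>d\<in>\<Union>\<D>. E d v"
        then obtain d where d: "d \<in> \<Union>\<D>" "E d v" by blast
        have "d \<in> C" using d U by blast
        show ?goal
        proof (cases "q d = q v")
          case True
          then show ?goal using hit d by (metis imageI)
        next
          case False
          then have "E (q d) v" using module_cong[of d "q d" v v] \<open>d \<in> C\<close> d v q_in q_q by simp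
          then show ?goal using d by blast
        qed
      qed (use hit in blast)
    qed
  next
    fix U'
    assume U': "U' \<subseteq> q ` C"
    \<comment> \<open>Necessity of the Hall condition: a unit has at least its demand of vertices in
      the modules of \<open>U'\<close>, and distinct units use distinct vertices.\<close>
    have "(\<Sum>S\<in>?F. demand (\<lambda>S. r) S U') = (\<Sum>D\<in>\<D>. demand (\<lambda>S. r) (q ` D) U')"
      by (rule sum.reindex[OF inj, unfolded comp_def])
    also have "\<dots> \<le> (\<Sum>D\<in>\<D>. card {v\<in>D. q v \<in> U'})"
    proof (rule sum_mono)
      fix D
      assume D: "D \<in> \<D>"
      show "demand (\<lambda>S. r) (q ` D) U' \<le> card {v\<in>D. q v \<in> U'}"
      proof (cases "q ` D \<subseteq> U'")
        case True
        then have "{v\<in>D. q v \<in> U'} = D" by blast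
        then show ?thesis using True D U by (simp add: demand_def)
      next
        case False
        have "q ` D \<inter> U' = q ` {v\<in>D. q v \<in> U'}" by blast
        then show ?thesis using False finD[OF D] by (simp add: demand_def card_image_le)
      qed
    qed
    also have "\<dots> = card (\<Union>D\<in>\<D>. {v\<in>D. q v \<in> U'})"
      using U finD by (intro card_UN_disjoint[symmetric]) (auto simp: disjoint_def)
    also have "\<dots> \<le> card {v\<in>C. q v \<in> U'}"
      using U fin by (intro card_mono) auto
    finally show "(\<Sum>S\<in>?F. demand (\<lambda>S. r) S U') \<le> card {v\<in>C. q v \<in> U'}" .
  qed
  moreover have "card ?F \<le> card \<D>\<^sub>0" using card_image[OF inj] min[OF u] by simp
  ultimately show ?thesis using U by blast
qed

text \<open>\<open>transport\<close> fixes how many vertices a unit takes from each module,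
  \<open>disjoint_choice\<close> realises these numbers separately inside each module, and
  \<open>conn_lift\<close> makes the resulting sets connected. As all numbers are positive, the unit
  for \<open>S\<close> projects exactly onto \<open>S\<close>.\<close>

lemma units_of_valid:
  assumes r: "2 \<le> r" and F: "finite F" "valid r F"
  shows "\<exists>\<D>. units E r C \<D> \<and> card \<D> = card F"
proof -
  have S: "S \<subseteq> q ` C" "conn E S" "card S \<le> r" "2 \<le> card S" if "S \<in> F" for S
    using F(2) that r by (auto simp: valid_def)
  define c where "c u = card {v\<in>C. q v = u}" for u
  have c: "(\<Sum>u\<in>U. c u) = card {v\<in>C. q v \<in> U}" if "U \<subseteq> q ` C" for U
  proof -
    have "(\<Sum>u\<in>U. c u) = card (\<Union>u\<in>U. {v\<in>C. q v = u})"
      unfolding c_def using that fin finite_subset[of U "q ` C"]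
      by (intro card_UN_disjoint[symmetric]) auto
    also have "(\<Union>u\<in>U. {v\<in>C. q v = u}) = {v\<in>C. q v \<in> U}" by blast
    finally show ?thesis .
  qed
  have "\<exists>x. (\<forall>S\<in>F. (\<forall>u\<in>S. 0 < x S u) \<and> (\<Sum>u\<in>S. x S u) = r) \<and>
      (\<forall>u\<in>q ` C. (\<Sum>S\<in>{S \<in> F. u \<in> S}. x S u) \<le> c u)"
  proof (rule transport)
    show "(\<Sum>S\<in>F. demand (\<lambda>S. r) S U) \<le> (\<Sum>u\<in>U. c u)" if "U \<subseteq> q ` C" for U
      unfolding c[OF that] using F(2) that by (simp add: valid_def)
  qed (simp_all add: S F(1) fin)
  then obtain x where *: "\<forall>S\<in>F. (\<forall>u\<in>S. 0 < x S u) \<and> (\<Sum>u\<in>S. x S u) = r"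
      "\<forall>u\<in>q ` C. (\<Sum>S\<in>{S \<in> F. u \<in> S}. x S u) \<le> c u" by blast
  have x: "\<And>S u. S \<in> F \<Longrightarrow> u \<in> S \<Longrightarrow> 0 < x S u" "\<And>S. S \<in> F \<Longrightarrow> (\<Sum>u\<in>S. x S u) = r"
      "\<And>u. u \<in> q ` C \<Longrightarrow> (\<Sum>S\<in>{S \<in> F. u \<in> S}. x S u) \<le> c u"
    using * by blast+
  have "\<forall>u\<in>q ` C. \<exists>A. (\<forall>S\<in>{S \<in> F. u \<in> S}. A S \<subseteq> {v\<in>C. q v = u} \<and> card (A S) = x S u) \<and>
      (\<forall>S\<in>{S \<in> F. u \<in> S}. \<forall>T\<in>{S \<in> F. u \<in> S}. S \<noteq> T \<longrightarrow> A S \<inter> A T = {})"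
    using F(1) fin x(3) unfolding c_def by (intro ballI disjoint_choice) auto
  then obtain A where *: "\<forall>u\<in>q ` C.
      (\<forall>S\<in>{S \<in> F. u \<in> S}. A u S \<subseteq> {v\<in>C. q v = u} \<and> card (A u S) = x S u) \<and>
      (\<forall>S\<in>{S \<in> F. u \<in> S}. \<forall>T\<in>{S \<in> F. u \<in> S}. S \<noteq> T \<longrightarrow> A u S \<inter> A u T = {})"
    unfolding bchoice_iff by blast
  have A: "\<And>u S. u \<in> q ` C \<Longrightarrow> S \<in> F \<Longrightarrow> u \<in> S \<Longrightarrow>
        A u S \<subseteq> {v\<in>C. q v = u} \<and> card (A u S) = x S u"
      "\<And>u S T. u \<in> q ` C \<Longrightarrow> S \<in> F \<Longrightarrow> T \<in> F \<Longrightarrow> u \<in> S \<Longrightarrow> u \<in> T \<Longrightarrow> S \<noteq> T \<Longrightarrow> A u S \<inter> A u T = {}"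
    using bspec[OF *] by simp_all
  define D where "D S = (\<Union>u\<in>S. A u S)" for S
  have memD: "v \<in> C \<and> q v \<in> S \<and> v \<in> A (q v) S" if "v \<in> D S" "S \<in> F" for v S
  proof -
    from that obtain u where u: "u \<in> S" "v \<in> A u S" by (auto simp: D_def)
    then show ?thesis using A(1)[of u S] S(1)[OF that(2)] that(2) by auto
  qed
  have qD: "q ` D S = S" if "S \<in> F" for S
  proof
    show "q ` D S \<subseteq> S" using memD that by blast
    show "S \<subseteq> q ` D S"
    proof
      fix u
      assume u: "u \<in> S"
      then have "A u S \<subseteq> {v\<in>C. q v = u}" "0 < card (A u S)"
        using A(1)[of u S] S(1)[OF that] x(1)[OF that u] that by auto
      then obtain v where "v \<in> A u S" "q v = u" by (auto simp: card_gt_0_iff)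
      then show "u \<in> q ` D S" using u by (auto simp: D_def)
    qed
  qed
  have DC: "D S \<subseteq> C" if "S \<in> F" for S using memD that by blast
  have cardD: "card (D S) = r" if SF: "S \<in> F" for S
  proof -
    have AS: "A u S \<subseteq> {v\<in>C. q v = u}" "card (A u S) = x S u" if "u \<in> S" for u
      using A(1)[of u S] S(1)[OF SF] that SF by auto
    have "finite S" using S(4)[OF SF] by (metis card.infinite not_numeral_le_zero)
    moreover have "\<forall>u\<in>S. finite (A u S)" using AS fin by (auto intro: finite_subset)
    moreover have "\<forall>u\<in>S. \<forall>u'\<in>S. u \<noteq> u' \<longrightarrow> A u S \<inter> A u' S = {}" using AS by blast
    ultimately have "card (D S) = (\<Sum>u\<in>S. card (A u S))"
      unfolding D_def by (rule card_UN_disjoint)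
    then show ?thesis using AS(2) x(2)[OF SF] by simp
  qed
  have disj: "D S \<inter> D T = {}" if "S \<in> F" "T \<in> F" "S \<noteq> T" for S T
  proof -
    have False if "v \<in> D S" "v \<in> D T" for v
    proof -
      have "v \<in> A (q v) S \<inter> A (q v) T" "q v \<in> S" "q v \<in> T" "q v \<in> q ` C"
        using memD[of v S] memD[of v T] that \<open>S \<in> F\<close> \<open>T \<in> F\<close> by blast+
      then show False using A(2)[of "q v" S T] \<open>S \<in> F\<close> \<open>T \<in> F\<close> \<open>S \<noteq> T\<close> by blast
    qed
    then show ?thesis by blast
  qed
  have connD: "conn E (D S)" if "S \<in> F" for S
    using conn_lift[of "D S"] qD[OF that] DC[OF that] S[OF that] by simp
  have "dominates E (\<Union>(D ` F)) C"
  proof (rule spanning_dominates)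
    show "A \<subseteq> C \<and> conn E A \<and> 2 \<le> card (q ` A)" if "A \<in> D ` F" for A
      using that DC connD qD S(4) by auto
    have img: "q ` \<Union>(D ` F) = \<Union>F" using qD by (simp add: image_UN)
    fix v
    assume v: "v \<in> C"
    \<comment> \<open>A representative other than that of \<open>v\<close> lies in a different
      module, so any vertex of its module does the same service to \<open>v\<close>.\<close>
    have *: "\<exists>w\<in>\<Union>(D ` F). q w \<noteq> q v \<and> E w v" if u: "u \<in> \<Union>F" "u \<noteq> q v" "E u v" for u
    proof -
      obtain w where w: "w \<in> \<Union>(D ` F)" "q w = u" using u(1) img by (metis imageE)
      have C: "w \<in> C" "u \<in> C" "q u = u" using w DC u(1) S(1) q_in q_rep by blast+
      then have "E w v" using module_cong[of w u v v] v w u by simp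
      then show ?thesis using w u by blast
    qed
    have "v \<in> \<Union>F \<or> (\<exists>u\<in>\<Union>F. E u v)" using F(2) v unfolding valid_def dominates_def by blast
    then show "q v \<in> q ` \<Union>(D ` F) \<or> (\<exists>w\<in>\<Union>(D ` F). q w \<noteq> q v \<and> E w v)"
    proof
      assume "v \<in> \<Union>F"
      then have "q v = v" using S(1) q_rep by blast
      then show ?thesis using \<open>v \<in> \<Union>F\<close> img by metis
    next
      assume "\<exists>u\<in>\<Union>F. E u v"
      then obtain u where u: "u \<in> \<Union>F" "E u v" by blast
      then show ?thesis using * img by (cases "u = q v") auto
    qed
  qed
  moreover have "disjoint (D ` F)"
    unfolding disjoint_def using disj by (metis imageE)
  ultimately have "units E r C (D ` F)"
    using F(1) DC cardD connD unfolding units_def by blast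
  moreover have "inj_on D F"
  proof (rule inj_onI, rule ccontr)
    fix S T
    assume "S \<in> F" "T \<in> F" "D S = D T" "S \<noteq> T"
    then have "D S = {}" using disj by blast
    then show False using connD[OF \<open>S \<in> F\<close>] by (simp add: conn_def)
  qed
  ultimately show ?thesis using card_image by blast
qed

section \<open>Units that consist of a single vertex\<close>

lemma conn_singleton: "conn E {x}"
  by (auto simp: conn_def)

text \<open>For \<open>r = 1\<close> the members of \<open>F\<close> are singletons of
  representatives, which are vertices, so \<open>F\<close> is its own realisation.\<close>

lemma units_of_valid_1:
  assumes F: "finite F" "valid 1 F"
  shows "units E 1 C F"
proof -
  have S: "S \<subseteq> q ` C" "conn E S" "card S = 1" if "S \<in> F" for S
    using F(2) that by (auto simp: valid_def)
  have "disjoint F"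
    unfolding disjoint_def
  proof (intro ballI impI)
    fix A B
    assume "A \<in> F" "B \<in> F" "A \<noteq> B"
    then show "A \<inter> B = {}" using S(3)[of A] S(3)[of B] by (auto simp: card_1_singleton_iff)
  qed
  moreover have "S \<subseteq> C" if "S \<in> F" for S using S(1)[OF that] q_image_in by (rule subset_trans)
  moreover have "dominates E (\<Union>F) C" using F(2) by (simp add: valid_def)
  ultimately show ?thesis using F(1) S unfolding units_def by simp
qed

text \<open>Suppose that \<open>x\<close> and \<open>y\<close> in \<open>X\<close> share a module.
  Outside the module \<open>y\<close> dominates nothing that \<open>x\<close> does not, so
  \<open>y\<close> may be traded for a neighbour of the module. If \<open>X\<close> already contains
  such a neighbour then it was not of minimum size; otherwise the trade hits a new module and
  contradicts the second condition.\<close>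

lemma minimal_dominating_inj:
  assumes X: "dominates E X C"
    and min1: "\<And>X'. dominates E X' C \<Longrightarrow> card X \<le> card X'"
    and min2: "\<And>X'. dominates E X' C \<Longrightarrow> card X' = card X \<Longrightarrow> card (q ` X') \<le> card (q ` X)"
  shows "inj_on q X"
proof (rule inj_onI, rule ccontr)
  have XC: "X \<subseteq> C" and dom: "\<And>v. v \<in> C \<Longrightarrow> v \<in> X \<or> (\<exists>d\<in>X. E d v)"
    using X unfolding dominates_def by blast+
  have finX: "finite X" using XC fin finite_subset by blast
  fix x y
  assume xy: "x \<in> X" "y \<in> X" "q x = q y" "x \<noteq> y"
  then have C: "x \<in> C" "y \<in> C" "C \<noteq> {x}" using XC by blast+
  have dom': "dominates E (insert w (X - {y})) C" if w: "w \<in> C" "q w \<noteq> q x" "E x w" for w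
    unfolding dominates_def
  proof (intro conjI ballI)
    show "insert w (X - {y}) \<subseteq> C" using XC w by blast
    fix v
    assume v: "v \<in> C"
    have adj: "E w v" if "q v = q x"
      using module_cong[of x v w w] C w v that sym[of v w] by simp
    from dom[OF v] show "v \<in> insert w (X - {y}) \<or> (\<exists>u\<in>insert w (X - {y}). E u v)"
    proof
      assume "v \<in> X"
      then show ?thesis using adj xy by (cases "v = y") auto
    next
      assume "\<exists>d\<in>X. E d v"
      then obtain d where d: "d \<in> X" "E d v" by blast
      show ?thesis
      proof (cases "d = y \<and> q v \<noteq> q x")
        case True
        then have "E x v" using module_cong[of y x v v] C v xy d by metis
        then show ?thesis using xy by blast
      next
        case False
        then show ?thesis using d adj by blast
      qed
    qed
  qed
  show False
  proof (cases "\<exists>w\<in>X. q w \<noteq> q x \<and> E x w")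
    case True
    then obtain w where w: "w \<in> X" "q w \<noteq> q x" "E x w" by blast
    then have "insert w (X - {y}) = X - {y}" using xy by auto
    then have "dominates E (X - {y}) C" using dom'[of w] w XC by auto
    then have "card X \<le> card (X - {y})" by (rule min1)
    then show False using card_Diff1_less[OF finX xy(2)] by simp
  next
    case False
    obtain w where w: "w \<in> C" "q w \<noteq> q x" "E x w" using nbr[OF C(1,3)] by blast
    have wX: "q w \<notin> q ` X"
    proof
      assume "q w \<in> q ` X"
      then obtain w' where w': "w' \<in> X" "q w' = q w" by (metis imageE)
      then have "E x w'" using module_cong[of x x w w'] C w XC by auto
      then show False using False w w' by metis
    qed
    let ?X = "insert w (X - {y})"
    have "card ?X = card X"
      using wX finX card_Suc_Diff1[OF finX xy(2)] by (subst card_insert_disjoint) auto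
    then have "card (q ` ?X) \<le> card (q ` X)" using min2 dom'[OF w] by blast
    moreover have "q y \<in> q ` (X - {y})" using xy by (metis Diff_iff imageI singletonD)
    then have "q ` (X - {y}) = q ` X" using xy(2) by (metis image_insert insert_Diff insert_absorb)
    then have "q ` ?X = insert (q w) (q ` X)" by simp
    ultimately show False using wX finX by simp
  qed
qed

text \<open>Replacing a chosen vertex by the representative of its module keeps everything outside
  the module dominated. Only the module itself is critical, and there the locale assumption
  \<open>universal\<close> applies.\<close>

lemma valid_of_units_1:
  assumes u: "units E 1 C \<D>"
  shows "\<exists>F. finite F \<and> card F \<le> card \<D> \<and> valid 1 F"
proof -
  note U = u[unfolded units_def]
  obtain X\<^sub>1 where 1: "dominates E X\<^sub>1 C" "\<And>X'. dominates E X' C \<Longrightarrow> card X\<^sub>1 \<le> card X'"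
    using ex_has_least_nat[of "\<lambda>X. dominates E X C" "\<Union>\<D>" card] U by blast
  \<comment> \<open>Maximising the number of modules hit is expressed as minimising its distance to
    the number of all modules.\<close>
  obtain X where 2: "dominates E X C" "card X = card X\<^sub>1"
      "\<And>X'. dominates E X' C \<Longrightarrow> card X' = card X\<^sub>1 \<Longrightarrow>
        card (q ` C) - card (q ` X) \<le> card (q ` C) - card (q ` X')"
    using ex_has_least_nat[of "\<lambda>X. dominates E X C \<and> card X = card X\<^sub>1" X\<^sub>1
        "\<lambda>X. card (q ` C) - card (q ` X)"] 1 by blast
  have "inj_on q X"
  proof (rule minimal_dominating_inj[OF 2(1)])
    fix X'
    assume X': "dominates E X' C"
    show "card X \<le> card X'" using 1(2) 2(2) X' by simp
    assume "card X' = card X"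
    then have "card (q ` C) - card (q ` X) \<le> card (q ` C) - card (q ` X')" using 2 X' by simp
    moreover have "card (q ` X') \<le> card (q ` C)"
      using X' fin by (intro card_mono) (auto simp: dominates_def)
    ultimately show "card (q ` X') \<le> card (q ` X)" by linarith
  qed
  have XC: "X \<subseteq> C" and dom: "\<And>v. v \<in> C \<Longrightarrow> v \<in> X \<or> (\<exists>d\<in>X. E d v)"
    using 2(1) unfolding dominates_def by blast+
  have finX: "finite X" using XC fin finite_subset by blast
  let ?F = "(\<lambda>x. {q x}) ` X"
  have inj: "inj_on (\<lambda>x. {q x}) X" using \<open>inj_on q X\<close> by (auto simp: inj_on_def)
  have "valid 1 ?F"
    unfolding valid_def
  proof (intro conjI ballI allI impI)
    have UF: "\<Union>?F = q ` X" by blast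
    show "dominates E (\<Union>?F) C"
      unfolding dominates_def UF
    proof (intro conjI ballI)
      show "q ` X \<subseteq> C" using XC q_in by blast
      fix v
      assume v: "v \<in> C"
      let ?goal = "v \<in> q ` X \<or> (\<exists>u\<in>q ` X. E u v)"
      have far: ?goal if d: "d \<in> X" "q d \<noteq> q v" "E d v" for d
      proof -
        have "E (q d) v" using module_cong[of d "q d" v v] d v XC q_in q_q by auto
        then show ?thesis using d by blast
      qed
      obtain d where d: "d \<in> X" "d = v \<or> E d v" using dom[OF v] by blast
      show ?goal
      proof (cases "q d = q v \<and> \<not> (\<exists>w\<in>X. q w \<noteq> q v \<and> E w v)")
        case True
        have dC: "d \<in> C" using d XC by blast
        \<comment> \<open>A chosen vertex of another module that dominates \<open>y\<close> would
          also dominate \<open>v\<close>. So \<open>d\<close>, the only chosen vertex of its module,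
          dominates the module alone.\<close>
        have "y = d \<or> E d y" if y: "y \<in> C" "q y = q d" for y
        proof -
          obtain d' where d': "d' \<in> X" "d' = y \<or> E d' y" using dom[OF y(1)] by blast
          have "d' = d"
          proof (rule ccontr)
            assume "d' \<noteq> d"
            then have "q d' \<noteq> q d" using \<open>inj_on q X\<close> d d' by (auto simp: inj_on_def)
            then have "E d' v" using d' y True v XC module_cong[of d' d' y v] by auto
            then show False using True d' \<open>q d' \<noteq> q d\<close> by auto
          qed
          then show ?thesis using d' by blast
        qed
        then have "\<forall>y\<in>C. q y = q d \<longrightarrow> y = q d \<or> E (q d) y" using universal[OF dC] by blast
        then have "v = q d \<or> E (q d) v" using v True by metis
        then show ?thesis using d by blast
      next
        case False
        then show ?thesis using d far by blast
      qed
    qed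
  next
    fix U
    assume U: "U \<subseteq> q ` C"
    have "(\<Sum>S\<in>?F. demand (\<lambda>S. 1) S U) = (\<Sum>x\<in>X. demand (\<lambda>S. 1) {q x} U)"
      by (rule sum.reindex[OF inj, unfolded comp_def])
    also have "\<dots> = (\<Sum>x\<in>X. if q x \<in> U then 1 else 0)"
      by (intro sum.cong) (auto simp: demand_def)
    also have "\<dots> = card {x\<in>X. q x \<in> U}"
      using finX by (simp add: sum.If_cases Int_def)
    also have "\<dots> \<le> card {v\<in>C. q v \<in> U}"
      using XC fin by (intro card_mono) auto
    finally show "(\<Sum>S\<in>?F. demand (\<lambda>S. 1) S U) \<le> card {v\<in>C. q v \<in> U}" .
  qed (use XC in \<open>auto simp: conn_singleton\<close>)
  moreover have "card (\<Union>\<D>) \<le> card \<D>"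
  proof -
    have "card (\<Union>\<D>) \<le> (\<Sum>D\<in>\<D>. card D)" by (rule card_Union_le_sum_card)
    also have "\<dots> = card \<D>" using U by simp
    finally show ?thesis .
  qed
  then have "card ?F \<le> card \<D>"
    using card_image[OF inj] 1(2)[of "\<Union>\<D>"] 2(2) U by simp
  ultimately show ?thesis using finX by blast
qed

theorem units_iff_valid:
  assumes "0 < r"
  shows "(\<exists>\<D>. units E r C \<D> \<and> card \<D> \<le> k) \<longleftrightarrow> (\<exists>F. finite F \<and> card F \<le> k \<and> valid r F)"
proof
  assume "\<exists>\<D>. units E r C \<D> \<and> card \<D> \<le> k"
  then obtain \<D> where \<D>: "units E r C \<D>" "card \<D> \<le> k" by blast
  have "\<exists>F. finite F \<and> card F \<le> card \<D> \<and> valid r F"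
  proof (cases "r = 1")
    case True
    then show ?thesis using valid_of_units_1 \<D>(1) by simp
  next
    case False
    then show ?thesis using valid_of_units[OF _ \<D>(1)] assms by simp
  qed
  then show "\<exists>F. finite F \<and> card F \<le> k \<and> valid r F" using \<D>(2) le_trans by blast
next
  assume "\<exists>F. finite F \<and> card F \<le> k \<and> valid r F"
  then obtain F where F: "finite F" "card F \<le> k" "valid r F" by blast
  show "\<exists>\<D>. units E r C \<D> \<and> card \<D> \<le> k"
  proof (cases "r = 1")
    case True
    then show ?thesis using units_of_valid_1[OF F(1)] F by blast
  next
    case False
    then show ?thesis using units_of_valid[OF _ F(1,3)] F(2) assms by auto
  qed
qed

end

section \<open>The coarsest modular partition\<close>

definition modl :: "('a \<Rightarrow> 'a \<Rightarrow> bool) \<Rightarrow> 'a set \<Rightarrow> 'a set \<Rightarrow> bool" where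
  "modl E C M \<longleftrightarrow> M \<subseteq> C \<and> (\<forall>x\<in>C - M. (\<forall>a\<in>M. E x a) \<or> (\<forall>a\<in>M. \<not> E x a))"

lemma modlD: "modl E C M \<Longrightarrow> x \<in> C \<Longrightarrow> x \<notin> M \<Longrightarrow> a \<in> M \<Longrightarrow> b \<in> M \<Longrightarrow> E x a = E x b"
  unfolding modl_def by blast

lemma modl_subset: "modl E C M \<Longrightarrow> M \<subseteq> C"
  unfolding modl_def by blast

lemma modl_Un:
  assumes "modl E C A" "modl E C B" "v \<in> A" "v \<in> B"
  shows "modl E C (A \<union> B)"
proof -
  have "E x a = E x v" if "x \<in> C - (A \<union> B)" "a \<in> A \<union> B" for x a
    using modlD[OF assms(1), of x a v] modlD[OF assms(2), of x a v] that assms(3,4) by blast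
  then show ?thesis using modl_subset[OF assms(1)] modl_subset[OF assms(2)] unfolding modl_def by blast
qed

text \<open>
  \<open>B\<close> is a connected component of the complement graph. If it is not all of \<open>C\<close> then \<open>B\<close> and
  \<open>C - B\<close> are the chosen modules, otherwise the maximal proper modules are.
\<close>

locale connected_part =
  fixes E :: "'a \<Rightarrow> 'a \<Rightarrow> bool" and C B :: "'a set" and rep :: "'a set \<Rightarrow> 'a"
  assumes fin: "finite C"
    and sym: "\<And>x y. x \<in> C \<Longrightarrow> y \<in> C \<Longrightarrow> E x y = E y x"
    and conn_C: "conn E C"
    and B_sub: "B \<subseteq> C"
    and conn_B: "conn (\<lambda>x y. \<not> E x y) B"
    and join_B: "\<And>x b. x \<in> C \<Longrightarrow> x \<notin> B \<Longrightarrow> b \<in> B \<Longrightarrow> E x b"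
    and rep_in: "\<And>X. X \<subseteq> C \<Longrightarrow> X \<noteq> {} \<Longrightarrow> rep X \<in> X"
    and rep_universal: "\<And>X x. X \<subseteq> C \<Longrightarrow> x \<in> X \<Longrightarrow> \<forall>y\<in>X. y = x \<or> E x y \<Longrightarrow>
      \<forall>y\<in>X. y = rep X \<or> E (rep X) y"
begin

text \<open>The disjunct \<open>u = v\<close> is there for a one-vertex \<open>C\<close>, where the
  only module containing the vertex is not proper.\<close>

definition sim :: "'a \<Rightarrow> 'a \<Rightarrow> bool" where
  "sim u v \<longleftrightarrow> u = v \<or>
     (if B = C then \<exists>M. modl E C M \<and> u \<in> M \<and> v \<in> M \<and> M \<noteq> C else u \<in> B \<longleftrightarrow> v \<in> B)"

definition cls :: "'a \<Rightarrow> 'a set" where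
  "cls u = {v\<in>C. sim u v}"

definition quot :: "'a \<Rightarrow> 'a" where
  "quot u = rep (cls u)"

text \<open>If two proper modules covered \<open>C\<close>, then comparing pairs through both of
  them would show that the pairs between \<open>M\<close> and \<open>C - M\<close> are all edges or
  all non-edges. The first contradicts connectedness of the complement, the second connectedness of
  the graph.\<close>

lemma Un_modl_proper:
  assumes "B = C" and A: "modl E C M" "M \<noteq> C" and A': "modl E C M'" "M' \<noteq> C"
    and v: "v \<in> M" "v \<in> M'"
  shows "M \<union> M' \<noteq> C"
proof
  assume un: "M \<union> M' = C"
  have sub: "M \<subseteq> C" "M' \<subseteq> C" using A A' modl_subset by blast+
  obtain a0 where a0: "a0 \<in> M" "a0 \<notin> M'" "a0 \<in> C" using un A' sub by blast
  obtain x0 where x0: "x0 \<in> C" "x0 \<notin> M" using A sub by blast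
  have const: "E x a = E x0 a0" if "x \<in> C" "x \<notin> M" "a \<in> M" for x a
  proof -
    have M': "x \<in> M'" "x0 \<in> M'" using that x0 un by blast+
    have "E x a = E x a0" using modlD[OF A(1)] that a0 by blast
    also have "\<dots> = E a0 x" using sym that a0 by blast
    also have "\<dots> = E a0 x0" using modlD[OF A'(1) a0(3,2)] M' by blast
    also have "\<dots> = E x0 a0" using sym x0 a0 by blast
    finally show ?thesis .
  qed
  obtain a x where "a \<in> M" "x \<in> C" "x \<notin> M" "E a x"
    using connD[OF conn_C sub(1) a0(1) x0] by blast
  then have "E x0 a0" using const[of x a] sym[of a x] sub by blast
  moreover have "conn (\<lambda>x y. \<not> E x y) C" using conn_B \<open>B = C\<close> by simp
  then obtain a x where "a \<in> M" "x \<in> C" "x \<notin> M" "\<not> E a x"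
    by (rule connD[OF _ sub(1) a0(1) x0])
  then have "\<not> E x0 a0" using const[of x a] sym[of a x] sub by blast
  ultimately show False by simp
qed

lemma sim_sym: "sim u v \<Longrightarrow> sim v u"
  unfolding sim_def by (auto split: if_splits)

lemma sim_trans:
  assumes "sim u v" "sim v w"
  shows "sim u w"
proof (cases "u = v \<or> v = w \<or> B \<noteq> C")
  case True
  then show ?thesis using assms unfolding sim_def by (auto split: if_splits)
next
  case False
  then obtain M M' where M: "modl E C M" "u \<in> M" "v \<in> M" "M \<noteq> C"
      and M': "modl E C M'" "v \<in> M'" "w \<in> M'" "M' \<noteq> C"
    using assms unfolding sim_def by auto
  have "modl E C (M \<union> M')" using M(1) M'(1) M(3) M'(2) by (rule modl_Un)
  moreover have "M \<union> M' \<noteq> C"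
    using Un_modl_proper[OF _ M(1,4) M'(1,4) M(3) M'(2)] False by blast
  ultimately show ?thesis using M M' False unfolding sim_def by auto
qed

lemma cls_eq: "sim u v \<Longrightarrow> cls u = cls v"
  unfolding cls_def using sim_trans sim_sym by blast

lemma in_cls: "u \<in> C \<Longrightarrow> u \<in> cls u"
  by (simp add: cls_def sim_def)

text \<open>If \<open>B\<close> is not all of \<open>C\<close>, every pair between \<open>B\<close>
  and \<open>C - B\<close> is an edge, so both sides are modules. Otherwise a proper module shared
  by \<open>u\<close> and \<open>a\<close> cannot contain a vertex outside the class.\<close>

lemma modl_cls: "u \<in> C \<Longrightarrow> modl E C (cls u)"
proof -
  assume u: "u \<in> C"
  have "E x a = E x u" if x: "x \<in> C" "x \<notin> cls u" and a: "a \<in> cls u" for x a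
  proof (cases "a = u")
    case False
    have "a \<in> C" "sim u a" "\<not> sim u x" using x a by (auto simp: cls_def)
    show ?thesis
    proof (cases "B = C")
      case True
      then obtain M where M: "modl E C M" "u \<in> M" "a \<in> M" "M \<noteq> C"
        using \<open>sim u a\<close> False unfolding sim_def by auto
      then have "x \<notin> M" using \<open>\<not> sim u x\<close> True unfolding sim_def by auto
      then show ?thesis using modlD[OF M(1) x(1)] M by blast
    next
      case BC: False
      then have "a \<in> B \<longleftrightarrow> u \<in> B" "x \<in> B \<longleftrightarrow> u \<notin> B"
        using \<open>sim u a\<close> \<open>\<not> sim u x\<close> unfolding sim_def by auto
      then have "E x a" "E x u"
        using join_B[of x a] join_B[of x u] join_B[of a x] join_B[of u x] sym[of x a] sym[of x u]
          \<open>a \<in> C\<close> u x by blast+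
      then show ?thesis by simp
    qed
  qed simp
  then have "\<forall>x\<in>C - cls u. (\<forall>a\<in>cls u. E x a) \<or> (\<forall>a\<in>cls u. \<not> E x a)" by blast
  moreover have "cls u \<subseteq> C" by (auto simp: cls_def)
  ultimately show ?thesis unfolding modl_def by blast
qed

text \<open>For \<open>B = C\<close>, take a largest proper module containing \<open>u\<close>. If
  all vertices were similar to \<open>u\<close>, a vertex outside it would share another proper
  module with \<open>u\<close>, and the union of the two would be larger and still proper.\<close>

lemma cls_proper:
  assumes u: "u \<in> C" and "C \<noteq> {u}"
  shows "cls u \<noteq> C"
proof
  assume all: "cls u = C"
  show False
  proof (cases "B = C")
    case True
    let ?P = "\<lambda>M. modl E C M \<and> u \<in> M \<and> M \<noteq> C"
    have "?P {u}" using assms by (auto simp: modl_def)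
    moreover have "\<forall>M. ?P M \<longrightarrow> card M < Suc (card C)"
      using fin modl_subset by (blast intro: card_mono le_imp_less_Suc)
    ultimately have "\<exists>M. ?P M \<and> (\<forall>M'. ?P M' \<longrightarrow> card M' \<le> card M)"
      using ex_has_greatest_nat[of ?P "{u}" card "Suc (card C)"] by blast
    then obtain M where M: "?P M" "\<And>M'. ?P M' \<Longrightarrow> card M' \<le> card M" by blast
    then obtain w where w: "w \<in> C" "w \<notin> M" using modl_subset by blast
    then have "sim u w" "u \<noteq> w" using all M(1) unfolding cls_def by blast+
    then obtain M' where M': "modl E C M'" "u \<in> M'" "w \<in> M'" "M' \<noteq> C"
      using True unfolding sim_def by auto
    have "?P (M \<union> M')"
      using modl_Un[of E C M M' u] Un_modl_proper[OF True, of M M' u] M(1) M' by simp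
    then have "card (M \<union> M') \<le> card M" by (rule M(2))
    moreover have "finite (M \<union> M')"
      using modl_subset M M' fin by (meson Un_least finite_subset)
    then have "card M < card (M \<union> M')" using w M' by (intro psubset_card_mono) auto
    ultimately show False by simp
  next
    case False
    obtain b x where "b \<in> C" "b \<in> B" "x \<in> C" "x \<notin> B"
      using conn_B B_sub False unfolding conn_def by blast
    moreover from this have "sim u b" "sim u x" using all unfolding cls_def by blast+
    ultimately show False using False sim_trans[of b u x] sim_sym unfolding sim_def by metis
  qed
qed

lemma sim_quot:
  assumes "u \<in> C"
  shows "quot u \<in> C" "sim u (quot u)" "cls (quot u) = cls u"
proof -
  have "quot u \<in> cls u" unfolding quot_def using in_cls[OF assms] by (intro rep_in) (auto simp: cls_def)
  then show "quot u \<in> C" "sim u (quot u)" by (auto simp: cls_def)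
  then show "cls (quot u) = cls u" using cls_eq by simp
qed

lemma quot_eq_iff:
  assumes "u \<in> C" "v \<in> C"
  shows "quot u = quot v \<longleftrightarrow> sim u v"
proof
  assume "quot u = quot v"
  then have "cls u = cls v" using sim_quot(3) assms by metis
  then show "sim u v" using in_cls[OF assms(2)] by (auto simp: cls_def)
qed (simp add: quot_def cls_eq)

lemma fibre: "u \<in> C \<Longrightarrow> {v\<in>C. quot v = quot u} = cls u"
  using quot_eq_iff sim_sym by (auto simp: cls_def)

sublocale modular_quotient E C quot
proof
  show "finite C" by (rule fin)
  show "E x y = E y x" if "x \<in> C" "y \<in> C" for x y using sym that .
  show "quot v \<in> C" if "v \<in> C" for v using sim_quot(1)[OF that] .
  show "quot (quot v) = quot v" if "v \<in> C" for v
    using sim_quot(3)[OF that] by (simp add: quot_def)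
  show "E x y = E (quot x) (quot y)" if xy: "x \<in> C" "y \<in> C" "quot x \<noteq> quot y" for x y
  proof -
    have notin: "x \<notin> cls y" "quot y \<notin> cls x"
    proof -
      have "\<not> sim x y" using xy quot_eq_iff by blast
      then have "\<not> sim y x" using sim_sym by blast
      then show "x \<notin> cls y" by (simp add: cls_def)
      have "\<not> sim x (quot y)"
        using \<open>\<not> sim x y\<close> sim_trans[OF _ sim_sym[OF sim_quot(2)[OF xy(2)]]] by blast
      then show "quot y \<notin> cls x" by (simp add: cls_def)
    qed
    have in_cls': "quot u \<in> cls u" if "u \<in> C" for u using sim_quot[OF that] by (simp add: cls_def)
    have "E x y = E x (quot y)"
      by (rule modlD[OF modl_cls[OF xy(2)] xy(1) notin(1) in_cls[OF xy(2)] in_cls'[OF xy(2)]])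
    also have "\<dots> = E (quot y) x" by (rule sym[OF xy(1) sim_quot(1)[OF xy(2)]])
    also have "\<dots> = E (quot y) (quot x)"
      by (rule modlD[OF modl_cls[OF xy(1)] sim_quot(1)[OF xy(2)] notin(2) in_cls[OF xy(1)]
            in_cls'[OF xy(1)]])
    also have "\<dots> = E (quot x) (quot y)" by (rule sym[OF sim_quot(1)[OF xy(2)] sim_quot(1)[OF xy(1)]])
    finally show ?thesis .
  qed
  show "\<exists>w\<in>C. quot w \<noteq> quot v \<and> E v w" if v: "v \<in> C" "C \<noteq> {v}" for v
  proof -
    have sub: "cls v \<subseteq> C" by (auto simp: cls_def)
    then obtain x where "x \<in> C" "x \<notin> cls v" using cls_proper[OF v] by blast
    \<comment> \<open>The class is proper and \<open>C\<close> is connected, so an edge leaves the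
      class; the module property moves its inner end to \<open>v\<close>.\<close>
    then obtain a b where ab: "a \<in> cls v" "b \<in> C" "b \<notin> cls v" "E a b"
      using connD[OF conn_C sub in_cls[OF v(1)]] by blast
    then have "E b v" using modlD[OF modl_cls[OF v(1)], of b a v] in_cls[OF v(1)] sym[of a b] sub by blast
    moreover have "quot b \<noteq> quot v" using fibre[OF v(1)] ab by blast
    ultimately show ?thesis using ab sym v by blast
  qed
  show "\<forall>y\<in>C. quot y = quot x \<longrightarrow> y = quot x \<or> E (quot x) y"
    if "x \<in> C" "\<forall>y\<in>C. quot y = quot x \<longrightarrow> y = x \<or> E x y" for x
  proof -
    have "\<forall>y\<in>cls x. y = x \<or> E x y" using that fibre[OF that(1)] by blast
    then have "\<forall>y\<in>cls x. y = quot x \<or> E (quot x) y"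
      unfolding quot_def using in_cls[OF that(1)]
      by (intro rep_universal) (auto simp: cls_def)
    then show ?thesis using fibre[OF that(1)] by blast
  qed
qed

text \<open>\<open>h\<close> stands for any nontrivial modular partition into at most
  \<open>k\<close> parts. If \<open>B = C\<close>, its parts are proper modules and hence lie inside
  classes. Otherwise there are just two classes, and nontriviality of \<open>h\<close> gives
  \<open>2 \<le> k\<close>.\<close>

lemma card_quot_le:
  assumes h: "h ` C \<subseteq> {..<k :: nat}" "x0 \<in> C" "y0 \<in> C" "h x0 \<noteq> h y0"
    and mod: "\<And>x y z. x \<in> C \<Longrightarrow> y \<in> C \<Longrightarrow> z \<in> C \<Longrightarrow> h x = h y \<Longrightarrow> h z \<noteq> h x \<Longrightarrow> E z x = E z y"
  shows "card (quot ` C) \<le> k"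
proof (cases "B = C")
  case True
  have "quot x = quot y" if "x \<in> C" "y \<in> C" "h x = h y" for x y
  proof -
    let ?M = "{v\<in>C. h v = h x}"
    have "modl E C ?M"
    proof -
      have "E z a = E z x" if "z \<in> C - ?M" "a \<in> ?M" for z a
        using mod[of a x z] that \<open>x \<in> C\<close> by auto
      then show ?thesis unfolding modl_def by blast
    qed
    moreover have "?M \<noteq> C" using h by (metis (mono_tags, lifting) mem_Collect_eq)
    ultimately have "sim x y" using that True unfolding sim_def by auto
    then show ?thesis using quot_eq_iff that by blast
  qed
  \<comment> \<open>The quotient map factors through \<open>h\<close>.\<close>
  then have "quot (inv_into C h (h x)) = quot x" if "x \<in> C" for x
    using that by (metis f_inv_into_f imageI inv_into_into)
  then have "quot ` C \<subseteq> (\<lambda>i. quot (inv_into C h i)) ` (h ` C)"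
    by (metis (no_types, lifting) image_eqI image_subsetI)
  also have "\<dots> \<subseteq> (\<lambda>i. quot (inv_into C h i)) ` {..<k}" using h(1) by blast
  finally have "card (quot ` C) \<le> card ((\<lambda>i. quot (inv_into C h i)) ` {..<k})"
    by (intro card_mono) auto
  also have "\<dots> \<le> k" using card_image_le[of "{..<k}"] by simp
  finally show ?thesis .
next
  case False
  have "{h x0, h y0} \<subseteq> {..<k}" using h by blast
  then have "card {h x0, h y0} \<le> card {..<k}" by (intro card_mono) auto
  then have "2 \<le> k" using h(4) by simp
  obtain b x where bx: "b \<in> B" "b \<in> C" "x \<in> C" "x \<notin> B" using conn_B B_sub False by (auto simp: conn_def)
  have "quot ` C \<subseteq> {quot b, quot x}"
  proof
    fix u
    assume "u \<in> quot ` C"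
    then obtain v where v: "v \<in> C" "u = quot v" by blast
    have "sim v b \<or> sim v x" using bx False unfolding sim_def by auto
    then show "u \<in> {quot b, quot x}" using quot_eq_iff v bx by blast
  qed
  then have "card (quot ` C) \<le> card {quot b, quot x}" by (intro card_mono) auto
  also have "\<dots> \<le> 2" by (simp add: card_insert_if)
  finally show ?thesis using \<open>2 \<le> k\<close> by simp
qed

end

section \<open>Connected components\<close>

definition component :: "('a \<Rightarrow> 'a \<Rightarrow> bool) \<Rightarrow> 'a set \<Rightarrow> 'a set \<Rightarrow> bool" where
  "component E V C \<longleftrightarrow> C \<subseteq> V \<and> conn E C \<and> (\<forall>x\<in>C. \<forall>y\<in>V - C. \<not> E x y \<and> \<not> E y x)"

lemma conn_subset_component:
  assumes "component E V C" "conn E D" "D \<subseteq> V" "x \<in> D" "x \<in> C"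
  shows "D \<subseteq> C"
proof
  fix y
  assume "y \<in> D"
  show "y \<in> C"
  proof (rule ccontr)
    assume "y \<notin> C"
    then obtain a b where "a \<in> D \<inter> C" "b \<in> D" "b \<notin> D \<inter> C" "E a b"
      using connD[OF assms(2), of "D \<inter> C" x y] assms \<open>y \<in> D\<close> by blast
    then show False using assms unfolding component_def by blast
  qed
qed

text \<open>A unit is connected and so cannot leave a component that it meets; likewise a vertex
  that dominates a vertex of \<open>C\<close> lies in \<open>C\<close>, together with its
  unit.\<close>

lemma units_restrict:
  assumes C: "component E V C" and u: "units E r V \<D>"
  shows "units E r C {D\<in>\<D>. D \<subseteq> C}"
proof -
  note U = u[unfolded units_def dominates_def]
  have sub: "D \<subseteq> C" if "D \<in> \<D>" "d \<in> D" "d \<in> C" for D d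
    using conn_subset_component[OF C, of D d] U that by blast
  have "v \<in> \<Union>{D\<in>\<D>. D \<subseteq> C} \<or> (\<exists>d\<in>\<Union>{D\<in>\<D>. D \<subseteq> C}. E d v)" if v: "v \<in> C" for v
  proof -
    have "v \<in> V" using v C unfolding component_def by blast
    then consider "v \<in> \<Union>\<D>" | d where "d \<in> \<Union>\<D>" "E d v" using U by blast
    then show ?thesis
    proof cases
      case 1
      then show ?thesis using sub v by blast
    next
      case 2
      then have "d \<in> C" using C U v unfolding component_def by blast
      then show ?thesis using 2 sub by blast
    qed
  qed
  then show ?thesis using U unfolding units_def dominates_def by (auto simp: disjoint_def)
qed

lemma units_Union:
  assumes part: "(\<Union>i\<in>I. C i) = V" "finite I" "\<And>i j. i \<in> I \<Longrightarrow> j \<in> I \<Longrightarrow> i \<noteq> j \<Longrightarrow> C i \<inter> C j = {}"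
    and u: "\<And>i. i \<in> I \<Longrightarrow> units E r (C i) (\<D> i)"
  shows "units E r V (\<Union>i\<in>I. \<D> i)"
proof -
  note U = u[unfolded units_def dominates_def]
  have "disjoint (\<Union>i\<in>I. \<D> i)"
    unfolding disjoint_def
  proof (intro ballI impI)
    fix A B
    assume AB: "A \<in> (\<Union>i\<in>I. \<D> i)" "B \<in> (\<Union>i\<in>I. \<D> i)" "A \<noteq> B"
    then obtain i j where ij: "i \<in> I" "j \<in> I" "A \<in> \<D> i" "B \<in> \<D> j" by blast
    show "A \<inter> B = {}"
    proof (cases "i = j")
      case True
      have "disjoint (\<D> i)" using U[OF ij(1)] by blast
      then show ?thesis using True ij AB by (simp add: disjoint_def)
    next
      case False
      then have "C i \<inter> C j = {}" using part(3) ij by blast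
      moreover have "A \<subseteq> C i" "B \<subseteq> C j" using U ij by blast+
      ultimately show ?thesis by blast
    qed
  qed
  moreover have "finite (\<Union>i\<in>I. \<D> i)" using part(2) U by simp
  moreover have D: "D \<subseteq> V \<and> card D = r \<and> conn E D" if D: "D \<in> (\<Union>i\<in>I. \<D> i)" for D
  proof -
    obtain i where i: "i \<in> I" "D \<in> \<D> i" using D by blast
    then have "D \<subseteq> C i \<and> card D = r \<and> conn E D" using U[OF i(1)] by simp
    then show ?thesis using i(1) part(1) by blast
  qed
  moreover have "v \<in> \<Union>(\<Union>i\<in>I. \<D> i) \<or> (\<exists>d\<in>\<Union>(\<Union>i\<in>I. \<D> i). E d v)" if "v \<in> V" for v
  proof -
    obtain i where i: "i \<in> I" "v \<in> C i" using \<open>v \<in> V\<close> part(1) by blast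
    then have "v \<in> \<Union>(\<D> i) \<or> (\<exists>d\<in>\<Union>(\<D> i). E d v)" using U[OF i(1)] by simp
    then show ?thesis using i(1) by blast
  qed
  moreover have "\<Union>(\<Union>i\<in>I. \<D> i) \<subseteq> V" by (rule Union_least) (use D in blast)
  ultimately show ?thesis unfolding units_def dominates_def by simp
qed

lemma units_components:
  assumes part: "(\<Union>i\<in>I. C i) = V" "finite I" "\<And>i j. i \<in> I \<Longrightarrow> j \<in> I \<Longrightarrow> i \<noteq> j \<Longrightarrow> C i \<inter> C j = {}"
    and comp: "\<And>i. i \<in> I \<Longrightarrow> component E V (C i)"
    and opt: "\<And>i. i \<in> I \<Longrightarrow> \<exists>\<D>. units E r (C i) \<D> \<and> card \<D> \<le> opt i"
    and min: "\<And>i \<D>. i \<in> I \<Longrightarrow> units E r (C i) \<D> \<Longrightarrow> opt i \<le> card \<D>"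
  shows "(\<exists>\<D>. units E r V \<D> \<and> card \<D> \<le> k) \<longleftrightarrow> (\<Sum>i\<in>I. opt i) \<le> k"
proof
  assume "\<exists>\<D>. units E r V \<D> \<and> card \<D> \<le> k"
  then obtain \<D> where \<D>: "units E r V \<D>" "card \<D> \<le> k" by blast
  let ?D = "\<lambda>i. {D\<in>\<D>. D \<subseteq> C i}"
  \<comment> \<open>Units are nonempty, so none of them is counted for two components.\<close>
  have fin: "finite \<D>" and ne: "\<And>D. D \<in> \<D> \<Longrightarrow> D \<noteq> {}"
    using \<D>(1) by (auto simp: units_def conn_def)
  have "(\<Sum>i\<in>I. opt i) \<le> (\<Sum>i\<in>I. card (?D i))"
    using min units_restrict[OF comp \<D>(1)] by (intro sum_mono) blast
  also have "\<dots> = card (\<Union>i\<in>I. ?D i)"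
  proof (rule card_UN_disjoint[symmetric])
    show "\<forall>i\<in>I. \<forall>j\<in>I. i \<noteq> j \<longrightarrow> ?D i \<inter> ?D j = {}"
      using part(3) ne by blast
  qed (use part(2) fin in auto)
  also have "\<dots> \<le> card \<D>" using fin by (intro card_mono) auto
  finally show "(\<Sum>i\<in>I. opt i) \<le> k" using \<D>(2) by simp
next
  assume k: "(\<Sum>i\<in>I. opt i) \<le> k"
  have "\<forall>i\<in>I. \<exists>\<D>. units E r (C i) \<D> \<and> card \<D> \<le> opt i" using opt by blast
  then obtain \<D> where \<D>: "\<And>i. i \<in> I \<Longrightarrow> units E r (C i) (\<D> i) \<and> card (\<D> i) \<le> opt i" by metis
  have "card (\<Union>i\<in>I. \<D> i) \<le> (\<Sum>i\<in>I. card (\<D> i))" using part(2) by (rule card_UN_le)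
  also have "\<dots> \<le> (\<Sum>i\<in>I. opt i)" using \<D> by (intro sum_mono) blast
  finally have "card (\<Union>i\<in>I. \<D> i) \<le> k" using k by simp
  moreover have "units E r V (\<Union>i\<in>I. \<D> i)" using \<D> by (intro units_Union[OF part]) auto
  ultimately show "\<exists>\<D>. units E r V \<D> \<and> card \<D> \<le> k" by blast
qed

section \<open>Closures\<close>

text \<open>The least superset of \<open>A\<close> that is closed under the rule that
  \<open>X\<close> forces \<open>x\<close> whenever \<open>P x X\<close>. Reachability, reachability
  in the complement, and the smallest module containing a set are instances.\<close>

definition is_closure :: "('a \<Rightarrow> 'a set \<Rightarrow> bool) \<Rightarrow> 'a set \<Rightarrow> 'a set \<Rightarrow> 'a set \<Rightarrow> bool" where
  "is_closure P C A S \<longleftrightarrow> A \<subseteq> S \<and> S \<subseteq> C \<and> (\<forall>x\<in>C. P x S \<longrightarrow> x \<in> S) \<and>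
     (\<forall>T. A \<subseteq> T \<longrightarrow> (\<forall>x\<in>C. P x T \<longrightarrow> x \<in> T) \<longrightarrow> S \<subseteq> T)"

text \<open>Every iteration before stabilisation adds an element of \<open>C\<close>, so
  \<open>card C\<close> iterations suffice; monotonicity of \<open>P\<close> gives
  leastness.\<close>

lemma is_closure_funpow:
  assumes fin: "finite C" and A: "A \<subseteq> C" and mono: "\<And>x X Y. P x X \<Longrightarrow> X \<subseteq> Y \<Longrightarrow> P x Y"
    and f: "\<And>X. f X = {x\<in>C. x \<in> X \<or> P x X}"
  shows "is_closure P C A ((f ^^ card C) A)"
proof -
  have sub: "(f ^^ n) A \<subseteq> C" for n using A f by (cases n) auto
  have inc: "(f ^^ n) A \<subseteq> (f ^^ Suc n) A" for n using sub[of n] f by auto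
  have "\<exists>n\<le>card C. (f ^^ Suc n) A = (f ^^ n) A"
  proof (rule ccontr)
    assume no: "\<not> ?thesis"
    have "n \<le> card ((f ^^ n) A)" if "n \<le> Suc (card C)" for n
      using that
    proof (induction n)
      case (Suc n)
      have "(f ^^ n) A \<subset> (f ^^ Suc n) A" using no inc[of n] Suc.prems by auto
      then have "card ((f ^^ n) A) < card ((f ^^ Suc n) A)"
        using finite_subset[OF sub fin] by (rule psubset_card_mono[rotated])
      then show ?case using Suc by simp
    qed simp
    then have "Suc (card C) \<le> card ((f ^^ Suc (card C)) A)" by blast
    also have "\<dots> \<le> card C" using sub fin by (rule card_mono[rotated])
    finally show False by simp
  qed
  then obtain n where n: "n \<le> card C" "f ((f ^^ n) A) = (f ^^ n) A" by auto
  have fix_n: "(f ^^ (n + m)) A = (f ^^ n) A" for m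
    by (induction m) (simp_all add: n(2))
  then have fixed: "f ((f ^^ card C) A) = (f ^^ card C) A"
    using n fix_n[of "card C - n"] by simp
  have le: "A \<subseteq> (f ^^ n) A" for n
  proof (induction n)
    case (Suc n)
    then show ?case using inc[of n] by blast
  qed simp
  have least: "(f ^^ n) A \<subseteq> T" if "A \<subseteq> T" "\<forall>x\<in>C. P x T \<longrightarrow> x \<in> T" for n T
  proof (induction n)
    case (Suc n)
    then show ?case using that f mono[OF _ Suc] by auto
  qed (use that in simp)
  have closed: "x \<in> (f ^^ card C) A" if "x \<in> C" "P x ((f ^^ card C) A)" for x
    using fixed f[of "(f ^^ card C) A"] that by blast
  show ?thesis unfolding is_closure_def using le sub closed least by blast
qed

text \<open>If no edge crossed a cut of \<open>S\<close>, the side containing \<open>v\<close> would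
  be closed already, contradicting leastness.\<close>

lemma closure_conn:
  assumes S: "is_closure (\<lambda>x X. \<exists>a\<in>X. E x a) C {v} S" and v: "v \<in> C"
    and sym: "\<And>x y. x \<in> C \<Longrightarrow> y \<in> C \<Longrightarrow> E x y = E y x"
  shows "v \<in> S" "S \<subseteq> C" "conn E S" "x \<in> C \<Longrightarrow> x \<notin> S \<Longrightarrow> a \<in> S \<Longrightarrow> \<not> E x a"
proof -
  show vS: "v \<in> S" and SC: "S \<subseteq> C" and cl: "x \<in> C \<Longrightarrow> x \<notin> S \<Longrightarrow> a \<in> S \<Longrightarrow> \<not> E x a" for x a
    using S unfolding is_closure_def by blast+
  have least: "S \<subseteq> T" if "v \<in> T" "\<forall>x\<in>C. (\<exists>a\<in>T. E x a) \<longrightarrow> x \<in> T" for T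
    using S that unfolding is_closure_def by simp
  show "conn E S"
    unfolding conn_def
  proof (intro conjI allI impI)
    show "S \<noteq> {}" using vS by blast
    fix A
    assume A: "A \<subseteq> S" "A \<noteq> {}" "A \<noteq> S"
    show "\<exists>a\<in>A. \<exists>b\<in>S - A. E a b"
    proof (rule ccontr)
      assume no: "\<not> ?thesis"
      have *: "\<not> E x a" if "x \<in> S" "a \<in> S" "x \<in> A \<longleftrightarrow> a \<notin> A" for x a
        using no that sym[of x a] SC by blast
      show False
      proof (cases "v \<in> A")
        case True
        have "S \<subseteq> A"
        proof (rule least[OF True], intro ballI impI, elim bexE)
          fix x a
          assume "x \<in> C" "a \<in> A" "E x a"
          moreover then have "x \<in> S" using cl A(1) by blast
          ultimately show "x \<in> A" using * A(1) by blast
        qed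
        then show False using A by blast
      next
        case False
        have "S \<subseteq> S - A"
        proof (rule least, goal_cases)
          case 2
          show ?case
          proof (intro ballI impI, elim bexE)
          fix x a
          assume "x \<in> C" "a \<in> S - A" "E x a"
          moreover then have "x \<in> S" using cl by blast
          ultimately show "x \<in> S - A" using * by blast
          qed
        qed (use False vS in blast)
        then show False using A by blast
      qed
    qed
  qed
qed

lemma conn_iff_closure:
  assumes S: "is_closure (\<lambda>x X. \<exists>a\<in>X. E x a) D {v} S" and v: "v \<in> D"
    and sym: "\<And>x y. x \<in> D \<Longrightarrow> y \<in> D \<Longrightarrow> E x y = E y x"
  shows "conn E D \<longleftrightarrow> S = D"
proof
  assume "conn E D"
  show "S = D"
  proof (rule ccontr)
    assume "S \<noteq> D"
    moreover have "S \<subseteq> D" "v \<in> S" using closure_conn[OF S v sym] by blast+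
    ultimately obtain b where "b \<in> D" "b \<notin> S" by blast
    then obtain x y where "x \<in> S" "y \<in> D" "y \<notin> S" "E x y"
      using connD[OF \<open>conn E D\<close> \<open>S \<subseteq> D\<close> \<open>v \<in> S\<close>] by blast
    then show False using closure_conn(4)[OF S v sym] sym \<open>S \<subseteq> D\<close> by blast
  qed
qed (use closure_conn(3)[OF S v sym] in blast)

text \<open>A vertex outside \<open>X\<close> that has both a neighbour and a non-neighbour in
  \<open>X\<close> belongs to every module containing \<open>X\<close>, and sets without such
  vertices are modules. The closure is therefore the least module containing
  \<open>A\<close>.\<close>

lemma closure_modl:
  assumes "is_closure (\<lambda>x X. x \<in> X \<or> (\<exists>a\<in>X. E x a) \<and> (\<exists>a\<in>X. \<not> E x a)) C A S"
  shows "S \<noteq> C \<longleftrightarrow> (\<exists>M. modl E C M \<and> A \<subseteq> M \<and> M \<noteq> C)"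
proof
  have "modl E C S" using assms unfolding is_closure_def modl_def by blast
  then show "S \<noteq> C \<Longrightarrow> \<exists>M. modl E C M \<and> A \<subseteq> M \<and> M \<noteq> C"
    using assms unfolding is_closure_def by blast
  assume "\<exists>M. modl E C M \<and> A \<subseteq> M \<and> M \<noteq> C"
  then obtain M where M: "modl E C M" "A \<subseteq> M" "M \<noteq> C" by blast
  then have "\<forall>x\<in>C. x \<in> M \<or> (\<exists>a\<in>M. E x a) \<and> (\<exists>a\<in>M. \<not> E x a) \<longrightarrow> x \<in> M"
    unfolding modl_def by blast
  then have "S \<subseteq> M" using assms M(2) unfolding is_closure_def by blast
  then show "S \<noteq> C" using M modl_subset[OF M(1)] by blast
qed

section \<open>Graphs of the problem instances\<close>

lemma arcs_ends_induce: "arcs_ends (G \<restriction> D) = {(u, v) \<in> arcs_ends G. u \<in> D \<and> v \<in> D}"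
  by (auto simp: arcs_ends_conv)

text \<open>A path that starts in \<open>A\<close> and ends outside crosses the cut at some edge.
  Conversely, the set reachable from \<open>u\<close> is a cut that no edge leaves.\<close>

lemma connected_iff_conn:
  assumes sym: "\<And>u v. u \<rightarrow>\<^bsub>G\<^esub> v \<Longrightarrow> v \<rightarrow>\<^bsub>G\<^esub> u"
  shows "connected (G \<restriction> D) \<longleftrightarrow> conn (\<lambda>u v. u \<rightarrow>\<^bsub>G\<^esub> v) D"
proof -
  let ?R = "(arcs_ends (G \<restriction> D))\<^sup>s"
  have R: "(u, v) \<in> ?R \<longleftrightarrow> u \<in> D \<and> v \<in> D \<and> u \<rightarrow>\<^bsub>G\<^esub> v" for u v
    using sym by (auto simp: symcl_def arcs_ends_induce)
  show ?thesis
  proof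
    assume "connected (G \<restriction> D)"
    then have D: "D \<noteq> {}" "\<And>u v. u \<in> D \<Longrightarrow> v \<in> D \<Longrightarrow> (u, v) \<in> rtrancl_on D ?R"
      by (auto simp: connected_conv)
    show "conn (\<lambda>u v. u \<rightarrow>\<^bsub>G\<^esub> v) D"
      unfolding conn_def
    proof (intro conjI allI impI)
      fix A
      assume A: "A \<subseteq> D" "A \<noteq> {}" "A \<noteq> D"
      then obtain u v where uv: "u \<in> A" "v \<in> D" "v \<notin> A" by blast
      have "(u, v) \<in> rtrancl_on D ?R" using D A uv by blast
      then show "\<exists>a\<in>A. \<exists>b\<in>D - A. a \<rightarrow>\<^bsub>G\<^esub> b"
        using \<open>u \<in> A\<close> \<open>v \<notin> A\<close>
      proof (induction rule: rtrancl_on.induct)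
        case (rtrancl_on_into_rtrancl_on u v w)
        then show ?case using R by (cases "v \<in> A") blast+
      qed simp
    qed (rule D(1))
  next
    assume D: "conn (\<lambda>u v. u \<rightarrow>\<^bsub>G\<^esub> v) D"
    have "(u, v) \<in> rtrancl_on D ?R" if uv: "u \<in> D" "v \<in> D" for u v
    proof (rule ccontr)
      assume v: "(u, v) \<notin> rtrancl_on D ?R"
      let ?A = "{w\<in>D. (u, w) \<in> rtrancl_on D ?R}"
      have "u \<in> ?A" using uv by (auto intro: rtrancl_on.intros)
      then obtain x y where "x \<in> ?A" "y \<in> D" "y \<notin> ?A" "x \<rightarrow>\<^bsub>G\<^esub> y"
        using connD[OF D, of ?A u v] v uv by blast
      moreover from this have "(x, y) \<in> ?R" using R by blast
      ultimately show False by (auto intro: rtrancl_on.intros)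
    qed
    moreover have "D \<noteq> {}" using D by (auto simp: conn_def)
    ultimately show "connected (G \<restriction> D)" by (auto simp: connected_conv)
  qed
qed

lemma grouped_dominating_set_iff:
  assumes "\<And>u v. u \<rightarrow>\<^bsub>G\<^esub> v \<Longrightarrow> v \<rightarrow>\<^bsub>G\<^esub> u"
  shows "grouped_dominating_set r k G \<D> \<longleftrightarrow> units (\<lambda>u v. u \<rightarrow>\<^bsub>G\<^esub> v) r (verts G) \<D> \<and> card \<D> = k"
  using connected_iff_conn[OF assms]
  by (auto simp: grouped_dominating_set_def units_def dominating_set_def dominates_def)

lemma conn_image:
  assumes E: "\<And>x y. x \<in> D \<Longrightarrow> y \<in> D \<Longrightarrow> E' (f x) (f y) = E x y" and D: "conn E D"
  shows "conn E' (f ` D)"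
  unfolding conn_def
proof (intro conjI allI impI)
  show "f ` D \<noteq> {}" using D by (auto simp: conn_def)
  fix A
  assume A: "A \<subseteq> f ` D" "A \<noteq> {}" "A \<noteq> f ` D"
  let ?A = "{x\<in>D. f x \<in> A}"
  obtain x y where "x \<in> ?A" "y \<in> D" "y \<notin> ?A" using A by blast
  then obtain x y where "x \<in> ?A" "y \<in> D" "y \<notin> ?A" "E x y" using connD[OF D, of ?A] by blast
  then show "\<exists>a\<in>A. \<exists>b\<in>f ` D - A. E' a b" using E by blast
qed

text \<open>The vertices of an instance are numbers, those of the algorithm unary trees; this
  transfers solutions along the renaming.\<close>

lemma units_image:
  assumes inj: "inj_on f V" and E: "\<And>x y. x \<in> V \<Longrightarrow> y \<in> V \<Longrightarrow> E' (f x) (f y) = E x y"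
    and u: "units E r V \<D>"
  shows "units E' r (f ` V) ((`) f ` \<D>)" "card ((`) f ` \<D>) = card \<D>"
proof -
  note U = u[unfolded units_def dominates_def]
  have sub: "D \<subseteq> V" if "D \<in> \<D>" for D using U that by blast
  have injD: "inj_on ((`) f) \<D>"
    using inj_on_image_eq_iff[OF inj] sub by (metis inj_onI)
  then show "card ((`) f ` \<D>) = card \<D>" by (rule card_image)
  have disj: "disjoint ((`) f ` \<D>)"
    unfolding disjoint_def
  proof (intro ballI impI)
    fix A B
    assume AB: "A \<in> (`) f ` \<D>" "B \<in> (`) f ` \<D>" "A \<noteq> B"
    then obtain A' B' where *: "A' \<in> \<D>" "B' \<in> \<D>" "A = f ` A'" "B = f ` B'" by blast
    then have "A' \<noteq> B'" using AB(3) by blast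
    then have "A' \<inter> B' = {}" using U *(1,2) unfolding disjoint_def by blast
    then show "A \<inter> B = {}" using inj_on_image_Int[OF inj, of A' B'] * sub by auto
  qed
  have un: "\<Union>((`) f ` \<D>) = f ` \<Union>\<D>" by blast
  have "v \<in> f ` \<Union>\<D> \<or> (\<exists>d\<in>f ` \<Union>\<D>. E' d v)" if v: "v \<in> f ` V" for v
  proof -
    obtain x where x: "x \<in> V" "v = f x" using v by blast
    then consider "x \<in> \<Union>\<D>" | d where "d \<in> \<Union>\<D>" "E d x" using U by blast
    then show ?thesis
    proof cases
      case 2
      then have "E' (f d) (f x)" using E sub x by blast
      then show ?thesis using 2 x by blast
    qed (use x in blast)
  qed
  moreover have "f ` D \<subseteq> f ` V \<and> card (f ` D) = r \<and> conn E' (f ` D)" if "D \<in> \<D>" for D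
  proof -
    have "card (f ` D) = r" using U that inj_on_subset[OF inj sub[OF that]] by (simp add: card_image)
    moreover have "conn E' (f ` D)"
      using U that sub[OF that] E by (intro conn_image[of D E' f E]) auto
    ultimately show ?thesis using sub[OF that] by blast
  qed
  moreover have "f ` \<Union>\<D> \<subseteq> f ` V" using sub by blast
  ultimately show "units E' r (f ` V) ((`) f ` \<D>)"
    using U disj unfolding units_def dominates_def un by simp
qed

lemma units_image_iff:
  assumes inj: "inj_on f V" and E: "\<And>x y. x \<in> V \<Longrightarrow> y \<in> V \<Longrightarrow> E' (f x) (f y) = E x y"
  shows "(\<exists>\<D>. units E' r (f ` V) \<D> \<and> card \<D> \<le> k) \<longleftrightarrow> (\<exists>\<D>. units E r V \<D> \<and> card \<D> \<le> k)"
proof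
  assume "\<exists>\<D>. units E' r (f ` V) \<D> \<and> card \<D> \<le> k"
  then obtain \<D> where \<D>: "units E' r (f ` V) \<D>" "card \<D> \<le> k" by blast
  let ?g = "inv_into V f"
  have "inj_on ?g (f ` V)" by (rule inj_on_inv_into) simp
  moreover have "E (?g x) (?g y) = E' x y" if "x \<in> f ` V" "y \<in> f ` V" for x y
    using E[of "?g x" "?g y"] that by (simp add: f_inv_into_f inv_into_into)
  ultimately have "units E r (?g ` f ` V) ((`) ?g ` \<D>)" "card ((`) ?g ` \<D>) = card \<D>"
    using units_image[of ?g "f ` V" E E' r \<D>] \<D>(1) by blast+
  moreover have "?g ` f ` V = V" using inj by (simp add: inv_into_image_cancel)
  ultimately show "\<exists>\<D>. units E r V \<D> \<and> card \<D> \<le> k" using \<D>(2) by metis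
next
  assume "\<exists>\<D>. units E r V \<D> \<and> card \<D> \<le> k"
  then obtain \<D> where "units E r V \<D>" "card \<D> \<le> k" by blast
  then show "\<exists>\<D>. units E' r (f ` V) \<D> \<and> card \<D> \<le> k"
    using units_image[of f V E' E r \<D>, OF inj E] by metis
qed

text \<open>The recursive decomposition collapses to one level here. Descend while \<open>C\<close>
  lies inside a single module; at the first level where it meets two modules, they induce a
  nontrivial modular partition of \<open>C\<close>. In a small graph the partition into single
  vertices does.\<close>

lemma modular_width_le_partition:
  assumes "modular_width_le G k" "finite (verts G)" "C \<subseteq> verts G" "2 \<le> card C"
  shows "\<exists>h. h ` C \<subseteq> {..<k} \<and> (\<exists>x\<in>C. \<exists>y\<in>C. h x \<noteq> h y) \<and>
    (\<forall>x\<in>C. \<forall>y\<in>C. \<forall>z\<in>C. h x = h y \<longrightarrow> h z \<noteq> h x \<longrightarrow> (z \<rightarrow>\<^bsub>G\<^esub> x) = (z \<rightarrow>\<^bsub>G\<^esub> y))"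
  using assms
proof (induction)
  case (small G k)
  have fin: "finite C" using small.prems by (metis finite_subset)
  have "card C \<le> k" using small card_mono by (metis le_trans)
  obtain h where h: "bij_betw h C {..<card C}"
    using ex_bij_betw_finite_nat[OF fin] unfolding atLeast0LessThan by blast
  have "h ` C \<subseteq> {..<k}" using h \<open>card C \<le> k\<close> by (auto simp: bij_betw_def)
  moreover have inj: "h x = h y \<longleftrightarrow> x = y" if "x \<in> C" "y \<in> C" for x y
    using h that by (auto simp: bij_betw_def inj_on_def)
  moreover have "\<exists>x\<in>C. \<exists>y\<in>C. x \<noteq> y"
    using small.prems(3) card_le_Suc0_iff_eq[OF fin] by force
  ultimately show ?case by (intro exI[of _ h]) (auto simp: inj)
next
  case (modules G P k)
  obtain b where b: "bij_betw b P {..<card P}"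
    using ex_bij_betw_finite_nat[OF modules.hyps(2)] unfolding atLeast0LessThan by blast
  have ex: "\<exists>M. M \<in> P \<and> v \<in> M" if "v \<in> C" for v
    using that modules.prems(2) partition_onD1[OF modules.hyps(1)] by blast
  define blk where "blk v = (SOME M. M \<in> P \<and> v \<in> M)" for v
  have blk: "blk v \<in> P" "v \<in> blk v" if "v \<in> C" for v
    using someI_ex[OF ex[OF that]] unfolding blk_def by blast+
  have unique: "blk v = M" if "v \<in> C" "M \<in> P" "v \<in> M" for v M
    using blk[OF that(1)] that(2,3) partition_onD2[OF modules.hyps(1)] unfolding disjoint_def by blast
  have b_inj: "b M = b M' \<longleftrightarrow> M = M'" if "M \<in> P" "M' \<in> P" for M M'
    using b that by (auto simp: bij_betw_def inj_on_def)
  show ?case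
  proof (cases "\<exists>x\<in>C. \<exists>y\<in>C. blk x \<noteq> blk y")
    case True
    have "(b \<circ> blk) ` C \<subseteq> {..<k}"
    proof
      fix i
      assume "i \<in> (b \<circ> blk) ` C"
      then have "i \<in> b ` P" using blk(1) by auto
      then show "i \<in> {..<k}" using b modules.hyps(3) by (auto simp: bij_betw_def)
    qed
    moreover have "\<exists>x\<in>C. \<exists>y\<in>C. (b \<circ> blk) x \<noteq> (b \<circ> blk) y" using True b_inj blk(1) by auto
    moreover have "(z \<rightarrow>\<^bsub>G\<^esub> x) = (z \<rightarrow>\<^bsub>G\<^esub> y)"
      if "x \<in> C" "y \<in> C" "z \<in> C" "(b \<circ> blk) x = (b \<circ> blk) y" "(b \<circ> blk) z \<noteq> (b \<circ> blk) x" for x y z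
    proof -
      have eq: "blk x = blk y" using that b_inj blk(1) by auto
      have "z \<notin> blk x" using that unique[of z "blk x"] blk(1)[of x] by auto
      then have "z \<in> verts G - blk x" using that modules.prems(2) by blast
      then have "blk x \<subseteq> neighbourhood G z \<or> blk x \<inter> neighbourhood G z = {}"
        using modules.hyps(4)[OF blk(1)[OF that(1)]] unfolding is_module_def by blast
      then show ?thesis using blk(2)[OF that(1)] blk(2)[OF that(2)] eq unfolding neighbourhood_def by blast
    qed
    ultimately show ?thesis by blast
  next
    case False
    have "C \<noteq> {}" using modules.prems(3) by auto
    then obtain v where v: "v \<in> C" by blast
    let ?M = "blk v"
    have CM: "C \<subseteq> ?M" using False v blk(2) by blast
    have "?M \<subseteq> verts G" using partition_onD1[OF modules.hyps(1)] blk(1)[OF v] by blast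
    then have "finite (verts (G \<restriction> ?M))" using modules.prems(1) finite_subset by auto
    then obtain h where h: "h ` C \<subseteq> {..<k}" "\<exists>x\<in>C. \<exists>y\<in>C. h x \<noteq> h y"
      "\<forall>x\<in>C. \<forall>y\<in>C. \<forall>z\<in>C. h x = h y \<longrightarrow> h z \<noteq> h x \<longrightarrow> (z \<rightarrow>\<^bsub>G \<restriction> ?M\<^esub> x) = (z \<rightarrow>\<^bsub>G \<restriction> ?M\<^esub> y)"
      using modules.IH[OF blk(1)[OF v]] CM modules.prems(3) unfolding induce_subgraph_verts by blast
    have adj: "z \<rightarrow>\<^bsub>G \<restriction> ?M\<^esub> x \<longleftrightarrow> z \<rightarrow>\<^bsub>G\<^esub> x" if "z \<in> C" "x \<in> C" for z x
      using that CM by (auto simp: arcs_ends_induce)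
    have "\<forall>x\<in>C. \<forall>y\<in>C. \<forall>z\<in>C. h x = h y \<longrightarrow> h z \<noteq> h x \<longrightarrow> (z \<rightarrow>\<^bsub>G\<^esub> x) = (z \<rightarrow>\<^bsub>G\<^esub> y)"
    proof (intro ballI impI)
      fix x y z
      assume C: "x \<in> C" "y \<in> C" "z \<in> C" and "h x = h y" "h z \<noteq> h x"
      then have "(z \<rightarrow>\<^bsub>G \<restriction> ?M\<^esub> x) = (z \<rightarrow>\<^bsub>G \<restriction> ?M\<^esub> y)"
        using h(3)[rule_format, OF C] by metis
      then show "(z \<rightarrow>\<^bsub>G\<^esub> x) = (z \<rightarrow>\<^bsub>G\<^esub> y)"
        unfolding adj[OF C(3,1)] adj[OF C(3,2)] .
    qed
    then show ?thesis using h(1,2) by blast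
  qed
qed

lemma modular_width_le_modular_width: "modular_width_le G (modular_width G)"
  unfolding modular_width_def
  by (rule LeastI[of _ "card (verts G)"]) (simp add: modular_width_le.small)

lemma units_cap:
  assumes "finite V"
  shows "units E (min (Suc (card V)) r) V \<D> \<longleftrightarrow> units E r V \<D>"
proof -
  have "card D = min (Suc (card V)) r \<longleftrightarrow> card D = r" if "D \<subseteq> V" for D
    using card_mono[OF assms that] by (auto simp: min_def)
  then show ?thesis unfolding units_def by blast
qed

lemma gds_yes_iff:
  assumes "(G, r, k) \<in> gds_instances"
  shows "gds_yes (G, r, k) \<longleftrightarrow> (\<exists>\<D>. units (\<lambda>i j. (i, j) \<in> parcs G) r (pverts G) \<D> \<and> card \<D> \<le> k)"
proof -
  interpret pair_graph G using assms by (simp add: gds_instances_def)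
  have "v \<rightarrow>\<^bsub>with_proj G\<^esub> u" if "u \<rightarrow>\<^bsub>with_proj G\<^esub> v" for u v
    using that sym_arcs by (auto dest: symD simp: symmetric_def)
  then have *: "grouped_dominating_set r k' (with_proj G) \<D> \<longleftrightarrow>
      units (\<lambda>i j. (i, j) \<in> parcs G) r (pverts G) \<D> \<and> card \<D> = k'" for k' \<D>
    using grouped_dominating_set_iff[of "with_proj G" r k' \<D>] by simp
  show ?thesis unfolding gds_yes_def prod.case * by blast
qed

section \<open>The algorithm\<close>

text \<open>The vertex \<open>i\<close> is represented by \<open>unary i\<close>.\<close>

definition adj :: "tree \<Rightarrow> tree \<Rightarrow> tree \<Rightarrow> bool" where
  "adj M u v \<longleftrightarrow> tnth (tnth M u) v \<noteq> Leaf"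

text \<open>The next vertex is the number of vertices collected so far, so they appear in decreasing
  order.\<close>

definition positions :: "tree \<Rightarrow> tree" where
  "positions M = foldr (\<lambda>_ a. Node (to_unary a) a) (tlist M) Leaf"

text \<open>Equality of trees is not a primitive of the language, but vertices are unary and can be
  compared by length.\<close>

definition has :: "tree \<Rightarrow> tree \<Rightarrow> bool" where
  "has x A \<longleftrightarrow> (\<exists>y\<in>tset A. same_length x y)"

text \<open>Both a flag that is set and the unary number 1; accordingly \<open>Node Leaf one\<close>
  is a unary 2.\<close>

definition one :: tree where
  "one = Node Leaf Leaf"

text \<open>
  \<open>p\<close> and \<open>p'\<close> are flags. With the first one set, the closure of a set is what can be reached from
  it, with the second one what can be reached in the complement graph, and with both of them it is
  the smallest module that contains the set.
\<close>

definition closure_step :: "tree \<Rightarrow> tree \<Rightarrow> tree \<Rightarrow> tree \<Rightarrow> tree \<Rightarrow> tree" where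
  "closure_step M p p' C a = tfilter (\<lambda>x. has x a \<or>
     (p \<noteq> Leaf \<longrightarrow> (\<exists>y\<in>tset a. adj M x y)) \<and> (p' \<noteq> Leaf \<longrightarrow> (\<exists>y\<in>tset a. \<not> adj M x y))) C"

definition tclosure :: "tree \<Rightarrow> tree \<Rightarrow> tree \<Rightarrow> tree \<Rightarrow> tree \<Rightarrow> tree" where
  "tclosure M p p' C A = foldr (\<lambda>_ a. closure_step M p p' C a) (tlist C) A"

definition co_component :: "tree \<Rightarrow> tree \<Rightarrow> tree" where
  "co_component M C = tclosure M Leaf one C (Node (left C) Leaf)"

text \<open>
  A sublist of \<open>C\<close> contains all vertices of \<open>C\<close> iff it has the same length. The same holds in \<open>tconn\<close>.
\<close>

definition tsim :: "tree \<Rightarrow> tree \<Rightarrow> tree \<Rightarrow> tree \<Rightarrow> bool" where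
  "tsim M C u v \<longleftrightarrow> same_length u v \<or>
     (same_length (co_component M C) C \<and>
       \<not> same_length (tclosure M one one C (Node u (Node v Leaf))) C) \<or>
     (\<not> same_length (co_component M C) C \<and> has u (co_component M C) = has v (co_component M C))"

definition tcls :: "tree \<Rightarrow> tree \<Rightarrow> tree \<Rightarrow> tree" where
  "tcls M C u = tfilter (\<lambda>v. tsim M C u v) C"

definition universals :: "tree \<Rightarrow> tree \<Rightarrow> tree" where
  "universals M X = tfilter (\<lambda>x. \<forall>y\<in>tset X. same_length x y \<or> adj M x y) X"

text \<open>The preference for universal vertices provides the locale assumption
  \<open>universal\<close>, on which the case \<open>r = 1\<close> relies.\<close>

definition trep :: "tree \<Rightarrow> tree \<Rightarrow> tree" where
  "trep M X = left (if universals M X \<noteq> Leaf then universals M X else X)"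

definition tquot :: "tree \<Rightarrow> tree \<Rightarrow> tree \<Rightarrow> tree" where
  "tquot M C u = trep M (tcls M C u)"

definition reps :: "tree \<Rightarrow> tree \<Rightarrow> tree" where
  "reps M C = tfilter (\<lambda>u. same_length (tquot M C u) u) C"

definition tconn :: "tree \<Rightarrow> tree \<Rightarrow> bool" where
  "tconn M S \<longleftrightarrow> S \<noteq> Leaf \<and> same_length (tclosure M one Leaf S (Node (left S) Leaf)) S"

definition tdemand :: "tree \<Rightarrow> tree \<Rightarrow> tree \<Rightarrow> tree" where
  "tdemand r S U = (if \<forall>x\<in>tset S. has x U then r else tfilter (\<lambda>x. has x U) S)"

text \<open>The Hall inequality on lists: only lengths count, so a sum of demands is a
  concatenation.\<close>

definition thall :: "tree \<Rightarrow> tree \<Rightarrow> tree \<Rightarrow> tree \<Rightarrow> tree \<Rightarrow> bool" where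
  "thall M C r F U \<longleftrightarrow> shorter (tconcat (tmap (\<lambda>S. tdemand r S U) F)) (tfilter (\<lambda>v. has (tquot M C v) U) C)"

text \<open>The disjunction expresses \<open>min 2 r \<le> card S\<close>; for \<open>r = 1\<close>
  this is nonemptiness, which \<open>tconn\<close> contains.\<close>

definition tvalid :: "tree \<Rightarrow> tree \<Rightarrow> tree \<Rightarrow> tree \<Rightarrow> tree \<Rightarrow> bool" where
  "tvalid M C r Us F \<longleftrightarrow>
     (\<forall>S\<in>tset F. tconn M S \<and> shorter S r \<and> (shorter r one \<or> shorter (Node Leaf one) S)) \<and>
     (\<forall>v\<in>tset C. \<exists>S\<in>tset F. \<exists>u\<in>tset S. same_length u v \<or> adj M u v) \<and>
     (\<forall>U\<in>tset Us. thall M C r F U)"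

definition candidates :: "tree \<Rightarrow> tree \<Rightarrow> tree \<Rightarrow> tree \<Rightarrow> tree" where
  "candidates z M r C = tfilter (\<lambda>F. tvalid M C r (sublists z (reps M C)) F)
     (sublists z (sublists z (reps M C)))"

definition shortest :: "tree \<Rightarrow> tree" where
  "shortest Fs = left (tfilter (\<lambda>F. \<forall>F'\<in>tset Fs. shorter F F') Fs)"

text \<open>The optimal family itself serves as the unary number of its members. \<open>Leaf\<close>
  can signal that no valid family exists, because the empty family does not dominate a nonempty
  component.\<close>

definition best :: "tree \<Rightarrow> tree \<Rightarrow> tree \<Rightarrow> tree \<Rightarrow> tree" where
  "best z M r C = shortest (candidates z M r C)"

definition tcomp :: "tree \<Rightarrow> tree \<Rightarrow> tree" where
  "tcomp M v = tclosure M one Leaf (positions M) (Node v Leaf)"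

text \<open>
  Vertex lists produced by filtering keep the order of \<open>positions M\<close>, so the first element is a
  canonical representative.
\<close>

definition comps :: "tree \<Rightarrow> tree" where
  "comps M = tmap (\<lambda>v. tcomp M v) (tfilter (\<lambda>v. same_length (left (tcomp M v)) v) (positions M))"

definition total_best :: "tree \<Rightarrow> tree \<Rightarrow> tree \<Rightarrow> tree" where
  "total_best z M r = tconcat (tmap (\<lambda>C. best z M r C) (comps M))"

text \<open>
  Both numbers may be exponential in the size of the instance. They are capped: no set of vertices
  has \<open>|V| + 1\<close> elements, so larger values of \<open>r\<close> make no difference.
\<close>

definition decide :: "tree \<Rightarrow> tree \<Rightarrow> tree \<Rightarrow> tree \<Rightarrow> bool" where
  "decide z M r k \<longleftrightarrow> (\<forall>C\<in>tset (comps M). best z M (capped_value (Node Leaf M) r) C \<noteq> Leaf) \<and>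
     shorter (total_best z M (capped_value (Node Leaf M) r))
       (capped_value (total_best z M (capped_value (Node Leaf M) r)) k)"

definition longest :: "tree \<Rightarrow> tree" where
  "longest Fs = left (tfilter (\<lambda>F. \<forall>F'\<in>tset Fs. shorter F' F) Fs)"

text \<open>The substitute for the modular width, which the program is not given.\<close>

definition max_reps :: "tree \<Rightarrow> tree" where
  "max_reps M = longest (tmap (\<lambda>C. reps M C) (comps M))"

section \<open>Polynomial running time of the algorithm\<close>

lemma ptime_arg4: "ptime (\<lambda>e. arg (drop m1 (drop m2 (drop m3 (drop m4 e)))) i)"
  by (simp add: feasible_arg)

lemma ptime_one: "ptime (\<lambda>e. one)"
  unfolding one_def by (intro ptime_rules)

lemmas algorithm_rules = ptime_rules ptime_arg4 ptime_one

lemma ptime_adj: "ptime f \<Longrightarrow> ptime g \<Longrightarrow> ptime h \<Longrightarrow> ptime_test (\<lambda>e. adj (f e) (g e) (h e))"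
  unfolding adj_def by (intro algorithm_rules)

lemma ptime_positions: "ptime f \<Longrightarrow> ptime (\<lambda>e. positions (f e))"
proof (rule ptime_comp1[where F=positions])
  have list: "foldr (\<lambda>_ a. Node (to_unary a) a) xs Leaf = encode_list (map unary (rev [0..<length xs]))"
    for xs :: "tree list"
    by (induction xs) (simp_all add: to_unary_conv)
  have size: "tree_size (encode_list (map unary (rev [0..<n]))) \<le> n * (2 * n + 2) + 1" for n
  proof (induction n)
    case (Suc n)
    then show ?case by (simp add: tree_size_unary algebra_simps)
  qed simp
  show "ptime (\<lambda>e. positions (arg e 0))"
    unfolding positions_def
  proof (rule ptime_fold[where S="\<lambda>e. tree_size (arg e 0) * (2 * tree_size (arg e 0) + 2) + 1"])
    show "poly_bounded esize (\<lambda>e. tree_size (arg e 0) * (2 * tree_size (arg e 0) + 2) + 1)"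
      by (intro poly_bounded_add poly_bounded_mult poly_bounded_const feasible_size ptime_arg)
    fix e zs ys
    assume "tlist (arg e 0) = zs @ ys"
    then have n: "length ys \<le> tree_size (arg e 0)" using length_tlist_le[of "arg e 0"] by simp
    have "tree_size (foldr (\<lambda>_ a. Node (to_unary a) a) ys Leaf) \<le> length ys * (2 * length ys + 2) + 1"
      unfolding list by (rule size)
    also have "\<dots> \<le> tree_size (arg e 0) * (2 * tree_size (arg e 0) + 2) + 1"
      using n by (intro add_mono mult_le_mono) simp_all
    finally show "tree_size (foldr (\<lambda>_ a. Node (to_unary a) a) ys Leaf)
      \<le> tree_size (arg e 0) * (2 * tree_size (arg e 0) + 2) + 1" .
  qed (intro ptime_to_unary algorithm_rules)+
qed

lemma ptime_has: "ptime f \<Longrightarrow> ptime g \<Longrightarrow> ptime_test (\<lambda>e. has (f e) (g e))"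
  by (rule ptime_comp2[where F="\<lambda>x a. encode_bool (has x a)"])
    (simp_all only: has_def, intro algorithm_rules)

lemma ptime_closure_step: "ptime f1 \<Longrightarrow> ptime f2 \<Longrightarrow> ptime f3 \<Longrightarrow> ptime f4 \<Longrightarrow> ptime f5 \<Longrightarrow>
  ptime (\<lambda>e. closure_step (f1 e) (f2 e) (f3 e) (f4 e) (f5 e))"
  by (rule ptime_comp5[where F=closure_step])
    (simp_all only: closure_step_def, intro algorithm_rules ptime_has ptime_adj)

lemma ptime_tclosure: "ptime f1 \<Longrightarrow> ptime f2 \<Longrightarrow> ptime f3 \<Longrightarrow> ptime f4 \<Longrightarrow> ptime f5 \<Longrightarrow>
  ptime (\<lambda>e. tclosure (f1 e) (f2 e) (f3 e) (f4 e) (f5 e))"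
proof (rule ptime_comp5[where F=tclosure])
  show "ptime (\<lambda>e. tclosure (arg e 0) (arg e 1) (arg e 2) (arg e 3) (arg e 4))"
    unfolding tclosure_def
  proof (rule ptime_fold[where S="\<lambda>e. tree_size (arg e 3) + tree_size (arg e 4)"])
    show "poly_bounded esize (\<lambda>e. tree_size (arg e 3) + tree_size (arg e 4))"
      by (intro poly_bounded_add feasible_size ptime_arg)
    fix e and ys :: "tree list"
    show "tree_size (foldr (\<lambda>_. closure_step (arg e 0) (arg e 1) (arg e 2) (arg e 3)) ys (arg e 4))
        \<le> tree_size (arg e 3) + tree_size (arg e 4)"
      \<comment> \<open>From the first step on, each value is a sublist of \<open>C\<close>, so its
        size does not grow with the number of iterations.\<close>
      by (cases ys) (auto simp: closure_step_def intro: le_trans[OF tree_size_tfilter])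
  qed (intro ptime_closure_step algorithm_rules)+
qed

lemma ptime_co_component: "ptime f \<Longrightarrow> ptime g \<Longrightarrow> ptime (\<lambda>e. co_component (f e) (g e))"
  unfolding co_component_def by (intro ptime_tclosure algorithm_rules)

lemma ptime_tsim: "ptime f \<Longrightarrow> ptime g \<Longrightarrow> ptime h \<Longrightarrow> ptime i \<Longrightarrow> ptime_test (\<lambda>e. tsim (f e) (g e) (h e) (i e))"
  unfolding tsim_def by (intro ptime_tclosure ptime_co_component ptime_has algorithm_rules)

lemma ptime_tcls: "ptime f \<Longrightarrow> ptime g \<Longrightarrow> ptime h \<Longrightarrow> ptime (\<lambda>e. tcls (f e) (g e) (h e))"
  by (rule ptime_comp3[where F=tcls]) (simp_all only: tcls_def, intro ptime_tsim algorithm_rules)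

lemma ptime_universals: "ptime f \<Longrightarrow> ptime g \<Longrightarrow> ptime (\<lambda>e. universals (f e) (g e))"
  by (rule ptime_comp2[where F=universals]) (simp_all only: universals_def, intro ptime_adj algorithm_rules)

lemma ptime_trep: "ptime f \<Longrightarrow> ptime g \<Longrightarrow> ptime (\<lambda>e. trep (f e) (g e))"
  unfolding trep_def by (intro ptime_universals algorithm_rules)

lemma ptime_tquot: "ptime f \<Longrightarrow> ptime g \<Longrightarrow> ptime h \<Longrightarrow> ptime (\<lambda>e. tquot (f e) (g e) (h e))"
  unfolding tquot_def by (intro ptime_trep ptime_tcls)

lemma ptime_reps: "ptime f \<Longrightarrow> ptime g \<Longrightarrow> ptime (\<lambda>e. reps (f e) (g e))"
  by (rule ptime_comp2[where F=reps]) (simp_all only: reps_def, intro ptime_tquot algorithm_rules)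

lemma ptime_tconn: "ptime f \<Longrightarrow> ptime g \<Longrightarrow> ptime_test (\<lambda>e. tconn (f e) (g e))"
  unfolding tconn_def by (intro ptime_tclosure algorithm_rules)

lemma ptime_tdemand: "ptime f \<Longrightarrow> ptime g \<Longrightarrow> ptime h \<Longrightarrow> ptime (\<lambda>e. tdemand (f e) (g e) (h e))"
  by (rule ptime_comp3[where F=tdemand]) (simp_all only: tdemand_def, intro ptime_has algorithm_rules)

lemma ptime_thall: "ptime f1 \<Longrightarrow> ptime f2 \<Longrightarrow> ptime f3 \<Longrightarrow> ptime f4 \<Longrightarrow> ptime f5 \<Longrightarrow>
  ptime_test (\<lambda>e. thall (f1 e) (f2 e) (f3 e) (f4 e) (f5 e))"
  by (rule ptime_comp5[where F="\<lambda>a b c d e. encode_bool (thall a b c d e)"])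
    (simp_all only: thall_def, intro ptime_has ptime_tquot ptime_tdemand algorithm_rules)

lemma ptime_tvalid: "ptime f1 \<Longrightarrow> ptime f2 \<Longrightarrow> ptime f3 \<Longrightarrow> ptime f4 \<Longrightarrow> ptime f5 \<Longrightarrow>
  ptime_test (\<lambda>e. tvalid (f1 e) (f2 e) (f3 e) (f4 e) (f5 e))"
  by (rule ptime_comp5[where F="\<lambda>a b c d e. encode_bool (tvalid a b c d e)"])
    (simp_all only: tvalid_def, intro ptime_thall ptime_tconn ptime_adj algorithm_rules)

lemma ptime_candidates: "ptime f1 \<Longrightarrow> ptime f2 \<Longrightarrow> ptime f3 \<Longrightarrow> ptime f4 \<Longrightarrow>
  ptime (\<lambda>e. candidates (f1 e) (f2 e) (f3 e) (f4 e))"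
  by (rule ptime_comp4[where F=candidates])
    (simp_all only: candidates_def, intro ptime_tvalid ptime_sublists ptime_reps algorithm_rules)

lemma ptime_shortest: "ptime f \<Longrightarrow> ptime (\<lambda>e. shortest (f e))"
  by (rule ptime_comp1[where F=shortest]) (simp_all only: shortest_def, intro algorithm_rules)

lemma ptime_best: "ptime f1 \<Longrightarrow> ptime f2 \<Longrightarrow> ptime f3 \<Longrightarrow> ptime f4 \<Longrightarrow>
  ptime (\<lambda>e. best (f1 e) (f2 e) (f3 e) (f4 e))"
  unfolding best_def by (intro ptime_shortest ptime_candidates)

lemma ptime_tcomp: "ptime f \<Longrightarrow> ptime g \<Longrightarrow> ptime (\<lambda>e. tcomp (f e) (g e))"
  unfolding tcomp_def by (intro ptime_tclosure ptime_positions algorithm_rules)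

lemma ptime_comps: "ptime f \<Longrightarrow> ptime (\<lambda>e. comps (f e))"
  by (rule ptime_comp1[where F=comps])
    (simp_all only: comps_def, intro ptime_tcomp ptime_positions algorithm_rules)

lemma ptime_total_best: "ptime f \<Longrightarrow> ptime g \<Longrightarrow> ptime h \<Longrightarrow> ptime (\<lambda>e. total_best (f e) (g e) (h e))"
  by (rule ptime_comp3[where F=total_best])
    (simp_all only: total_best_def, intro ptime_best ptime_comps algorithm_rules)

lemma ptime_decide: "ptime_test (\<lambda>e. decide (arg e 0) (arg e 1) (arg e 2) (arg e 3))"
  unfolding decide_def
  by (intro ptime_total_best ptime_capped_value ptime_best ptime_comps algorithm_rules)

lemma ptime_longest: "ptime f \<Longrightarrow> ptime (\<lambda>e. longest (f e))"
  by (rule ptime_comp1[where F=longest]) (simp_all only: longest_def, intro algorithm_rules)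

lemma ptime_max_reps: "ptime f \<Longrightarrow> ptime (\<lambda>e. max_reps (f e))"
  by (rule ptime_comp1[where F=max_reps])
    (simp_all only: max_reps_def, intro ptime_longest ptime_reps ptime_comps algorithm_rules)

section \<open>The cut-off list and the cost of the whole program\<close>

definition doubly_exponential :: "tree \<Rightarrow> tree" where
  "doubly_exponential n = doubling (doubling n (unary 1)) (unary 1)"

lemma tlen_doubly_exponential: "tlen (doubly_exponential n) = 2 ^ 2 ^ tlen n"
  by (simp only: doubly_exponential_def doubling_unary tlist_unary length_replicate mult_1)

lemma feasible_doubling_comp:
  assumes f: "feasible \<mu> f" and \<mu>: "poly_bounded \<mu> (\<lambda>e. 2 ^ tlen (f e))"
  shows "feasible \<mu> (\<lambda>e. doubling (f e) (unary 1))"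
proof -
  have "poly_bounded \<mu> (\<lambda>e. (tree_size (f e) + tree_size (unary 1)) + 2 ^ tlen (f e))"
    by (intro poly_bounded_add feasible_size[OF f] poly_bounded_const \<mu>)
  then show ?thesis
    using feasible_call[OF feasible_doubling, of "[f, \<lambda>e. unary 1]" \<mu>] f feasible_unary by auto
qed

text \<open>The second summand is the length of the cut-off list; everything else is polynomial in
  the size of the input and of this list.\<close>

definition main_measure :: "tree list \<Rightarrow> nat" where
  "main_measure e = esize e + 2 ^ 2 ^ tlen (max_reps (left (arg e 0)))"

lemma feasible_main: "feasible main_measure
  (\<lambda>e. encode_bool (decide (doubly_exponential (max_reps (left (arg e 0))))
     (left (arg e 0)) (left (right (arg e 0))) (right (right (arg e 0)))))"
proof -
  let ?n = "\<lambda>e. max_reps (left (arg e 0))"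
  have base: "feasible main_measure f" if "ptime f" for f
    using that by (rule feasible_measure) (rule poly_bounded_mono[OF poly_bounded_self], simp add: main_measure_def)
  have n: "feasible main_measure ?n" by (intro base ptime_max_reps algorithm_rules)
  have le: "poly_bounded main_measure (\<lambda>e. 2 ^ 2 ^ tlen (?n e))" "poly_bounded main_measure (\<lambda>e. 2 ^ tlen (?n e))"
    by (rule poly_bounded_mono[OF poly_bounded_self], simp add: main_measure_def less_imp_le[OF less_exp] trans_le_add2)+
  have 1: "feasible main_measure (\<lambda>e. doubling (?n e) (unary 1))"
    by (rule feasible_doubling_comp[OF n le(2)])
  have "feasible main_measure (\<lambda>e. doubly_exponential (?n e))"
    unfolding doubly_exponential_def
    by (rule feasible_doubling_comp[OF 1])
      (simp only: doubling_unary tlist_unary length_replicate mult_1 le)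
  then show ?thesis
    by (rule ptime_comp4[where F="\<lambda>a b c d. encode_bool (decide a b c d)", OF ptime_decide])
      (intro base algorithm_rules)+
qed

section \<open>Correctness of the algorithm\<close>

text \<open>As long as the cut-off does not take effect, the enumerated lists correspond one to one
  to the subsets. This turns sums over lists into sums over sets.\<close>

lemma sublists_props:
  assumes "2 ^ tlen t \<le> tlen z" "distinct (tlist t)"
  shows "tlen (sublists z t) = 2 ^ tlen t" "distinct (tlist (sublists z t))"
    "tset ` tset (sublists z t) = Pow (tset t)" "inj_on tset (tset (sublists z t))"
    "s \<in> tset (sublists z t) \<Longrightarrow> distinct (tlist s)"
proof -
  have list: "tlist (sublists z t) = map encode_list (subseqs (tlist t))"
    using sublists_conv[OF assms(1)] by simp
  show "tlen (sublists z t) = 2 ^ tlen t" by (simp add: list length_subseqs)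
  have "map tset (tlist (sublists z t)) = map set (subseqs (tlist t))"
    by (simp add: list)
  then have "distinct (map tset (tlist (sublists z t)))"
    using distinct_set_subseqs[OF assms(2)] by simp
  then show "distinct (tlist (sublists z t))" "inj_on tset (tset (sublists z t))"
    by (simp_all only: distinct_map)
  have "tset ` tset (sublists z t) = set ` set (subseqs (tlist t))"
    unfolding list by (simp only: set_map image_image tlist_encode_list)
  then show "tset ` tset (sublists z t) = Pow (tset t)" by (simp only: subseqs_powset)
  assume "s \<in> tset (sublists z t)"
  then have "tlist s \<in> set (subseqs (tlist t))"
    unfolding list by (simp only: set_map image_iff) (metis tlist_encode_list)
  then show "distinct (tlist s)" using assms(2) by (rule subseqs_distinctD)
qed

lemma is_closure_reflexive:
  "is_closure P C A S \<Longrightarrow> is_closure (\<lambda>x X. x \<in> X \<or> P x X) C A S"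
  unfolding is_closure_def by blast

lemma left_in: "t \<noteq> Leaf \<Longrightarrow> left t \<in> tset t"
  by (cases t) auto

lemma extremal_props:
  assumes "Fs \<noteq> Leaf"
  shows "shortest Fs \<in> tset Fs" "\<And>F. F \<in> tset Fs \<Longrightarrow> tlen (shortest Fs) \<le> tlen F"
    "longest Fs \<in> tset Fs" "\<And>F. F \<in> tset Fs \<Longrightarrow> tlen F \<le> tlen (longest Fs)"
proof -
  have ne: "tset Fs \<noteq> {}" using assms by simp
  let ?A = "tfilter (\<lambda>F. \<forall>F'\<in>tset Fs. shorter F F') Fs"
  obtain F where "F \<in> tset Fs" "tlen F = Min (tlen ` tset Fs)"
    using Min_in[of "tlen ` tset Fs"] ne by fastforce
  then have "F \<in> tset ?A" by (auto simp: shorter_def)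
  then have "?A \<noteq> Leaf" by (metis tlist.simps(1) empty_iff empty_set)
  then have "shortest Fs \<in> tset ?A" unfolding shortest_def by (rule left_in)
  then show "shortest Fs \<in> tset Fs" "\<And>F. F \<in> tset Fs \<Longrightarrow> tlen (shortest Fs) \<le> tlen F"
    by (auto simp: shorter_def)
  let ?B = "tfilter (\<lambda>F. \<forall>F'\<in>tset Fs. shorter F' F) Fs"
  obtain F where "F \<in> tset Fs" "tlen F = Max (tlen ` tset Fs)"
    using Max_in[of "tlen ` tset Fs"] ne by fastforce
  then have "F \<in> tset ?B" by (auto simp: shorter_def)
  then have "?B \<noteq> Leaf" by (metis tlist.simps(1) empty_iff empty_set)
  then have "longest Fs \<in> tset ?B" unfolding longest_def by (rule left_in)
  then show "longest Fs \<in> tset Fs" "\<And>F. F \<in> tset Fs \<Longrightarrow> tlen F \<le> tlen (longest Fs)"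
    by (auto simp: shorter_def)
qed

lemma tlist_positions: "tlist (positions M) = map unary (rev [0..<tlen M])"
proof -
  have "foldr (\<lambda>_ a. Node (to_unary a) a) xs Leaf = encode_list (map unary (rev [0..<length xs]))"
    for xs :: "tree list"
    by (induction xs) (simp_all add: to_unary_conv)
  then show ?thesis unfolding positions_def by simp
qed

lemma unary_inject [simp]: "unary m = unary n \<longleftrightarrow> m = n"
  by (metis length_replicate tlist_unary)

section \<open>Vertex lists, closures and components of the encoded graph\<close>

locale tree_graph =
  fixes M :: tree
  assumes adj_sym: "\<And>u v. u \<in> unary ` {..<tlen M} \<Longrightarrow> v \<in> unary ` {..<tlen M} \<Longrightarrow> adj M u v = adj M v u"
begin

abbreviation V :: "tree set" where
  "V \<equiv> unary ` {..<tlen M}"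

abbreviation E :: "tree \<Rightarrow> tree \<Rightarrow> bool" where
  "E \<equiv> adj M"

definition vlist :: "tree \<Rightarrow> bool" where
  "vlist C \<longleftrightarrow> tset C \<subseteq> V \<and> distinct (tlist C)"

lemma same_length_V: "x \<in> V \<Longrightarrow> y \<in> V \<Longrightarrow> same_length x y \<longleftrightarrow> x = y"
  by (auto simp: same_length_def)

lemma has_iff: "x \<in> V \<Longrightarrow> tset A \<subseteq> V \<Longrightarrow> has x A \<longleftrightarrow> x \<in> tset A"
  unfolding has_def by (metis same_length_V subsetD)

lemma tlen_vlist: "vlist C \<Longrightarrow> tlen C = card (tset C)"
  by (simp add: vlist_def distinct_card)

lemma vlist_filter: "vlist C \<Longrightarrow> vlist (tfilter P C)"
  by (auto simp: vlist_def)

lemma same_length_subset: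
  assumes "vlist A" "vlist C" "tset A \<subseteq> tset C"
  shows "same_length A C \<longleftrightarrow> tset A = tset C"
proof
  assume "same_length A C"
  then have "card (tset A) = card (tset C)" using assms by (simp add: same_length_def tlen_vlist)
  then show "tset A = tset C" using assms(3) by (intro card_subset_eq) simp_all
qed (use assms in \<open>simp add: same_length_def tlen_vlist\<close>)

lemma vlist_positions: "vlist (positions M)" "tset (positions M) = V"
  by (auto simp: vlist_def tlist_positions distinct_map inj_on_def)

definition spread :: "tree \<Rightarrow> tree \<Rightarrow> tree \<Rightarrow> tree set \<Rightarrow> bool" where
  "spread p p' x X \<longleftrightarrow> (p \<noteq> Leaf \<longrightarrow> (\<exists>y\<in>X. E x y)) \<and> (p' \<noteq> Leaf \<longrightarrow> (\<exists>y\<in>X. \<not> E x y))"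

lemma tclosure_closure:
  assumes C: "vlist C" and A: "tset A \<subseteq> tset C"
  shows "is_closure (spread p p') (tset C) (tset A) (tset (tclosure M p p' C A))"
proof -
  let ?g = "closure_step M p p' C"
  define f where "f X = {x\<in>tset C. x \<in> X \<or> (x \<in> X \<or> spread p p' x X)}" for X
  have CV: "tset C \<subseteq> V" using C by (simp add: vlist_def)
  have fold: "foldr (\<lambda>_ a. ?g a) xs A = (?g ^^ length xs) A" for xs :: "tree list"
    by (induction xs) simp_all
  have step: "tset (?g a) = f (tset a)" if "tset a \<subseteq> tset C" for a
  proof -
    have "has x a \<longleftrightarrow> x \<in> tset a" if "x \<in> tset C" for x
      using has_iff[of x a] that \<open>tset a \<subseteq> tset C\<close> CV by blast
    then show ?thesis unfolding closure_step_def f_def spread_def by auto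
  qed
  have "tset ((?g ^^ n) A) = (f ^^ n) (tset A) \<and> tset ((?g ^^ n) A) \<subseteq> tset C" for n
  proof (induction n)
    case (Suc n)
    have "tset ((?g ^^ n) A) \<subseteq> tset C" using Suc by blast
    from step[OF this] have "tset ((?g ^^ Suc n) A) = f (tset ((?g ^^ n) A))" by simp
    then show ?case using Suc by (auto simp: f_def)
  qed (use A in simp)
  then have "tset (tclosure M p p' C A) = (f ^^ tlen C) (tset A)"
    unfolding tclosure_def fold by blast
  also have "tlen C = card (tset C)" using C by (rule tlen_vlist)
  finally have eq: "tset (tclosure M p p' C A) = (f ^^ card (tset C)) (tset A)" .
  have "is_closure (\<lambda>x X. x \<in> X \<or> spread p p' x X) (tset C) (tset A) ((f ^^ card (tset C)) (tset A))"
  proof (rule is_closure_funpow)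
    show "x \<in> Y \<or> spread p p' x Y" if "x \<in> X \<or> spread p p' x X" "X \<subseteq> Y" for x X Y
      using that unfolding spread_def by blast
  qed (simp_all add: A f_def)
  then show ?thesis unfolding eq is_closure_def by blast
qed

lemma vlist_tclosure:
  assumes C: "vlist C" "C \<noteq> Leaf"
  shows "vlist (tclosure M p p' C A)" "tset (tclosure M p p' C A) \<subseteq> tset C"
    "\<exists>P. tclosure M p p' C A = tfilter P C"
proof -
  \<comment> \<open>As \<open>C\<close> is nonempty at least one step is performed, and its result
    is a filter of \<open>C\<close> whatever \<open>A\<close> is.\<close>
  obtain x xs where "tlist C = x # xs" using C(2) by (cases C) auto
  then show *: "\<exists>P. tclosure M p p' C A = tfilter P C"
    unfolding tclosure_def by (simp add: closure_step_def) blast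
  then show "vlist (tclosure M p p' C A)" "tset (tclosure M p p' C A) \<subseteq> tset C"
    using vlist_filter[OF C(1)] by auto
qed

lemma spread_reach: "spread one Leaf = (\<lambda>x X. \<exists>y\<in>X. E x y)"
  and spread_coreach: "spread Leaf one = (\<lambda>x X. \<exists>y\<in>X. \<not> E x y)"
  and spread_both: "spread one one = (\<lambda>x X. (\<exists>y\<in>X. E x y) \<and> (\<exists>y\<in>X. \<not> E x y))"
  by (auto simp: spread_def one_def fun_eq_iff)

lemma tconn_iff:
  assumes S: "vlist S"
  shows "tconn M S \<longleftrightarrow> conn E (tset S)"
proof (cases "S = Leaf")
  case True
  then show ?thesis by (simp add: tconn_def conn_def)
next
  case False
  let ?T = "tclosure M one Leaf S (Node (left S) Leaf)"
  have sym: "E x y = E y x" if "x \<in> tset S" "y \<in> tset S" for x y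
    using S that by (intro adj_sym) (auto simp: vlist_def)
  have "is_closure (\<lambda>x X. \<exists>y\<in>X. E x y) (tset S) {left S} (tset ?T)"
    using tclosure_closure[OF S, of "Node (left S) Leaf" one Leaf] left_in[OF False]
    by (simp add: spread_reach)
  then have "conn E (tset S) \<longleftrightarrow> tset ?T = tset S"
    using left_in[OF False] sym by (rule conn_iff_closure)
  also have "\<dots> \<longleftrightarrow> same_length ?T S"
    using same_length_subset[OF vlist_tclosure(1)[OF S False] S vlist_tclosure(2)[OF S False]] by simp
  finally show ?thesis using False by (simp add: tconn_def)
qed

text \<open>By the last claim the list is determined by its set of vertices, so equal components are
  equal trees.\<close>

lemma tcomp_component:
  assumes v: "v \<in> V"
  shows "component E V (tset (tcomp M v))" "v \<in> tset (tcomp M v)" "vlist (tcomp M v)"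
    "tcomp M v = tfilter (\<lambda>x. x \<in> tset (tcomp M v)) (positions M)"
proof -
  have ne: "positions M \<noteq> Leaf" using v vlist_positions(2) by auto
  have "is_closure (\<lambda>x X. \<exists>y\<in>X. E x y) V {v} (tset (tcomp M v))"
    using tclosure_closure[OF vlist_positions(1), of "Node v Leaf" one Leaf] v
    by (simp add: spread_reach vlist_positions(2) tcomp_def)
  note cl = closure_conn[OF this v adj_sym]
  show "v \<in> tset (tcomp M v)" using cl(1) by blast
  show "component E V (tset (tcomp M v))"
    unfolding component_def
  proof (intro conjI ballI)
    show "tset (tcomp M v) \<subseteq> V" using cl(2) by blast
    show "conn E (tset (tcomp M v))" using cl(3) by blast
    fix x y
    assume xy: "x \<in> tset (tcomp M v)" "y \<in> V - tset (tcomp M v)"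
    then show "\<not> E y x" using cl(4) by blast
    then show "\<not> E x y" using adj_sym[of x y] xy cl(2) by blast
  qed
  show "vlist (tcomp M v)" unfolding tcomp_def by (rule vlist_tclosure[OF vlist_positions(1) ne])
  obtain P where P: "tcomp M v = tfilter P (positions M)"
    unfolding tcomp_def using vlist_tclosure(3)[OF vlist_positions(1) ne] by blast
  then show "tcomp M v = tfilter (\<lambda>x. x \<in> tset (tcomp M v)) (positions M)"
    by (auto simp: tfilter_def intro: filter_cong)
qed

lemma tcomp_eq:
  assumes "v \<in> V" "w \<in> V" "x \<in> tset (tcomp M v)" "x \<in> tset (tcomp M w)"
  shows "tcomp M v = tcomp M w"
proof -
  have "tset (tcomp M v) = tset (tcomp M w)"
  proof (rule subset_antisym)
    have conn: "conn E (tset (tcomp M u))" "tset (tcomp M u) \<subseteq> V" if "u \<in> V" for u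
      using tcomp_component(1)[OF that] by (simp_all add: component_def)
    show "tset (tcomp M v) \<subseteq> tset (tcomp M w)"
      using conn_subset_component[OF tcomp_component(1)[OF assms(2)] conn[OF assms(1)] assms(3,4)] .
    show "tset (tcomp M w) \<subseteq> tset (tcomp M v)"
      using conn_subset_component[OF tcomp_component(1)[OF assms(1)] conn[OF assms(2)] assms(4,3)] .
  qed
  then show ?thesis using tcomp_component(4) assms(1,2) by metis
qed

lemma comps_props:
  shows "C \<in> tset (comps M) \<Longrightarrow> vlist C \<and> component E V (tset C)"
    "(\<Union>C\<in>tset (comps M). tset C) = V"
    "C \<in> tset (comps M) \<Longrightarrow> C' \<in> tset (comps M) \<Longrightarrow> C \<noteq> C' \<Longrightarrow> tset C \<inter> tset C' = {}"
    "distinct (tlist (comps M))"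
proof -
  let ?L = "tfilter (\<lambda>v. same_length (left (tcomp M v)) v) (positions M)"
  have left: "left (tcomp M v) \<in> tset (tcomp M v)" if "v \<in> V" for v
    using tcomp_component(2)[OF that] by (intro left_in) auto
  have sub: "tset (tcomp M v) \<subseteq> V" if "v \<in> V" for v
    using tcomp_component(3)[OF that] by (simp add: vlist_def)
  have "same_length (left (tcomp M v)) v \<longleftrightarrow> left (tcomp M v) = v" if "v \<in> V" for v
    using that left[OF that] sub[OF that] by (intro same_length_V) blast+
  then have L: "tset ?L = {v\<in>V. left (tcomp M v) = v}"
    unfolding tlist_tfilter set_filter vlist_positions(2) by blast
  have comps: "tset (comps M) = tcomp M ` {v\<in>V. left (tcomp M v) = v}"
    unfolding comps_def tlist_tmap set_map L ..
  show "C \<in> tset (comps M) \<Longrightarrow> vlist C \<and> component E V (tset C)"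
    unfolding comps using tcomp_component by blast
  show "(\<Union>C\<in>tset (comps M). tset C) = V"
  proof
    show "(\<Union>C\<in>tset (comps M). tset C) \<subseteq> V" unfolding comps using sub by blast
    show "V \<subseteq> (\<Union>C\<in>tset (comps M). tset C)"
    proof
      fix v
      assume v: "v \<in> V"
      let ?w = "left (tcomp M v)"
      have w: "?w \<in> V" using left[OF v] sub[OF v] by blast
      \<comment> \<open>The first vertex of a component generates the same component, hence it
        passes the test in \<open>comps\<close>.\<close>
      have "tcomp M ?w = tcomp M v"
        using tcomp_eq[OF w v tcomp_component(2)[OF w] left[OF v]] .
      then have "tcomp M v \<in> tset (comps M)" unfolding comps using w by (metis (mono_tags, lifting) image_eqI mem_Collect_eq)
      then show "v \<in> (\<Union>C\<in>tset (comps M). tset C)" using tcomp_component(2)[OF v] by blast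
    qed
  qed
  show "C \<in> tset (comps M) \<Longrightarrow> C' \<in> tset (comps M) \<Longrightarrow> C \<noteq> C' \<Longrightarrow> tset C \<inter> tset C' = {}"
    unfolding comps using tcomp_eq by blast
  have "distinct (tlist ?L)" using vlist_filter[OF vlist_positions(1)] by (simp add: vlist_def)
  \<comment> \<open>On the selected vertices, taking the first element undoes
    \<open>tcomp\<close>.\<close>
  moreover have "inj_on (tcomp M) (tset ?L)"
    unfolding L by (rule inj_on_inverseI[where g=left]) simp
  ultimately show "distinct (tlist (comps M))" by (simp add: comps_def distinct_map)
qed

end

section \<open>The quotient of a single component\<close>

locale tree_component = tree_graph +
  fixes C :: tree
  assumes C: "vlist C" and conn_C: "conn E (tset C)"
begin

abbreviation rep_of :: "tree set \<Rightarrow> tree" where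
  "rep_of X \<equiv> trep M (tfilter (\<lambda>x. x \<in> X) C)"

lemma C_sub: "tset C \<subseteq> V"
  using C by (simp add: vlist_def)

lemma C_ne: "C \<noteq> Leaf"
  using conn_C by (auto simp: conn_def)

lemma co_component_closure:
  "is_closure (\<lambda>x X. \<exists>a\<in>X. \<not> E x a) (tset C) {left C} (tset (co_component M C))"
  using tclosure_closure[OF C, of "Node (left C) Leaf" Leaf one] left_in[OF C_ne]
  by (simp add: spread_coreach co_component_def)

lemma universals_set:
  "tset X \<subseteq> V \<Longrightarrow> tset (universals M X) = {x\<in>tset X. \<forall>y\<in>tset X. y = x \<or> E x y}"
proof -
  assume "tset X \<subseteq> V"
  then have "same_length x y \<longleftrightarrow> y = x" if "x \<in> tset X" "y \<in> tset X" for x y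
    using that same_length_V[of x y] by blast
  then show ?thesis unfolding universals_def by auto
qed

lemma sym_C: "x \<in> tset C \<Longrightarrow> y \<in> tset C \<Longrightarrow> E x y = E y x"
  by (rule adj_sym) (use C_sub in blast)+

sublocale connected_part E "tset C" "tset (co_component M C)" rep_of
proof
  note cl = closure_conn[OF co_component_closure left_in[OF C_ne]]
  have sym': "(\<not> E x y) = (\<not> E y x)" if "x \<in> tset C" "y \<in> tset C" for x y
    using sym_C that by blast
  show "finite (tset C)" by simp
  show "E x y = E y x" if "x \<in> tset C" "y \<in> tset C" for x y using that by (rule sym_C)
  show "conn E (tset C)" by (rule conn_C)
  show "tset (co_component M C) \<subseteq> tset C" using cl(2) sym' by blast
  show "conn (\<lambda>x y. \<not> E x y) (tset (co_component M C))" using cl(3) sym' by blast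
  show "E x b" if "x \<in> tset C" "x \<notin> tset (co_component M C)" "b \<in> tset (co_component M C)" for x b
    using cl(4)[of x b] sym' that by blast
  have X: "tset (tfilter (\<lambda>x. x \<in> X) C) = X" if "X \<subseteq> tset C" for X using that by auto
  show "rep_of X \<in> X" if "X \<subseteq> tset C" "X \<noteq> {}" for X
  proof -
    let ?X = "tfilter (\<lambda>x. x \<in> X) C"
    have "?X \<noteq> Leaf" using that X[OF that(1)] by (metis empty_set tlist.simps(1))
    then have "trep M ?X \<in> tset ?X \<union> tset (universals M ?X)"
      unfolding trep_def using left_in[of ?X] left_in[of "universals M ?X"] by (auto simp del: tlist_tfilter)
    also have "\<dots> \<subseteq> tset ?X" by (auto simp: universals_def)
    also have "\<dots> = X" by (rule X[OF that(1)])
    finally show ?thesis .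
  qed
  show "\<forall>y\<in>X. y = rep_of X \<or> E (rep_of X) y"
    if "X \<subseteq> tset C" "x \<in> X" "\<forall>y\<in>X. y = x \<or> E x y" for X x
  proof -
    let ?X = "tfilter (\<lambda>x. x \<in> X) C"
    have u: "tset (universals M ?X) = {x\<in>X. \<forall>y\<in>X. y = x \<or> E x y}"
    proof -
      have "tset ?X \<subseteq> V" unfolding X[OF that(1)] using that(1) C_sub by (rule subset_trans)
      from universals_set[OF this] show ?thesis unfolding X[OF that(1)] .
    qed
    have "x \<in> tset (universals M ?X)" unfolding u using that(2,3) by simp
    then have ne: "universals M ?X \<noteq> Leaf" by (metis empty_iff empty_set tlist.simps(1))
    then have "trep M ?X \<in> tset (universals M ?X)" unfolding trep_def using left_in by simp
    then show ?thesis unfolding u by simp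
  qed
qed

lemma tsim_iff:
  assumes "u \<in> tset C" "v \<in> tset C"
  shows "tsim M C u v \<longleftrightarrow> sim u v"
proof -
  let ?B = "co_component M C"
  let ?T = "tclosure M one one C (Node u (Node v Leaf))"
  have B: "vlist ?B" "tset ?B \<subseteq> tset C"
    unfolding co_component_def by (rule vlist_tclosure[OF C C_ne])+
  have "is_closure (\<lambda>x X. (\<exists>a\<in>X. E x a) \<and> (\<exists>a\<in>X. \<not> E x a)) (tset C) {u, v} (tset ?T)"
    using tclosure_closure[OF C, of "Node u (Node v Leaf)" one one] assms by (simp add: spread_both)
  from closure_modl[OF is_closure_reflexive[OF this]] have T:
    "tset ?T \<noteq> tset C \<longleftrightarrow> (\<exists>M'. modl E (tset C) M' \<and> u \<in> M' \<and> v \<in> M' \<and> M' \<noteq> tset C)" by simp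
  have same: "same_length ?T C \<longleftrightarrow> tset ?T = tset C" "same_length ?B C \<longleftrightarrow> tset ?B = tset C"
    by (rule same_length_subset[OF vlist_tclosure(1)[OF C C_ne] C vlist_tclosure(2)[OF C C_ne]],
        rule same_length_subset[OF B(1) C B(2)])
  have uv: "u \<in> V" "v \<in> V" "tset ?B \<subseteq> V" using assms B C_sub by blast+
  show ?thesis
    unfolding tsim_def sim_def same same_length_V[OF uv(1,2)] has_iff[OF uv(1,3)] has_iff[OF uv(2,3)] T
    by (cases "tset ?B = tset C") simp_all
qed

lemma tquot_eq:
  assumes "u \<in> tset C"
  shows "tquot M C u = quot u"
proof -
  have "tcls M C u = tfilter (\<lambda>v. v \<in> cls u) C"
    unfolding tcls_def tfilter_def cls_def using tsim_iff[OF assms] by (simp cong: filter_cong)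
  then show ?thesis by (simp add: tquot_def quot_def)
qed

lemma reps_props: "vlist (reps M C)" "tset (reps M C) = quot ` tset C"
proof -
  show "vlist (reps M C)" unfolding reps_def using C by (rule vlist_filter)
  have "same_length (tquot M C u) u \<longleftrightarrow> quot u = u" if "u \<in> tset C" for u
    using same_length_V[of "quot u" u] sim_quot(1)[OF that] that C_sub tquot_eq[OF that] by auto
  then have "tset (reps M C) = {u\<in>tset C. quot u = u}" unfolding reps_def by auto
  also have "\<dots> = quot ` tset C" using q_q q_in by force
  finally show "tset (reps M C) = quot ` tset C" .
qed

end

section \<open>Exhaustive search for an optimal valid family\<close>

context tree_component
begin

context
  fixes z :: tree and r :: nat
  assumes z: "2 ^ 2 ^ tlen (reps M C) \<le> tlen z" and r: "0 < r"
begin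

abbreviation Us :: tree where
  "Us \<equiv> sublists z (reps M C)"

definition family :: "tree \<Rightarrow> tree set set" where
  "family F = tset ` tset F"

lemma Us_props: "tlen Us = 2 ^ tlen (reps M C)" "distinct (tlist Us)"
    "tset ` tset Us = Pow (quot ` tset C)" "inj_on tset (tset Us)" "U \<in> tset Us \<Longrightarrow> vlist U"
proof -
  \<comment> \<open>Enumerating the sets of representatives takes only one exponential; the second
    one is for families of such sets.\<close>
  have "2 ^ tlen (reps M C) \<le> tlen z"
    using z less_exp[of "2 ^ tlen (reps M C)"] by linarith
  moreover have "distinct (tlist (reps M C))" using reps_props(1) by (simp add: vlist_def)
  ultimately have *: "tlen Us = 2 ^ tlen (reps M C)" "distinct (tlist Us)"
    "tset ` tset Us = Pow (tset (reps M C))" "inj_on tset (tset Us)"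
    "\<And>U. U \<in> tset Us \<Longrightarrow> distinct (tlist U)"
    using sublists_props[of "reps M C" z] by blast+
  then show "tlen Us = 2 ^ tlen (reps M C)" "distinct (tlist Us)"
    "tset ` tset Us = Pow (quot ` tset C)" "inj_on tset (tset Us)"
    using reps_props(2) by simp_all
  assume U: "U \<in> tset Us"
  then have "tset U \<subseteq> tset (reps M C)" using *(3) by blast
  then show "vlist U" using *(5)[OF U] reps_props(1) by (auto simp: vlist_def)
qed

lemma families_props: "tset ` tset (sublists z Us) = Pow (tset Us)"
    "F \<in> tset (sublists z Us) \<Longrightarrow> distinct (tlist F) \<and> tset F \<subseteq> tset Us"
proof -
  have "2 ^ tlen Us \<le> tlen z" using z by (simp add: Us_props(1))
  note * = sublists_props[OF this Us_props(2)]
  show "tset ` tset (sublists z Us) = Pow (tset Us)" by (fact *(3))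
  then show "F \<in> tset (sublists z Us) \<Longrightarrow> distinct (tlist F) \<and> tset F \<subseteq> tset Us"
    using *(5) by blast
qed

lemma family_props:
  assumes "F \<in> tset (sublists z Us)"
  shows "finite (family F)" "card (family F) = tlen F" "inj_on tset (tset F)"
proof -
  note F = families_props(2)[OF assms]
  show inj: "inj_on tset (tset F)" using F inj_on_subset[OF Us_props(4)] by blast
  show "finite (family F)" by (simp add: family_def)
  show "card (family F) = tlen F"
    unfolding family_def card_image[OF inj] using F by (simp add: distinct_card)
qed

lemma tlen_tdemand:
  assumes "S \<in> tset Us" "U \<in> tset Us"
  shows "tlen (tdemand (unary r) S U) = demand (\<lambda>S. r) (tset S) (tset U)"
proof -
  have S: "tset S \<subseteq> V" "tset U \<subseteq> V" "distinct (tlist S)"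
    using Us_props(5) assms by (auto simp: vlist_def)
  have has: "has x U \<longleftrightarrow> x \<in> tset U" if "x \<in> tset S" for x
    using has_iff S that by blast
  have "tset (tfilter (\<lambda>x. has x U) S) = tset S \<inter> tset U" using has by auto
  then have "tlen (tfilter (\<lambda>x. has x U) S) = card (tset S \<inter> tset U)"
    using distinct_card[of "tlist (tfilter (\<lambda>x. has x U) S)"] S(3) by simp
  moreover have "(\<forall>x\<in>tset S. has x U) \<longleftrightarrow> tset S \<subseteq> tset U" using has by blast
  ultimately show ?thesis by (simp add: tdemand_def demand_def)
qed

lemma thall_iff:
  assumes F: "F \<in> tset (sublists z Us)" and U: "U \<in> tset Us"
  shows "thall M C (unary r) F U \<longleftrightarrow>
    (\<Sum>S\<in>family F. demand (\<lambda>S. r) S (tset U)) \<le> card {v\<in>tset C. quot v \<in> tset U}"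
proof -
  note F' = families_props(2)[OF F]
  have "tlen (tconcat (tmap (\<lambda>S. tdemand (unary r) S U) F)) = (\<Sum>S\<leftarrow>tlist F. tlen (tdemand (unary r) S U))"
    by (simp add: length_concat comp_def)
  also have "\<dots> = (\<Sum>S\<in>tset F. tlen (tdemand (unary r) S U))"
    using F' by (simp add: sum_list_distinct_conv_sum_set)
  also have "\<dots> = (\<Sum>S\<in>tset F. demand (\<lambda>S. r) (tset S) (tset U))"
    using F' U tlen_tdemand by (intro sum.cong) auto
  also have "\<dots> = (\<Sum>S\<in>family F. demand (\<lambda>S. r) S (tset U))"
    unfolding family_def by (rule sum.reindex[OF family_props(3)[OF F], unfolded comp_def, symmetric])
  finally have lhs: "tlen (tconcat (tmap (\<lambda>S. tdemand (unary r) S U) F)) =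
    (\<Sum>S\<in>family F. demand (\<lambda>S. r) S (tset U))" .
  have "has (tquot M C v) U \<longleftrightarrow> quot v \<in> tset U" if "v \<in> tset C" for v
  proof -
    have "quot v \<in> V" using sim_quot(1)[OF that] C_sub by blast
    moreover have "tset U \<subseteq> V" using Us_props(5)[OF U] by (simp add: vlist_def)
    ultimately show ?thesis unfolding tquot_eq[OF that] by (rule has_iff)
  qed
  then have "tset (tfilter (\<lambda>v. has (tquot M C v) U) C) = {v\<in>tset C. quot v \<in> tset U}" by auto
  moreover have "distinct (tlist (tfilter (\<lambda>v. has (tquot M C v) U) C))"
    using C by (simp add: vlist_def)
  ultimately have "tlen (tfilter (\<lambda>v. has (tquot M C v) U) C) = card {v\<in>tset C. quot v \<in> tset U}"
    using distinct_card by metis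
  with lhs show ?thesis by (simp only: thall_def shorter_def)
qed

lemma tvalid_iff:
  assumes F: "F \<in> tset (sublists z Us)"
  shows "tvalid M C (unary r) Us F \<longleftrightarrow> valid r (family F)"
proof -
  have sub: "tset S \<subseteq> quot ` tset C" "vlist S" "tset S \<subseteq> V" "tset S \<subseteq> tset C" if "S \<in> tset F" for S
  proof -
    have "S \<in> tset Us" using families_props(2)[OF F] that by blast
    then show "tset S \<subseteq> quot ` tset C" "vlist S" using Us_props(3,5) by blast+
    then show "tset S \<subseteq> V" "tset S \<subseteq> tset C" using q_in C_sub by blast+
  qed
  have "tconn M S \<and> shorter S (unary r) \<and> (shorter (unary r) one \<or> shorter (Node Leaf one) S) \<longleftrightarrow>
      tset S \<subseteq> quot ` tset C \<and> conn E (tset S) \<and> card (tset S) \<le> r \<and> min 2 r \<le> card (tset S)"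
    if S: "S \<in> tset F" for S
  proof (cases "conn E (tset S)")
    case True
    then have "0 < card (tset S)" by (simp add: conn_def card_gt_0_iff)
    then have "(r \<le> 1 \<or> 2 \<le> card (tset S)) \<longleftrightarrow> min 2 r \<le> card (tset S)" using r by linarith
    then show ?thesis
      using sub(1)[OF S] True
      by (simp add: tconn_iff[OF sub(2)[OF S]] shorter_def tlen_vlist[OF sub(2)[OF S]] one_def numeral_2_eq_2)
  next
    case False
    then show ?thesis by (simp add: tconn_iff[OF sub(2)[OF S]])
  qed
  then have "(\<forall>S\<in>tset F. tconn M S \<and> shorter S (unary r) \<and> (shorter (unary r) one \<or> shorter (Node Leaf one) S)) \<longleftrightarrow>
      (\<forall>S\<in>family F. S \<subseteq> quot ` tset C \<and> conn E S \<and> card S \<le> r \<and> min 2 r \<le> card S)"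
    by (simp add: family_def)
  moreover have "(\<forall>v\<in>tset C. \<exists>S\<in>tset F. \<exists>u\<in>tset S. same_length u v \<or> adj M u v) \<longleftrightarrow>
      dominates E (\<Union>(family F)) (tset C)"
  proof -
    have same: "same_length u v \<longleftrightarrow> u = v" if "v \<in> tset C" "S \<in> tset F" "u \<in> tset S" for u v S
      by (rule same_length_V) (use sub(3)[OF that(2)] that C_sub in blast)+
    have eq: "(\<forall>v\<in>tset C. \<exists>S\<in>tset F. \<exists>u\<in>tset S. same_length u v \<or> adj M u v) \<longleftrightarrow>
        (\<forall>v\<in>tset C. \<exists>S\<in>tset F. \<exists>u\<in>tset S. u = v \<or> adj M u v)"
      using same by (intro ball_cong bex_cong refl) simp
    have "\<Union>(tset ` tset F) \<subseteq> tset C" using sub(4) by (intro Union_least) auto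
    moreover have "(\<exists>S\<in>tset F. \<exists>u\<in>tset S. u = v \<or> adj M u v) \<longleftrightarrow>
        v \<in> \<Union>(tset ` tset F) \<or> (\<exists>u\<in>\<Union>(tset ` tset F). adj M u v)" for v by blast
    ultimately show ?thesis unfolding eq dominates_def family_def by simp
  qed
  moreover have "(\<forall>U\<in>tset Us. thall M C (unary r) F U) \<longleftrightarrow> (\<forall>U\<subseteq>quot ` tset C.
      (\<Sum>S\<in>family F. demand (\<lambda>S. r) S U) \<le> card {v\<in>tset C. quot v \<in> U})"
  proof -
    have "(\<forall>U\<in>tset Us. thall M C (unary r) F U) \<longleftrightarrow> (\<forall>U\<in>tset ` tset Us.
      (\<Sum>S\<in>family F. demand (\<lambda>S. r) S U) \<le> card {v\<in>tset C. quot v \<in> U})"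
      using thall_iff[OF F] by simp
    then show ?thesis unfolding Us_props(3) by blast
  qed
  ultimately show ?thesis unfolding tvalid_def valid_def by blast
qed

lemma candidates_props:
  "F \<in> tset (candidates z M (unary r) C) \<Longrightarrow>
    finite (family F) \<and> card (family F) = tlen F \<and> valid r (family F)"
  "valid r \<F> \<Longrightarrow> \<exists>F\<in>tset (candidates z M (unary r) C). family F = \<F> \<and> tlen F = card \<F>"
proof -
  have cand: "tset (candidates z M (unary r) C) = {F\<in>tset (sublists z Us). valid r (family F)}"
    unfolding candidates_def using tvalid_iff by auto
  then show "F \<in> tset (candidates z M (unary r) C) \<Longrightarrow>
    finite (family F) \<and> card (family F) = tlen F \<and> valid r (family F)"
    using family_props by blast
  assume v: "valid r \<F>"
  \<comment> \<open>Every set of representatives is listed exactly once in \<open>Us\<close>, so a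
    family of sets is recovered by selecting the matching lists.\<close>
  let ?S = "{S\<in>tset Us. tset S \<in> \<F>}"
  have "?S \<in> tset ` tset (sublists z Us)" unfolding families_props(1) by blast
  then obtain F where F: "F \<in> tset (sublists z Us)" "tset F = ?S" by blast
  have "\<F> \<subseteq> tset ` tset Us" using v unfolding valid_def Us_props(3) by blast
  then have "family F = \<F>" unfolding family_def F(2) by blast
  then show "\<exists>F\<in>tset (candidates z M (unary r) C). family F = \<F> \<and> tlen F = card \<F>"
    using F(1) v family_props(2)[OF F(1)] unfolding cand by auto
qed

lemma best_props:
  shows "best z M (unary r) C = Leaf \<Longrightarrow> \<not> units E r (tset C) \<D>"
    "best z M (unary r) C \<noteq> Leaf \<Longrightarrow>
      \<exists>\<D>. units E r (tset C) \<D> \<and> card \<D> \<le> tlen (best z M (unary r) C)"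
    "units E r (tset C) \<D> \<Longrightarrow> tlen (best z M (unary r) C) \<le> card \<D>"
proof -
  let ?F = "candidates z M (unary r) C"
  have F_ne: "F \<noteq> Leaf" if "F \<in> tset ?F" for F
  proof
    assume "F = Leaf"
    then have "valid r {}" using candidates_props(1)[OF that] by (simp add: family_def)
    then show False using C_ne by (simp add: valid_def dominates_def)
  qed
  have le: "?F \<noteq> Leaf \<and> tlen (best z M (unary r) C) \<le> card \<D>" if u: "units E r (tset C) \<D>" for \<D>
  proof -
    have "\<exists>\<F>. finite \<F> \<and> card \<F> \<le> card \<D> \<and> valid r \<F>"
      using units_iff_valid[OF r, of "card \<D>"] u by blast
    then obtain F where "F \<in> tset ?F" "tlen F \<le> card \<D>" using candidates_props(2) by metis
    moreover from this have "?F \<noteq> Leaf" by auto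
    ultimately show ?thesis using extremal_props(2) le_trans unfolding best_def by blast
  qed
  then show "units E r (tset C) \<D> \<Longrightarrow> tlen (best z M (unary r) C) \<le> card \<D>" by blast
  have best_in: "best z M (unary r) C \<in> tset ?F" if "?F \<noteq> Leaf"
    using extremal_props(1)[OF that] by (simp add: best_def)
  then show "best z M (unary r) C = Leaf \<Longrightarrow> \<not> units E r (tset C) \<D>"
    using F_ne le by blast
  assume "best z M (unary r) C \<noteq> Leaf"
  then have "?F \<noteq> Leaf" by (auto simp: best_def shortest_def tfilter_def)
  from candidates_props(1)[OF best_in[OF this]]
  show "\<exists>\<D>. units E r (tset C) \<D> \<and> card \<D> \<le> tlen (best z M (unary r) C)"
    using units_iff_valid[OF r] by auto
qed

end

end

section \<open>Adding up the components, and the bound on the quotients\<close>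

context tree_graph
begin

lemma tree_component: "C \<in> tset (comps M) \<Longrightarrow> tree_component M C"
  using comps_props(1)
  by (intro tree_component.intro tree_component_axioms.intro tree_graph_axioms)
    (auto simp: component_def)

lemma tlen_reps_le_max: "C \<in> tset (comps M) \<Longrightarrow> tlen (reps M C) \<le> tlen (max_reps M)"
proof -
  assume "C \<in> tset (comps M)"
  then have *: "reps M C \<in> tset (tmap (\<lambda>C. reps M C) (comps M))" by simp
  then have "tmap (\<lambda>C. reps M C) (comps M) \<noteq> Leaf" by (metis empty_iff empty_set tlist.simps(1))
  then show ?thesis unfolding max_reps_def using * by (rule extremal_props(4))
qed

lemma decide_iff:
  assumes z: "2 ^ 2 ^ tlen (max_reps M) \<le> tlen z" and r: "0 < r"
  shows "decide z M (encode_nat r) (encode_nat k) \<longleftrightarrow> (\<exists>\<D>. units E r V \<D> \<and> card \<D> \<le> k)"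
proof -
  \<comment> \<open>The cap comes from the length of \<open>Node Leaf M\<close>, which is one more
    than the number of vertices.\<close>
  define r' where "r' = min (Suc (tlen M)) r"
  have r'_pos: "0 < r'" using r by (simp add: r'_def)
  have cap: "capped_value (Node Leaf M) (encode_nat r) = unary r'"
    by (simp add: capped_value_conv r'_def)
  have z': "2 ^ 2 ^ tlen (reps M C) \<le> tlen z" if "C \<in> tset (comps M)" for C
  proof -
    have "(2::nat) ^ 2 ^ tlen (reps M C) \<le> 2 ^ 2 ^ tlen (max_reps M)"
      using tlen_reps_le_max[OF that] by (intro power_increasing) simp_all
    then show ?thesis using z by linarith
  qed
  note best = tree_component.best_props[OF tree_component z' r'_pos]
  let ?b = "\<lambda>C. best z M (unary r') C"
  have "card V = tlen M" by (simp add: card_image inj_on_def)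
  then have r': "units E r' V \<D> \<longleftrightarrow> units E r V \<D>" for \<D>
    using units_cap[of V E r \<D>] by (simp add: r'_def)
  have "tlen (total_best z M (unary r')) = (\<Sum>C\<leftarrow>tlist (comps M). tlen (?b C))"
    by (simp add: total_best_def length_concat comp_def)
  also have "\<dots> = (\<Sum>C\<in>tset (comps M). tlen (?b C))"
    using comps_props(4) by (simp add: sum_list_distinct_conv_sum_set)
  finally have total: "tlen (total_best z M (unary r')) = (\<Sum>C\<in>tset (comps M). tlen (?b C))" .
  \<comment> \<open>Capping \<open>k\<close> at the total \<open>n\<close> does not affect the
    comparison: \<open>n \<le> min n k\<close> holds iff \<open>n \<le> k\<close>.\<close>
  have decide: "decide z M (encode_nat r) (encode_nat k) \<longleftrightarrow>
      (\<forall>C\<in>tset (comps M). ?b C \<noteq> Leaf) \<and> (\<Sum>C\<in>tset (comps M). tlen (?b C)) \<le> k"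
    unfolding decide_def cap unfolding shorter_def capped_value_conv by (simp add: total)
  show ?thesis
  proof (cases "\<forall>C\<in>tset (comps M). ?b C \<noteq> Leaf")
    case True
    have "(\<exists>\<D>. units E r' V \<D> \<and> card \<D> \<le> k) \<longleftrightarrow> (\<Sum>C\<in>tset (comps M). tlen (?b C)) \<le> k"
    proof (rule units_components)
      show "(\<Union>C\<in>tset (comps M). tset C) = V" by (rule comps_props(2))
      show "tset C \<inter> tset C' = {}" if "C \<in> tset (comps M)" "C' \<in> tset (comps M)" "C \<noteq> C'" for C C'
        using that by (rule comps_props(3))
      show "component E V (tset C)" if "C \<in> tset (comps M)" for C using comps_props(1)[OF that] by blast
      show "\<exists>\<D>. units E r' (tset C) \<D> \<and> card \<D> \<le> tlen (?b C)" if "C \<in> tset (comps M)" for C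
        using best(2)[OF that that] True that by blast
      show "tlen (?b C) \<le> card \<D>" if "C \<in> tset (comps M)" "units E r' (tset C) \<D>" for C \<D>
        using best(3)[OF that(1,1,2)] .
    qed simp
    then show ?thesis using True decide r' by simp
  next
    case False
    then obtain C where C: "C \<in> tset (comps M)" "?b C = Leaf" by blast
    have "\<not> units E r' V \<D>" for \<D>
      using best(1)[OF C(1,1,2)] units_restrict comps_props(1)[OF C(1)] by blast
    then show ?thesis using decide r' False by blast
  qed
qed

text \<open>A largest quotient is bounded by \<open>card_quot_le\<close>. The successor covers
  components with a single vertex, about which the assumption says nothing.\<close>

lemma tlen_max_reps_le:
  assumes "\<And>C. C \<subseteq> V \<Longrightarrow> 2 \<le> card C \<Longrightarrow> \<exists>h. h ` C \<subseteq> {..<k} \<and> (\<exists>x\<in>C. \<exists>y\<in>C. h x \<noteq> h y) \<and>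
    (\<forall>x\<in>C. \<forall>y\<in>C. \<forall>z\<in>C. h x = h y \<longrightarrow> h z \<noteq> h x \<longrightarrow> E z x = E z y)"
  shows "tlen (max_reps M) \<le> Suc k"
proof (cases "comps M = Leaf")
  case True
  then show ?thesis by (simp add: max_reps_def longest_def tmap_def tfilter_def)
next
  case False
  then have "tmap (\<lambda>C. reps M C) (comps M) \<noteq> Leaf" by (cases "comps M") (auto simp: tmap_def)
  from extremal_props(3)[OF this] obtain C where mx: "C \<in> tset (comps M)" "max_reps M = reps M C"
    by (auto simp: max_reps_def)
  interpret tree_component M C using mx(1) by (rule tree_component)
  have "tlen (reps M C) = card (quot ` tset C)"
    using tlen_vlist[OF reps_props(1)] reps_props(2) by simp
  also have "\<dots> \<le> Suc k"
  proof (cases "2 \<le> card (tset C)")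
    case True
    obtain h x y where h: "h ` tset C \<subseteq> {..<k}" "x \<in> tset C" "y \<in> tset C" "h x \<noteq> h y"
      and mod: "\<forall>x\<in>tset C. \<forall>y\<in>tset C. \<forall>z\<in>tset C. h x = h y \<longrightarrow> h z \<noteq> h x \<longrightarrow> E z x = E z y"
      using assms[OF C_sub True] by blast
    have "card (quot ` tset C) \<le> k"
      by (rule card_quot_le[OF h]) (rule mod[rule_format])
    then show ?thesis by simp
  next
    case False
    then show ?thesis using card_image_le[of "tset C" quot] by simp
  qed
  finally show ?thesis using mx(2) by simp
qed

end

section \<open>The encoded instance and the final bound\<close>

lemma encode_graph_props:
  assumes "(G, r, k) \<in> gds_instances"
  defines "M \<equiv> encode_graph G"
  shows "tree_graph M" "unary ` {..<tlen M} = unary ` pverts G"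
    "\<And>i j. i \<in> pverts G \<Longrightarrow> j \<in> pverts G \<Longrightarrow> adj M (unary i) (unary j) \<longleftrightarrow> (i, j) \<in> parcs G"
proof -
  interpret pair_graph G using assms by (simp add: gds_instances_def)
  have V: "pverts G = {..<card (pverts G)}" using assms(1) by (simp add: gds_instances_def)
  have len: "tlen M = card (pverts G)" by (simp add: M_def encode_graph_def Let_def)
  then show V': "unary ` {..<tlen M} = unary ` pverts G" using V by simp
  show adj: "adj M (unary i) (unary j) \<longleftrightarrow> (i, j) \<in> parcs G"
    if "i \<in> pverts G" "j \<in> pverts G" for i j
  proof -
    let ?n = "card (pverts G)"
    have ij: "i < ?n" "j < ?n" using that V by (metis lessThan_iff)+
    have "tnth M (unary i) = encode_list (map (\<lambda>j. encode_bool ((i, j) \<in> parcs G)) [0..<?n])"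
      using tnth_conv[of "unary i" M] ij len by (simp add: M_def encode_graph_def Let_def)
    then have "tnth (tnth M (unary i)) (unary j) = encode_bool ((i, j) \<in> parcs G)"
      using ij by (simp add: tnth_conv)
    then show ?thesis by (simp add: adj_def)
  qed
  have "(i, j) \<in> parcs G \<longleftrightarrow> (j, i) \<in> parcs G" for i j
    using sym_arcs by (auto simp: symmetric_def dest: symD)
  then show "tree_graph M"
    unfolding tree_graph_def V' using adj by blast
qed

theorem theorem10:
  "fixed_parameter_tractable gds_instances encode_gds gds_yes
     (\<lambda>(G, r, k). modular_width (with_proj G))"
proof (rule fixed_parameter_tractableI[OF feasible_main])
  fix x :: gds_instance
  assume x: "x \<in> gds_instances"
  obtain G r k where x_def: "x = (G, r, k)" by (cases x)
  define M where "M = encode_graph G"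
  note G = encode_graph_props[OF x[unfolded x_def], folded M_def]
  interpret tree_graph M by (rule G(1))
  have enc: "encode_gds x = Node M (Node (encode_nat r) (encode_nat k))"
    by (simp add: encode_gds_def x_def M_def)
  have fin: "finite (pverts G)" and r: "0 < r"
    using x pair_fin_digraph.pair_finite_verts[of G]
    by (auto simp: x_def gds_instances_def pair_graph_def pair_digraph_def)
  have inj: "inj_on unary (pverts G)" by (simp add: inj_on_def)
  have "decide (doubly_exponential (max_reps M)) M (encode_nat r) (encode_nat k) \<longleftrightarrow>
      (\<exists>\<D>. units E r (unary ` pverts G) \<D> \<and> card \<D> \<le> k)"
    unfolding G(2)[symmetric] using r by (intro decide_iff) (simp_all add: tlen_doubly_exponential)
  also have "\<dots> \<longleftrightarrow> (\<exists>\<D>. units (\<lambda>i j. (i, j) \<in> parcs G) r (pverts G) \<D> \<and> card \<D> \<le> k)"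
    using inj G(3) by (rule units_image_iff)
  also have "\<dots> \<longleftrightarrow> gds_yes x" unfolding x_def by (rule gds_yes_iff[OF x[unfolded x_def], symmetric])
  finally show "encode_bool (decide (doubly_exponential (max_reps (left (arg [encode_gds x] 0))))
      (left (arg [encode_gds x] 0)) (left (right (arg [encode_gds x] 0)))
      (right (right (arg [encode_gds x] 0)))) = encode_bool (gds_yes x)"
    by (simp add: enc)
  let ?w = "modular_width (with_proj G)"
  have "tlen (max_reps M) \<le> Suc ?w"
  proof (rule tlen_max_reps_le)
    fix C
    assume C: "C \<subseteq> V" "2 \<le> card C"
    define D where "D = {i\<in>pverts G. unary i \<in> C}"
    have CD: "C = unary ` D" using C(1) unfolding D_def G(2) by blast
    have D: "D \<subseteq> pverts G" by (auto simp: D_def)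
    have "card C = card D" unfolding CD by (rule card_image) (simp add: inj_on_def)
    then obtain h where h: "h ` D \<subseteq> {..<?w}" "\<exists>x\<in>D. \<exists>y\<in>D. h x \<noteq> h y"
        "\<forall>x\<in>D. \<forall>y\<in>D. \<forall>z\<in>D. h x = h y \<longrightarrow> h z \<noteq> h x \<longrightarrow> ((z, x) \<in> parcs G) = ((z, y) \<in> parcs G)"
      using modular_width_le_partition[OF modular_width_le_modular_width, of "with_proj G" D] D fin C(2)
      by auto
    \<comment> \<open>The length of a unary tree is the vertex number, so the labelling carries
      over.\<close>
    let ?h = "\<lambda>t. h (tlen t)"
    have "?h ` C \<subseteq> {..<?w}" "\<exists>x\<in>C. \<exists>y\<in>C. ?h x \<noteq> ?h y" using h(1,2) by (auto simp: CD)
    moreover have "\<forall>x\<in>C. \<forall>y\<in>C. \<forall>z\<in>C. ?h x = ?h y \<longrightarrow> ?h z \<noteq> ?h x \<longrightarrow> E z x = E z y"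
    proof (intro ballI impI)
      fix x y z
      assume C: "x \<in> C" "y \<in> C" "z \<in> C" "?h x = ?h y" "?h z \<noteq> ?h x"
      then obtain i j l where ijl: "x = unary i" "y = unary j" "z = unary l" "i \<in> D" "j \<in> D" "l \<in> D"
        unfolding CD by blast
      then have "((l, i) \<in> parcs G) = ((l, j) \<in> parcs G)"
        using h(3)[rule_format, OF ijl(4,5,6)] C by simp
      then show "E z x = E z y" using G(3) D ijl by (metis subsetD)
    qed
    ultimately show "\<exists>h. h ` C \<subseteq> {..<?w} \<and> (\<exists>x\<in>C. \<exists>y\<in>C. h x \<noteq> h y) \<and>
        (\<forall>x\<in>C. \<forall>y\<in>C. \<forall>z\<in>C. h x = h y \<longrightarrow> h z \<noteq> h x \<longrightarrow> E z x = E z y)" by blast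
  qed
  then have "(2::nat) ^ 2 ^ tlen (max_reps M) \<le> 2 ^ 2 ^ Suc ?w" by (intro power_increasing) simp_all
  \<comment> \<open>The possible extra representative squares the double exponential, which is why
    the exponent 2 appears in the bound on the measure.\<close>
  also have "\<dots> = (2 ^ 2 ^ ?w)\<^sup>2" by (simp add: power_mult[symmetric] mult.commute)
  finally have "main_measure [encode_gds x] \<le> tree_size (encode_gds x) + (2 ^ 2 ^ ?w)\<^sup>2"
    by (simp add: main_measure_def enc)
  also have "\<dots> \<le> (tree_size (encode_gds x) + 2 ^ 2 ^ ?w + 2)\<^sup>2"
    unfolding power2_eq_square by (simp add: algebra_simps)
  finally show "main_measure [encode_gds x] \<le> (tree_size (encode_gds x) +
      2 ^ 2 ^ (case x of (G, r, k) \<Rightarrow> modular_width (with_proj G)) + 2) ^ 2"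
    by (simp add: x_def)
qed

end
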